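(* Let $\mathcal{G}$ be a finite simplicial graph. Then the cell complex $K\mathcal{G}$ is a $K(G\mathcal{G},1)$, i.e. $\pi_1(K\mathcal{G})\cong G\mathcal{G}$ and the universal cover of $K\mathcal{G}$ is contractible.
   Context: For a finite simplicial graph $\mathcal{G}$ with vertex set $V(\mathcal{G})$, the graph group $G\mathcal{G}$ is $\langle V(\mathcal{G}) \mid xy=yx \text{ for all adjacent } x,y\in V(\mathcal{G})\rangle$. A clique of $\mathcal{G}$ is a set of pairwise adjacent vertices. Construction of $K\mathcal{G}$: let $T^n$ be the $n$-torus with the cell structure obtained from the unit Euclidean $n$-cube by identifying all opposite faces; it has a single vertex, and $n$ edges (loops). For each clique $Q_i$ of $\mathcal{G}$, let $T_i$ be a copy of $T^n$ with $n=|Q_i|$, whose $n$ edges are labelled by the vertices of $Q_i$; for each subset of $Q_i$ with $k$ elements, $T_i$ contains the corresponding subcomplex $T^k$ (the subtorus spanned by the edges with those labels). If two cliques $Q_i$ and $Q_j$ intersect in a (possibly empty) clique with $k$ vertices, identify the corresponding copies of $T^k$ in $T_i$ and $T_j$ (respecting labels and orientations of edges); in particular if $Q_i\cap Q_j=\emptyset$ then $T_i$ and $T_j$ are joined only at the single vertex. The resulting cell complex is $K\mathcal{G}$. (Its $2$-skeleton is the standard $2$-complex of the presentation of $G\mathcal{G}$ above.) *)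

theory Defs
  imports "HOL-Analysis.Analysis" "HOL-Algebra.Group"
begin

section \<open>Finite simplicial graphs and their graph groups\<close>

definition finite_simplicial_graph :: "'v set \<Rightarrow> 'v set set \<Rightarrow> bool" where
  "finite_simplicial_graph V E \<longleftrightarrow> finite V \<and> (\<forall>e\<in>E. e \<subseteq> V \<and> card e = 2)"

text \<open>The empty set is a clique; its torus is the single vertex of the complex.\<close>

definition cliques :: "'v set \<Rightarrow> 'v set set \<Rightarrow> 'v set set" where
  "cliques V E = {Q. Q \<subseteq> V \<and> (\<forall>x\<in>Q. \<forall>y\<in>Q. x \<noteq> y \<longrightarrow> {x, y} \<in> E)}"

text \<open>Words in generators and inverses: the letter \<open>(s, True)\<close> stands for \<open>s\<close> and
  \<open>(s, False)\<close> for its inverse. A relation \<open>u = v\<close> is given as the pair \<open>(u, v)\<close>.\<close>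

type_synonym 'a gword = "('a \<times> bool) list"

definition gwords :: "'a set \<Rightarrow> 'a gword set" where
  "gwords S = lists (S \<times> UNIV)"

inductive_set presentation_cong :: "'a set \<Rightarrow> ('a gword \<times> 'a gword) set \<Rightarrow> ('a gword \<times> 'a gword) set"
  for S R where
  refl: "w \<in> gwords S \<Longrightarrow> (w, w) \<in> presentation_cong S R"
| sym: "(u, v) \<in> presentation_cong S R \<Longrightarrow> (v, u) \<in> presentation_cong S R"
| trans: "(u, v) \<in> presentation_cong S R \<Longrightarrow> (v, w) \<in> presentation_cong S R
    \<Longrightarrow> (u, w) \<in> presentation_cong S R"
| cancel: "s \<in> S \<Longrightarrow> a \<in> gwords S \<Longrightarrow> b \<in> gwords S
    \<Longrightarrow> (a @ [(s, e), (s, \<not> e)] @ b, a @ b) \<in> presentation_cong S R"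
| relation: "(u, v) \<in> R \<Longrightarrow> u \<in> gwords S \<Longrightarrow> v \<in> gwords S \<Longrightarrow> a \<in> gwords S \<Longrightarrow> b \<in> gwords S
    \<Longrightarrow> (a @ u @ b, a @ v @ b) \<in> presentation_cong S R"

definition presented_group :: "'a set \<Rightarrow> ('a gword \<times> 'a gword) set \<Rightarrow> 'a gword set monoid" where
  "presented_group S R =
    \<lparr>carrier = gwords S // presentation_cong S R,
     mult = (\<lambda>A B. \<Union>u\<in>A. \<Union>v\<in>B. presentation_cong S R `` {u @ v}),
     one = presentation_cong S R `` {[]}\<rparr>"

definition graph_group :: "'v set \<Rightarrow> 'v set set \<Rightarrow> 'v gword set monoid" where
  "graph_group V E =
    presented_group V {([(x, True), (y, True)], [(y, True), (x, True)]) | x y. {x, y} \<in> E}"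

lemma presentation_cong_gwords:
  "(u, v) \<in> presentation_cong S R \<Longrightarrow> u \<in> gwords S \<and> v \<in> gwords S"
  by (induction rule: presentation_cong.induct) (auto simp: gwords_def)

lemma equiv_presentation_cong: "equiv (gwords S) (presentation_cong S R)"
  by (rule equivI)
    (auto simp: refl_on_def sym_def trans_def dest: presentation_cong_gwords
      intro: presentation_cong.intros)

lemma presentation_cong_context:
  assumes "(u, v) \<in> presentation_cong S R" "c \<in> gwords S" "d \<in> gwords S"
  shows "(c @ u @ d, c @ v @ d) \<in> presentation_cong S R"
  using assms
proof (induction rule: presentation_cong.induct)
  case (cancel s a b e)
  then show ?case
    using presentation_cong.cancel[of s S "c @ a" "b @ d" e R] by (simp add: gwords_def)
next
  case (relation u v a b)
  then show ?case
    using presentation_cong.relation[of u v R S "c @ a" "b @ d"] by (simp add: gwords_def)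
qed (auto simp: gwords_def intro: presentation_cong.intros)

lemma presentation_cong_append:
  assumes "(u, u') \<in> presentation_cong S R" "(v, v') \<in> presentation_cong S R"
  shows "(u @ v, u' @ v') \<in> presentation_cong S R"
proof -
  have "(u @ v, u' @ v) \<in> presentation_cong S R"
    using presentation_cong_context[OF assms(1), of "[]" v] presentation_cong_gwords[OF assms(2)]
    by (simp add: gwords_def)
  moreover have "(u' @ v, u' @ v') \<in> presentation_cong S R"
    using presentation_cong_context[OF assms(2), of u' "[]"] presentation_cong_gwords[OF assms(1)]
    by (simp add: gwords_def)
  ultimately show ?thesis by (rule presentation_cong.trans)
qed

lemma presented_group_mult:
  assumes "u \<in> gwords S" "v \<in> gwords S"
  shows "presentation_cong S R `` {u} \<otimes>\<^bsub>presented_group S R\<^esub> presentation_cong S R `` {v}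
    = presentation_cong S R `` {u @ v}"
proof -
  have "congruent2 (presentation_cong S R) (presentation_cong S R)
      (\<lambda>u v. presentation_cong S R `` {u @ v})"
    by (auto simp: congruent2_def intro!: equiv_class_eq[OF equiv_presentation_cong]
        presentation_cong_append)
  from UN_equiv_class2[OF equiv_presentation_cong equiv_presentation_cong this assms]
  show ?thesis by (simp add: presented_group_def)
qed

lemma presentation_cong_inverse:
  assumes "w \<in> gwords S"
  shows "(rev (map (\<lambda>(s, e). (s, \<not> e)) w) @ w, []) \<in> presentation_cong S R"
  using assms
proof (induction w)
  case Nil
  then show ?case by (auto simp: gwords_def intro: presentation_cong.refl)
next
  case (Cons l w)
  obtain s e where l: "l = (s, e)" by (cases l)
  let ?i = "rev (map (\<lambda>(s, e). (s, \<not> e)) w)"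
  have w: "w \<in> gwords S" "s \<in> S" "?i \<in> gwords S"
    using Cons.prems by (auto simp: gwords_def l in_lists_conv_set)
  then have "(?i @ [(s, \<not> e), (s, \<not> \<not> e)] @ w, ?i @ w) \<in> presentation_cong S R"
    by (intro presentation_cong.cancel)
  with Cons.IH[OF w(1)] show ?case
    by (auto simp: l intro: presentation_cong.trans)
qed

lemma group_presented_group: "group (presented_group S R)"
proof (rule groupI)
  let ?P = "presented_group S R"
  have cl: "presentation_cong S R `` {u} \<in> carrier ?P" if "u \<in> gwords S" for u
    using that by (simp add: presented_group_def quotientI)
  have ex: "\<exists>u\<in>gwords S. x = presentation_cong S R `` {u}" if "x \<in> carrier ?P" for x
    using that by (auto simp: presented_group_def elim: quotientE)
  have nil: "[] \<in> gwords S" by (simp add: gwords_def)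
  have app: "u @ v \<in> gwords S" if "u \<in> gwords S" "v \<in> gwords S" for u v
    using that by (simp add: gwords_def)
  have one: "\<one>\<^bsub>?P\<^esub> = presentation_cong S R `` {[]}" by (simp add: presented_group_def)
  show "x \<otimes>\<^bsub>?P\<^esub> y \<in> carrier ?P" if "x \<in> carrier ?P" "y \<in> carrier ?P" for x y
    using ex[OF that(1)] ex[OF that(2)] by (auto simp: presented_group_mult intro!: cl app)
  show "\<one>\<^bsub>?P\<^esub> \<in> carrier ?P" by (simp add: one cl nil)
  show "(x \<otimes>\<^bsub>?P\<^esub> y) \<otimes>\<^bsub>?P\<^esub> z = x \<otimes>\<^bsub>?P\<^esub> (y \<otimes>\<^bsub>?P\<^esub> z)"
    if "x \<in> carrier ?P" "y \<in> carrier ?P" "z \<in> carrier ?P" for x y z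
    using ex[OF that(1)] ex[OF that(2)] ex[OF that(3)] by (auto simp: presented_group_mult app)
  show "\<one>\<^bsub>?P\<^esub> \<otimes>\<^bsub>?P\<^esub> x = x" if "x \<in> carrier ?P" for x
    using ex[OF that] by (auto simp: one presented_group_mult nil)
  show "\<exists>y\<in>carrier ?P. y \<otimes>\<^bsub>?P\<^esub> x = \<one>\<^bsub>?P\<^esub>" if x: "x \<in> carrier ?P" for x
  proof -
    obtain w where w: "w \<in> gwords S" "x = presentation_cong S R `` {w}" using ex[OF x] by blast
    let ?i = "rev (map (\<lambda>(s, e). (s, \<not> e)) w)"
    have i: "?i \<in> gwords S" using w(1) by (auto simp: gwords_def in_lists_conv_set)
    have "presentation_cong S R `` {?i} \<otimes>\<^bsub>?P\<^esub> x = \<one>\<^bsub>?P\<^esub>"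
      unfolding w(2) one presented_group_mult[OF i w(1)]
      by (rule equiv_class_eq[OF equiv_presentation_cong presentation_cong_inverse[OF w(1)]])
    with cl[OF i] show ?thesis by blast
  qed
qed


section \<open>Quotient spaces\<close>

text \<open>\<open>glue_class r x\<close> is the class of \<open>x\<close> under the equivalence relation generated by \<open>r\<close>.\<close>

definition glue_class :: "('a \<times> 'a) set \<Rightarrow> 'a \<Rightarrow> 'a set" where
  "glue_class r x = (r \<union> r\<inverse>)\<^sup>* `` {x}"

definition quotient_topology :: "'a topology \<Rightarrow> ('a \<times> 'a) set \<Rightarrow> 'a set topology" where
  "quotient_topology X r = topology (\<lambda>U.
    U \<subseteq> glue_class r ` topspace X \<and> openin X {x \<in> topspace X. glue_class r x \<in> U})"

lemma openin_quotient_topology: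
  "openin (quotient_topology X r) U \<longleftrightarrow>
    U \<subseteq> glue_class r ` topspace X \<and> openin X {x \<in> topspace X. glue_class r x \<in> U}"
proof -
  let ?P = "\<lambda>U. {x \<in> topspace X. glue_class r x \<in> U}"
  have "?P (U \<inter> W) = ?P U \<inter> ?P W" "?P (\<Union>\<K>) = \<Union> (?P ` \<K>)" for U W \<K> by auto
  then have "istopology (\<lambda>U. U \<subseteq> glue_class r ` topspace X \<and> openin X (?P U))"
    unfolding istopology_def by (auto simp: openin_Int openin_Union Sup_le_iff)
  then show ?thesis by (simp add: quotient_topology_def topology_inverse')
qed

lemma topspace_quotient_topology:
  "topspace (quotient_topology X r) = glue_class r ` topspace X"
proof -
  have "{x \<in> topspace X. glue_class r x \<in> glue_class r ` topspace X} = topspace X" by auto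
  then have "openin (quotient_topology X r) (glue_class r ` topspace X)"
    by (simp add: openin_quotient_topology)
  then show ?thesis by (meson openin_quotient_topology openin_subset openin_topspace subset_antisym)
qed

lemma quotient_map_glue_class: "quotient_map X (quotient_topology X r) (glue_class r)"
  by (auto simp: quotient_map_def topspace_quotient_topology openin_quotient_topology)


section \<open>The cell complex of a graph\<close>

text \<open>The cube on a set \<open>Q\<close> of labels; coordinate directions play the role of labelled, oriented
  edges.\<close>

definition unit_cube :: "'v set \<Rightarrow> ('v \<Rightarrow> real) topology" where
  "unit_cube Q = product_topology (\<lambda>_. top_of_set {0..1}) Q"

definition opposite_faces :: "'v set \<Rightarrow> (('v \<Rightarrow> real) \<times> ('v \<Rightarrow> real)) set" where
  "opposite_faces Q = {(x, x(v := 1)) | x v. x \<in> topspace (unit_cube Q) \<and> v \<in> Q \<and> x v = 0}"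

definition torus :: "'v set \<Rightarrow> ('v \<Rightarrow> real) set topology" where
  "torus Q = quotient_topology (unit_cube Q) (opposite_faces Q)"

text \<open>The point of the subtorus of \<open>torus Q\<close> spanned by the edges in \<open>S \<subseteq> Q\<close> that is represented
  by a point \<open>z\<close> of the cube on \<open>S\<close>.\<close>

definition subtorus_point :: "'v set \<Rightarrow> 'v set \<Rightarrow> ('v \<Rightarrow> real) \<Rightarrow> ('v \<Rightarrow> real) set" where
  "subtorus_point Q S z =
    glue_class (opposite_faces Q) (\<lambda>v\<in>Q. if v \<in> S then z v else 0)"

type_synonym 'v torus_sum_point = "'v set \<times> ('v \<Rightarrow> real) set"

definition torus_identification ::
    "'v set \<Rightarrow> 'v set set \<Rightarrow> ('v torus_sum_point \<times> 'v torus_sum_point) set" where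
  "torus_identification V E =
    {((Q, subtorus_point Q (Q \<inter> Q') z), (Q', subtorus_point Q' (Q \<inter> Q') z)) | Q Q' z.
      Q \<in> cliques V E \<and> Q' \<in> cliques V E \<and> z \<in> topspace (unit_cube (Q \<inter> Q'))}"

definition graph_complex :: "'v set \<Rightarrow> 'v set set \<Rightarrow> 'v torus_sum_point set topology" where
  "graph_complex V E =
    quotient_topology (sum_topology torus (cliques V E)) (torus_identification V E)"


section \<open>Fundamental groups and universal coverings\<close>

text \<open>The library develops path homotopy and covering spaces for subsets of types of class
  \<open>topological_space\<close>; the following are the corresponding notions for abstract topologies.\<close>

definition loops_at :: "'a topology \<Rightarrow> 'a \<Rightarrow> (real \<Rightarrow> 'a) set" where
  "loops_at X x = {p. pathin X p \<and> p 0 = x \<and> p 1 = x}"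

definition loop_homotopy :: "'a topology \<Rightarrow> 'a \<Rightarrow> ((real \<Rightarrow> 'a) \<times> (real \<Rightarrow> 'a)) set" where
  "loop_homotopy X x = {(p, q). p \<in> loops_at X x \<and> q \<in> loops_at X x \<and>
    homotopic_with (\<lambda>r. r 0 = x \<and> r 1 = x) (top_of_set {0..1}) X p q}"

definition path_concat :: "(real \<Rightarrow> 'a) \<Rightarrow> (real \<Rightarrow> 'a) \<Rightarrow> real \<Rightarrow> 'a" where
  "path_concat p q = (\<lambda>t. if t \<le> 1/2 then p (2 * t) else q (2 * t - 1))"

definition fundamental_group :: "'a topology \<Rightarrow> 'a \<Rightarrow> (real \<Rightarrow> 'a) set monoid" where
  "fundamental_group X x =
    \<lparr>carrier = loops_at X x // loop_homotopy X x,
     mult = (\<lambda>A B. \<Union>p\<in>A. \<Union>q\<in>B. loop_homotopy X x `` {path_concat p q}),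
     one = loop_homotopy X x `` {\<lambda>_. x}\<rparr>"

definition simply_connected_space :: "'a topology \<Rightarrow> bool" where
  "simply_connected_space X \<longleftrightarrow> path_connected_space X \<and>
    (\<forall>x\<in>topspace X. carrier (fundamental_group X x) = {\<one>\<^bsub>fundamental_group X x\<^esub>})"

definition covering_map :: "'a topology \<Rightarrow> ('a \<Rightarrow> 'b) \<Rightarrow> 'b topology \<Rightarrow> bool" where
  "covering_map C p X \<longleftrightarrow>
    continuous_map C X p \<and> p ` topspace C = topspace X \<and>
    (\<forall>x\<in>topspace X. \<exists>T. x \<in> T \<and> openin X T \<and>
      (\<exists>\<U>. \<Union>\<U> = {c \<in> topspace C. p c \<in> T} \<and> (\<forall>U\<in>\<U>. openin C U) \<and> pairwise disjnt \<U> \<and>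
        (\<forall>U\<in>\<U>. homeomorphic_map (subtopology C U) (subtopology X T) p)))"

definition universal_covering :: "'a topology \<Rightarrow> ('a \<Rightarrow> 'b) \<Rightarrow> 'b topology \<Rightarrow> bool" where
  "universal_covering C p X \<longleftrightarrow> covering_map C p X \<and> simply_connected_space C"

end

theory Submission
  imports Defs
begin

text \<open>The universal covering is written down explicitly. A point of it lies in a flat \<open>g \<cdot> \<real>\<^sup>Q\<close>, where
  \<open>g\<close> is a group element and \<open>Q\<close> a clique, and it is recorded by its multilinear barycentric
  coordinates, a function on the vertex set \<open>G\<close>. In these coordinates the gluing of cubes becomes
  equality, the group acts by translations, and reduction of the flat coordinates modulo \<open>1\<close> is a
  covering of the subspace of the torus \<open>(S\<^sup>1)\<^sup>V\<close> formed by the points whose non-trivial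
  coordinates span a clique; this subspace is the cell complex. The combinatorial input for
  contractibility is the word length of graph groups, computed with the pilings of Crisp, Godelle
  and Wiest: the letters that shorten \<open>g\<close> commute pairwise, so the cubes for which \<open>g\<close> is the
  vertex farthest from the identity are faces of a single one. Pushing that cube away from \<open>g\<close>, for
  all \<open>g\<close> of length \<open>n + 1\<close>, retracts the ball of radius \<open>n + 1\<close> onto the ball of radius \<open>n\<close>, and the
  infinite concatenation of these retractions contracts the covering space.\<close>

section \<open>Covering maps of abstract topologies\<close>

text \<open>Two features of the statement shape the topological half. Its last clause concerns every
  universal covering, on any type, while only one is constructed; the comparison lifts the
  contraction of the constructed one, run backwards from a constant map, because a constant map has
  an obvious lift. Existence is asked for on one particular type, so the constructed space is also
  transported there. The covering carries the topology of pointwise convergence of measures, not a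
  weak topology of cells. This suffices because the points of an open star
  \<open>{b \<in> UC. b g > 0}\<close> put weight on finitely many vertices only, so that every
  point has a neighbourhood inside one ball. Exponent sums make the coordinates explicit: inside a
  flat they determine the vertex, so \<open>\<sigma>\<close> can be written without naming the
  clique. A cube is pushed away from its farthest vertex along the diagonal. The faces opposite to
  that vertex stay fixed, and only there do cubes with distinct farthest vertices of equal length
  meet each other or the smaller ball; hence the pushes fit together.\<close>

lemma covering_map_continuous: "covering_map C p X \<Longrightarrow> continuous_map C X p"
  by (simp add: covering_map_def)

lemma covering_map_image: "covering_map C p X \<Longrightarrow> p ` topspace C = topspace X"
  by (simp add: covering_map_def)

lemma covering_map_evenly:
  assumes "covering_map C p X" "x \<in> topspace X"
  shows "\<exists>T \<U>. x \<in> T \<and> openin X T \<and> \<Union>\<U> = {c \<in> topspace C. p c \<in> T} \<and>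
    (\<forall>U\<in>\<U>. openin C U) \<and> pairwise disjnt \<U> \<and>
    (\<forall>U\<in>\<U>. homeomorphic_map (subtopology C U) (subtopology X T) p)"
  using assms unfolding covering_map_def by auto

text \<open>One evenly covered neighbourhood seen from one point: an open \<open>U\<close> over
  \<open>T\<close> with the inverse \<open>s\<close> of \<open>p\<close> on it. The lifting
  arguments use sheets in this form and do not carry the whole family of sheets along.\<close>

definition sheet ::
    "'c topology \<Rightarrow> ('c \<Rightarrow> 'x) \<Rightarrow> 'x topology \<Rightarrow> 'x set \<Rightarrow> 'c set \<Rightarrow> ('x \<Rightarrow> 'c) \<Rightarrow> bool" where
  "sheet C p X T U s \<longleftrightarrow> openin C U \<and> continuous_map (subtopology X T) C s \<and> s ` T \<subseteq> U \<and>
    (\<forall>x\<in>T. p (s x) = x) \<and> (\<forall>u\<in>U. s (p u) = u)"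

lemma covering_map_sheets:
  assumes "covering_map C p X" "x \<in> topspace X"
  shows "\<exists>T. openin X T \<and> x \<in> T \<and> (\<forall>c\<in>topspace C. p c \<in> T \<longrightarrow>
      (\<exists>U s. c \<in> U \<and> sheet C p X T U s))"
proof -
  obtain T \<U> where T: "x \<in> T" "openin X T" "\<Union>\<U> = {c \<in> topspace C. p c \<in> T}"
      and op: "\<forall>U\<in>\<U>. openin C U"
      and hom: "\<forall>U\<in>\<U>. homeomorphic_map (subtopology C U) (subtopology X T) p"
    using covering_map_evenly[OF assms] by (elim exE conjE) (rule that)
  have "\<exists>U s. c \<in> U \<and> sheet C p X T U s"
    if c: "c \<in> topspace C" "p c \<in> T" for c
  proof -
    obtain U where U: "U \<in> \<U>" "c \<in> U" using T(3) c by blast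
    have oU: "openin C U" using op U by blast
    have tU: "topspace (subtopology C U) = U" and tT: "topspace (subtopology X T) = T"
      using T(2) oU openin_subset by fastforce+
    have "homeomorphic_map (subtopology C U) (subtopology X T) p" using hom U by blast
    then obtain s where s: "homeomorphic_maps (subtopology C U) (subtopology X T) p s"
      unfolding homeomorphic_map_maps by (elim exE) (rule that)
    have s1: "continuous_map (subtopology X T) (subtopology C U) s"
      and s2: "\<forall>x\<in>T. p (s x) = x" "\<forall>u\<in>U. s (p u) = u"
      using s unfolding homeomorphic_maps_def tU tT by auto
    have "continuous_map (subtopology X T) C s"
      using s1 by (simp add: continuous_map_in_subtopology)
    moreover have "s ` T \<subseteq> U"
      using continuous_map_image_subset_topspace[OF s1] unfolding tU tT .
    ultimately show ?thesis
      using s2 oU U(2) by (intro exI[of _ U] exI[of _ s]) (simp add: sheet_def)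
  qed
  with T(1,2) show ?thesis by (intro exI[of _ T]) simp
qed

text \<open>Distinct points of one fibre lie in different sheets, since \<open>p\<close> is
  injective on each sheet. This takes the place of a Hausdorff assumption on \<open>C\<close> in the
  uniqueness of lifts.\<close>

lemma covering_map_separation:
  assumes "covering_map C p X" "c \<in> topspace C" "c' \<in> topspace C" "p c = p c'" "c \<noteq> c'"
  shows "\<exists>U U'. openin C U \<and> openin C U' \<and> c \<in> U \<and> c' \<in> U' \<and> U \<inter> U' = {}"
proof -
  have x: "p c \<in> topspace X" using assms(1,2) by (auto simp: covering_map_def)
  obtain T \<U> where T: "p c \<in> T" "\<Union>\<U> = {c \<in> topspace C. p c \<in> T}"
      and op: "\<forall>U\<in>\<U>. openin C U" and dis: "pairwise disjnt \<U>"
      and hom: "\<forall>U\<in>\<U>. homeomorphic_map (subtopology C U) (subtopology X T) p"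
    using covering_map_evenly[OF assms(1) x] by (elim exE conjE) (rule that)
  obtain U where U: "U \<in> \<U>" "c \<in> U" using T assms(2) by blast
  have "c' \<in> \<Union>\<U>" using T assms(3,4) by simp
  then obtain U' where U': "U' \<in> \<U>" "c' \<in> U'" by blast
  have "inj_on p (topspace (subtopology C U))"
    using hom U(1) homeomorphic_imp_injective_map by blast
  moreover have "topspace (subtopology C U) = U" using op U(1) openin_subset by fastforce
  ultimately have "U \<noteq> U'" using U U' assms(4,5) by (auto dest: inj_onD)
  then have "U \<inter> U' = {}" using dis U U' by (auto simp: pairwise_def disjnt_def)
  with op U U' show ?thesis by blast
qed

lemma covering_map_open:
  assumes "covering_map C p X" "openin C W"
  shows "openin X (p ` W)"
proof (subst openin_subopen, intro ballI)
  fix x assume "x \<in> p ` W"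
  then obtain c where c: "c \<in> W" "x = p c" by blast
  have cC: "c \<in> topspace C" using c assms(2) openin_subset by blast
  then have xX: "x \<in> topspace X" using assms(1) c by (auto simp: covering_map_def)
  obtain T where T0: "openin X T" "x \<in> T" "\<forall>c\<in>topspace C. p c \<in> T \<longrightarrow>
      (\<exists>U s. c \<in> U \<and> sheet C p X T U s)"
    using covering_map_sheets[OF assms(1) xX] by (elim exE conjE) (rule that)
  have pT: "p c \<in> T" using T0(2) c by simp
  obtain U s where T: "openin C U" "c \<in> U" "continuous_map (subtopology X T) C s"
      "s ` T \<subseteq> U" "\<forall>x\<in>T. p (s x) = x" "\<forall>u\<in>U. s (p u) = u"
    using T0(3)[rule_format, OF cC pT] unfolding sheet_def by (elim exE conjE) (rule that)
  let ?V = "{y \<in> topspace (subtopology X T). s y \<in> W}"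
  have "openin (subtopology X T) ?V"
    using T(3) assms(2) by (rule openin_continuous_map_preimage)
  then have "openin X ?V" using T0(1) by (meson openin_trans_full)
  moreover have "?V \<subseteq> p ` W"
  proof
    fix y assume "y \<in> ?V"
    then show "y \<in> p ` W" using T(5) by (intro image_eqI[of _ _ "s y"]) auto
  qed
  moreover have "x \<in> ?V" using T0 T(2,6) c xX by auto
  ultimately show "\<exists>V. openin X V \<and> x \<in> V \<and> V \<subseteq> p ` W" by blast
qed

text \<open>The set where the two lifts agree is open because nearby values lie in a common sheet,
  and its complement is open by \<open>covering_map_separation\<close>; connectedness decides
  between them.\<close>

lemma covering_map_lift_unique:
  assumes cov: "covering_map C p X" and Y: "connected_space Y"
    and f: "continuous_map Y C f" and g: "continuous_map Y C g"
    and eq: "\<And>y. y \<in> topspace Y \<Longrightarrow> p (f y) = p (g y)"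
    and y0: "y0 \<in> topspace Y" "f y0 = g y0" and y: "y \<in> topspace Y"
  shows "f y = g y"
proof -
  let ?A = "{y \<in> topspace Y. f y = g y}" and ?B = "{y \<in> topspace Y. f y \<noteq> g y}"
  have fg: "f y \<in> topspace C" "g y \<in> topspace C" if "y \<in> topspace Y" for y
    using f g that by (auto simp: continuous_map_def)
  have A: "openin Y ?A"
  proof (subst openin_subopen, intro ballI)
    fix z assume z: "z \<in> ?A"
    then have pX: "p (f z) \<in> topspace X" using fg cov by (auto simp: covering_map_def)
    obtain T where T0: "openin X T" "p (f z) \<in> T" "\<forall>c\<in>topspace C. p c \<in> T \<longrightarrow>
      (\<exists>U s. c \<in> U \<and> sheet C p X T U s)"
      using covering_map_sheets[OF cov pX] by (elim exE conjE) (rule that)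
    have fz: "f z \<in> topspace C" using fg z by auto
    obtain U s where T: "openin C U" "f z \<in> U" "\<forall>u\<in>U. s (p u) = u"
      using T0(3)[rule_format, OF fz T0(2)] unfolding sheet_def by (elim exE conjE) (rule that)
    let ?V = "{y \<in> topspace Y. f y \<in> U} \<inter> {y \<in> topspace Y. g y \<in> U}"
    have "openin Y ?V" using T f g by (intro openin_Int openin_continuous_map_preimage)
    moreover have "?V \<subseteq> ?A"
    proof
      fix y assume "y \<in> ?V"
      then have y: "y \<in> topspace Y" "f y \<in> U" "g y \<in> U" by auto
      have "f y = s (p (f y))" using bspec[OF T(3) y(2)] by (rule HOL.sym)
      also have "\<dots> = s (p (g y))" by (rule arg_cong[OF eq[OF y(1)]])
      also have "\<dots> = g y" by (rule bspec[OF T(3) y(3)])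
      finally show "y \<in> ?A" using y(1) by simp
    qed
    moreover have "z \<in> ?V" using z T by auto
    ultimately show "\<exists>V. openin Y V \<and> z \<in> V \<and> V \<subseteq> ?A" by blast
  qed
  have B: "openin Y ?B"
  proof (subst openin_subopen, intro ballI)
    fix z assume z: "z \<in> ?B"
    then obtain U U' where U: "openin C U" "openin C U'" "f z \<in> U" "g z \<in> U'" "U \<inter> U' = {}"
      using covering_map_separation[OF cov, of "f z" "g z"] fg eq by blast
    let ?V = "{y \<in> topspace Y. f y \<in> U} \<inter> {y \<in> topspace Y. g y \<in> U'}"
    have "openin Y ?V" using U f g by (intro openin_Int openin_continuous_map_preimage)
    moreover have "?V \<subseteq> ?B" using U by auto
    moreover have "z \<in> ?V" using z U by auto
    ultimately show "\<exists>V. openin Y V \<and> z \<in> V \<and> V \<subseteq> ?B" by blast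
  qed
  have "?A \<inter> ?B = {}" "topspace Y \<subseteq> ?A \<union> ?B" by auto
  with Y A B have "?A = {} \<or> ?B = {}" unfolding connected_space_def by meson
  then show ?thesis using y0 y by blast
qed

text \<open>The local statement behind homotopy lifting: a lift given at time \<open>a\<close> near \<open>y0\<close> can be
  continued to time \<open>b\<close> after shrinking the neighbourhood of \<open>y0\<close>.\<close>

lemma covering_map_extend_lift:
  fixes H :: "real \<times> 'y \<Rightarrow> 'x"
  assumes cov: "covering_map C p X" and H: "continuous_map (prod_topology euclideanreal Y) X H"
    and y0: "y0 \<in> topspace Y" and ab: "a \<le> b"
  shows "\<forall>N f. openin Y N \<and> y0 \<in> N \<and> continuous_map (subtopology Y N) C f \<and>
      (\<forall>y\<in>N. p (f y) = H (a, y)) \<longrightarrow>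
    (\<exists>N' K. openin Y N' \<and> y0 \<in> N' \<and> N' \<subseteq> N \<and>
      continuous_map (subtopology (prod_topology euclideanreal Y) ({a..b} \<times> N')) C K \<and>
      (\<forall>y\<in>N'. K (a, y) = f y) \<and> (\<forall>t\<in>{a..b}. \<forall>y\<in>N'. p (K (t, y)) = H (t, y)))"
  using ab
\<comment> \<open>Bisection of the time interval. The claim quantifies over all \<open>N\<close> and
  \<open>f\<close> so that, when two intervals are joined, the second lift can start from the end of
  the first one on an already shrunken neighbourhood.\<close>
proof (induct rule: Bolzano)
  let ?W = "prod_topology euclideanreal Y"
  case (trans a b c)
  show ?case
  proof (intro allI impI, elim conjE)
    fix N f assume N: "openin Y N" "y0 \<in> N" "continuous_map (subtopology Y N) C f"
      "\<forall>y\<in>N. p (f y) = H (a, y)"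
    then obtain N1 K1 where N1: "openin Y N1" "y0 \<in> N1" "N1 \<subseteq> N"
      "continuous_map (subtopology ?W ({a..b} \<times> N1)) C K1"
      "\<forall>y\<in>N1. K1 (a, y) = f y" "\<forall>t\<in>{a..b}. \<forall>y\<in>N1. p (K1 (t, y)) = H (t, y)"
      using trans(1)[rule_format, of N f] by auto
    have "continuous_map (subtopology Y N1) C (K1 \<circ> (\<lambda>y. (b, y)))"
    proof (rule continuous_map_compose[OF _ N1(4)])
      show "continuous_map (subtopology Y N1) (subtopology ?W ({a..b} \<times> N1)) (\<lambda>y. (b, y))"
        using trans(3) by (auto simp: continuous_map_in_subtopology continuous_map_pairwise o_def
            intro: continuous_map_from_subtopology)
    qed
    then obtain N2 K2 where N2: "openin Y N2" "y0 \<in> N2" "N2 \<subseteq> N1"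
      "continuous_map (subtopology ?W ({b..c} \<times> N2)) C K2"
      "\<forall>y\<in>N2. K2 (b, y) = K1 (b, y)" "\<forall>t\<in>{b..c}. \<forall>y\<in>N2. p (K2 (t, y)) = H (t, y)"
      using trans(2)[rule_format, of N1 "\<lambda>y. K1 (b, y)"] N1 trans(3) by (auto simp: o_def)
    let ?K = "\<lambda>z. if fst z \<le> b then K1 z else K2 z"
    let ?S = "subtopology ?W ({a..c} \<times> N2)"
    have "continuous_map ?S C ?K"
    proof (rule continuous_map_cases_le)
      show "continuous_map ?S euclideanreal fst"
        by (intro continuous_map_from_subtopology continuous_map_fst)
      have "continuous_map (subtopology ?W ({a..b} \<times> N2)) C K1"
        by (rule continuous_map_from_subtopology_mono[OF N1(4)]) (use N2 in auto)
      then show "continuous_map (subtopology ?S {x \<in> topspace ?S. fst x \<le> b}) C K1"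
        unfolding subtopology_subtopology
        by (rule continuous_map_from_subtopology_mono) auto
      show "continuous_map (subtopology ?S {x \<in> topspace ?S. b \<le> fst x}) C K2"
        unfolding subtopology_subtopology
        by (rule continuous_map_from_subtopology_mono[OF N2(4)]) auto
    qed (use N2 in auto)
    then show "\<exists>N' K. openin Y N' \<and> y0 \<in> N' \<and> N' \<subseteq> N \<and>
      continuous_map (subtopology ?W ({a..c} \<times> N')) C K \<and>
      (\<forall>y\<in>N'. K (a, y) = f y) \<and> (\<forall>t\<in>{a..c}. \<forall>y\<in>N'. p (K (t, y)) = H (t, y))"
      using N1 N2 trans(3,4) by (intro exI[of _ N2] exI[of _ ?K]) auto
  qed
next
  let ?W = "prod_topology euclideanreal Y"
  case (local x)
  have tW: "(x, y0) \<in> topspace ?W" using y0 by auto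
  then have HX: "H (x, y0) \<in> topspace X" using H by (auto simp: continuous_map_def)
  obtain T where T: "openin X T" "H (x, y0) \<in> T"
    and sh: "\<forall>c\<in>topspace C. p c \<in> T \<longrightarrow>
      (\<exists>U s. c \<in> U \<and> sheet C p X T U s)"
    using covering_map_sheets[OF cov HX] by (elim exE conjE) (rule that)
  have op: "openin ?W {z \<in> topspace ?W. H z \<in> T}"
    using H T(1) by (rule openin_continuous_map_preimage)
  have mem: "(x, y0) \<in> {z \<in> topspace ?W. H z \<in> T}" using tW T by simp
  obtain R M where RM: "openin euclideanreal R" "openin Y M" "x \<in> R" "y0 \<in> M"
      "R \<times> M \<subseteq> {z \<in> topspace ?W. H z \<in> T}"
    using iffD1[OF openin_prod_topology_alt op, rule_format, OF mem]
    by (elim exE conjE) (rule that)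
  obtain d where d: "d > 0" "\<And>t. \<bar>t - x\<bar> < d \<Longrightarrow> t \<in> R"
    using RM(1,3) by (auto simp: open_dist dist_real_def)
  show ?case
  proof (intro exI[of _ d] conjI d(1) allI impI; elim conjE)
    fix a b N f assume ab: "a \<le> x" "x \<le> b" "b - a < d"
      and N: "openin Y N" "y0 \<in> N" "continuous_map (subtopology Y N) C f"
        "\<forall>y\<in>N. p (f y) = H (a, y)"
    have R: "{a..b} \<subseteq> R" using ab d(2) by auto
    have NY: "N \<subseteq> topspace Y" using N(1) openin_subset by blast
    have fC: "f y \<in> topspace C" if "y \<in> N" for y
      using N(3) that NY by (auto simp: continuous_map_def)
    have "p (f y0) \<in> T" using N R RM ab by force
    from sh[rule_format, OF fC[OF N(2)] this] obtain U s where U: "openin C U" "f y0 \<in> U"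
        "continuous_map (subtopology X T) C s" "\<forall>x\<in>T. p (s x) = x" "\<forall>u\<in>U. s (p u) = u"
      unfolding sheet_def by (elim exE conjE) (rule that)
    \<comment> \<open>Besides \<open>H\<close> staying in \<open>T\<close>, the given lift has to
      stay in the sheet \<open>U\<close>; then \<open>s \<circ> H\<close> agrees with
      \<open>f\<close> at time \<open>a\<close>.\<close>
    define N' where "N' = {y \<in> topspace (subtopology Y N). f y \<in> U} \<inter> M"
    have "openin (subtopology Y N) {y \<in> topspace (subtopology Y N). f y \<in> U}"
      using N(3) U(1) by (rule openin_continuous_map_preimage)
    then have oN': "openin Y N'" unfolding N'_def using N(1) RM(2) by (meson openin_Int openin_trans_full)
    have N'N: "N' \<subseteq> N" and N'M: "N' \<subseteq> M" by (auto simp: N'_def)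
    have y0N': "y0 \<in> N'" using N(2) U(2) RM(4) y0 by (simp add: N'_def)
    have HT: "H (t, y) \<in> T" if "t \<in> {a..b}" "y \<in> N'" for t y
    proof -
      have "(t, y) \<in> R \<times> M" using that R N'M by blast
      then show ?thesis using RM(5) by blast
    qed
    let ?K = "s \<circ> H"
    have "continuous_map (subtopology ?W ({a..b} \<times> N')) C ?K"
    proof (rule continuous_map_compose[OF _ U(3)])
      show "continuous_map (subtopology ?W ({a..b} \<times> N')) (subtopology X T) H"
        using H HT by (auto simp: continuous_map_in_subtopology intro: continuous_map_from_subtopology)
    qed
    moreover have "?K (a, y) = f y" if "y \<in> N'" for y
      using that U(5) N(4) N'N unfolding N'_def by fastforce
    moreover have "p (?K (t, y)) = H (t, y)" if "t \<in> {a..b}" "y \<in> N'" for t y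
      using HT[OF that] U(4) by simp
    ultimately show "\<exists>N' K. openin Y N' \<and> y0 \<in> N' \<and> N' \<subseteq> N \<and>
      continuous_map (subtopology ?W ({a..b} \<times> N')) C K \<and>
      (\<forall>y\<in>N'. K (a, y) = f y) \<and> (\<forall>t\<in>{a..b}. \<forall>y\<in>N'. p (K (t, y)) = H (t, y))"
      using oN' N'N y0N' by blast
  qed
qed

text \<open>Two local lifts over \<open>{0..1} \<times> N\<close> restrict, along each segment
  \<open>{0..1} \<times> {y}\<close>, to lifts of the same path with the same start. They therefore
  agree on overlaps and paste together.\<close>

theorem covering_map_lift_homotopy:
  assumes cov: "covering_map C p X"
    and H: "continuous_map (prod_topology (top_of_set {0..1}) Y) X H"
    and f: "continuous_map Y C f" and pf: "\<And>y. y \<in> topspace Y \<Longrightarrow> p (f y) = H (0::real, y)"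
  obtains K where "continuous_map (prod_topology (top_of_set {0..1}) Y) C K"
    "\<And>y. y \<in> topspace Y \<Longrightarrow> K (0, y) = f y"
    "\<And>t y. t \<in> {0..1} \<Longrightarrow> y \<in> topspace Y \<Longrightarrow> p (K (t, y)) = H (t, y)"
proof -
  let ?W = "prod_topology euclideanreal Y" and ?I = "{0..1::real}"
  \<comment> \<open>Clamping the time extends \<open>H\<close> to all real times, the form in which
    the bisection argument is stated.\<close>
  let ?c = "\<lambda>z::real \<times> 'c. (max 0 (min 1 (fst z)), snd z)"
  have "continuous_map ?W (prod_topology (top_of_set ?I) Y) ?c"
    by (auto simp: continuous_map_pairwise o_def continuous_map_in_subtopology
        intro!: continuous_intros continuous_map_fst continuous_map_snd)
  then have H': "continuous_map ?W X (H \<circ> ?c)"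
    by (rule continuous_map_compose) (rule H)
  have "\<forall>y0\<in>topspace Y. \<exists>N K. openin Y N \<and> y0 \<in> N \<and>
      continuous_map (subtopology ?W (?I \<times> N)) C K \<and>
      (\<forall>y\<in>N. K (0, y) = f y) \<and> (\<forall>t\<in>?I. \<forall>y\<in>N. p (K (t, y)) = H (t, y))"
  proof
    fix y0 assume y0: "y0 \<in> topspace Y"
    have "\<exists>N K. openin Y N \<and> y0 \<in> N \<and> N \<subseteq> topspace Y \<and>
      continuous_map (subtopology ?W (?I \<times> N)) C K \<and> (\<forall>y\<in>N. K (0, y) = f y) \<and>
      (\<forall>t\<in>?I. \<forall>y\<in>N. p (K (t, y)) = (H \<circ> ?c) (t, y))"
      using covering_map_extend_lift[OF cov H' y0, of 0 1, rule_format, of "topspace Y" f]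
        f pf y0 by simp
    then show "\<exists>N K. openin Y N \<and> y0 \<in> N \<and>
      continuous_map (subtopology ?W (?I \<times> N)) C K \<and>
      (\<forall>y\<in>N. K (0, y) = f y) \<and> (\<forall>t\<in>?I. \<forall>y\<in>N. p (K (t, y)) = H (t, y))"
      by (elim exE conjE) (intro exI conjI; simp)
  qed
  from bchoice[OF this] obtain N where N: "\<forall>z\<in>topspace Y. \<exists>K. openin Y (N z) \<and> z \<in> N z \<and>
      continuous_map (subtopology ?W (?I \<times> N z)) C K \<and>
      (\<forall>y\<in>N z. K (0, y) = f y) \<and> (\<forall>t\<in>?I. \<forall>y\<in>N z. p (K (t, y)) = H (t, y))"
    by (elim exE) (rule that)
  from bchoice[OF this] obtain K where "\<forall>z\<in>topspace Y. openin Y (N z) \<and> z \<in> N z \<and>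
      continuous_map (subtopology ?W (?I \<times> N z)) C (K z) \<and>
      (\<forall>y\<in>N z. K z (0, y) = f y) \<and> (\<forall>t\<in>?I. \<forall>y\<in>N z. p (K z (t, y)) = H (t, y))"
    by (elim exE) (rule that)
  then have NK: "\<And>z. z \<in> topspace Y \<Longrightarrow> openin Y (N z)"
      "\<And>z. z \<in> topspace Y \<Longrightarrow> z \<in> N z"
      "\<And>z. z \<in> topspace Y \<Longrightarrow> continuous_map (subtopology ?W (?I \<times> N z)) C (K z)"
      "\<And>z y. z \<in> topspace Y \<Longrightarrow> y \<in> N z \<Longrightarrow> K z (0, y) = f y"
      "\<And>z t y. z \<in> topspace Y \<Longrightarrow> t \<in> ?I \<Longrightarrow> y \<in> N z \<Longrightarrow> p (K z (t, y)) = H (t, y)"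
    by auto
  let ?P = "prod_topology (top_of_set ?I) Y"
  have P: "?P = subtopology ?W (?I \<times> topspace Y)"
    by (metis subtopology_Times subtopology_topspace)
  have agree: "K z (t, y) = K z' (t, y)"
    if z: "z \<in> topspace Y" "z' \<in> topspace Y" "y \<in> N z" "y \<in> N z'" "t \<in> ?I" for z z' t y
  proof -
    have *: "continuous_map (top_of_set ?I) C (K w \<circ> (\<lambda>t. (t, y)))"
      if "w \<in> topspace Y" "y \<in> N w" for w
    proof (rule continuous_map_compose[OF _ NK(3)])
      show "continuous_map (top_of_set ?I) (subtopology ?W (?I \<times> N w)) (\<lambda>t. (t, y))"
        using that NK(1)[OF that(1)] openin_subset
        by (fastforce simp: continuous_map_in_subtopology continuous_map_pairwise o_def)
    qed (rule that)
    have "(K z \<circ> (\<lambda>t. (t, y))) t = (K z' \<circ> (\<lambda>t. (t, y))) t"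
      by (rule covering_map_lift_unique[OF cov _ *[OF z(1,3)] *[OF z(2,4)], of 0])
        (use z NK in \<open>auto simp: connected_space_subtopology\<close>)
    then show ?thesis by simp
  qed
  obtain g where g: "continuous_map ?P C g"
      "\<And>w z. z \<in> topspace Y \<Longrightarrow> w \<in> topspace ?P \<inter> (?I \<times> N z) \<Longrightarrow> g w = K z w"
  proof (rule pasting_lemma_exists[where X = ?P and I = "topspace Y" and T = "\<lambda>z. ?I \<times> N z" and f = K and Y = C])
    show "topspace ?P \<subseteq> (\<Union>z\<in>topspace Y. ?I \<times> N z)" using NK(2) by auto
    show "openin ?P (?I \<times> N z)" if "z \<in> topspace Y" for z
      using NK(1)[OF that] by (auto simp: openin_prod_Times_iff)
    show "continuous_map (subtopology ?P (?I \<times> N z)) C (K z)" if "z \<in> topspace Y" for z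
      unfolding P subtopology_subtopology
      by (rule continuous_map_from_subtopology_mono[OF NK(3)[OF that]]) auto
    show "K z w = K z' w" if "z \<in> topspace Y" "z' \<in> topspace Y"
      "w \<in> topspace ?P \<inter> (?I \<times> N z) \<inter> (?I \<times> N z')" for z z' w
    proof -
      obtain t y where w: "w = (t, y)" by (cases w)
      then have "y \<in> N z" "y \<in> N z'" "t \<in> ?I" using that(3) by auto
      from agree[OF that(1,2) this] show ?thesis by (simp add: w)
    qed
  qed (rule that)
  show ?thesis
  proof (rule that[OF g(1)])
    fix y assume "y \<in> topspace Y"
    then show "g (0, y) = f y" using g(2)[of y "(0, y)"] NK by auto
  next
    fix t y assume "t \<in> ?I" "y \<in> topspace Y"
    then show "p (g (t, y)) = H (t, y)" using g(2)[of y "(t, y)"] NK by auto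
  qed
qed

lemma covering_map_lift_path:
  assumes cov: "covering_map C p X" and g: "pathin X g" and c: "c \<in> topspace C" "p c = g 0"
  obtains h where "pathin C h" "h 0 = c" "\<And>t. t \<in> {0..1} \<Longrightarrow> p (h t) = g t"
proof -
  let ?Y = "discrete_topology {()}"
  \<comment> \<open>A path is a homotopy of maps from a one-point space.\<close>
  have "continuous_map (prod_topology (top_of_set {0..1}) ?Y) X (g \<circ> fst)"
    using g unfolding pathin_def by (intro continuous_map_compose[OF continuous_map_fst])
  then obtain K where K: "continuous_map (prod_topology (top_of_set {0..1}) ?Y) C K"
      "\<And>y. y \<in> topspace ?Y \<Longrightarrow> K (0, y) = c"
      "\<And>t y. t \<in> {0..1} \<Longrightarrow> y \<in> topspace ?Y \<Longrightarrow> p (K (t, y)) = (g \<circ> fst) (t, y)"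
    by (rule covering_map_lift_homotopy[OF cov, of ?Y _ "\<lambda>_. c"]) (use c in auto)
  have "pathin C (K \<circ> (\<lambda>t. (t, ())))"
    unfolding pathin_def
    by (rule continuous_map_compose[OF _ K(1)]) (auto simp: continuous_map_pairwise o_def)
  then show ?thesis using that[of "K \<circ> (\<lambda>t. (t, ()))"] K(2,3) by simp
qed

lemma covering_map_lift_path_unique:
  assumes "covering_map C p X" "pathin C h" "pathin C k" "h 0 = k 0"
    "\<And>t. t \<in> {0..1} \<Longrightarrow> p (h t) = p (k t)" "t \<in> {0..1}"
  shows "h t = k t"
  using covering_map_lift_unique[OF assms(1), of "top_of_set {0..1}" h k 0 t] assms(2-6)
  by (auto simp: pathin_def connected_space_subtopology)

text \<open>Lifts of homotopic paths end at the same point: both the homotopy and the constant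
  path lift the side of the square at \<open>t = 1\<close>.\<close>

lemma covering_map_monodromy:
  assumes cov: "covering_map C p X" and h: "pathin C h" and k: "pathin C k" and hk: "h 0 = k 0"
    and hom: "homotopic_with (\<lambda>r. r 0 = x \<and> r 1 = y) (top_of_set {0..1}) X f g"
    and f: "\<And>t. t \<in> {0..1} \<Longrightarrow> p (h t) = f t" and g: "\<And>t. t \<in> {0..1} \<Longrightarrow> p (k t) = g t"
  shows "h 1 = k 1"
proof -
  let ?I = "top_of_set {0..1::real}"
  obtain F where F: "continuous_map (prod_topology ?I ?I) X F"
      "\<And>t. F (0, t) = f t" "\<And>t. F (1, t) = g t"
      "\<And>s. s \<in> {0..1} \<Longrightarrow> F (s, 0) = x \<and> F (s, 1) = y"
    using hom unfolding homotopic_with_def by blast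
  obtain K where K: "continuous_map (prod_topology ?I ?I) C K"
      "\<And>t. t \<in> {0..1} \<Longrightarrow> K (0, t) = h t"
      "\<And>s t. s \<in> {0..1} \<Longrightarrow> t \<in> {0..1} \<Longrightarrow> p (K (s, t)) = F (s, t)"
    by (rule covering_map_lift_homotopy[OF cov F(1), of h]) (use h f F in \<open>auto simp: pathin_def\<close>)
  have cs: "pathin C (\<lambda>s. K (s, t))" if "t \<in> {0..1}" for t
  proof -
    have "continuous_map ?I (prod_topology ?I ?I) (\<lambda>s. (s, t))"
      using that by (auto simp: continuous_map_pairwise o_def intro!: continuous_intros)
    from continuous_map_compose[OF this K(1)] show ?thesis by (simp add: pathin_def o_def)
  qed
  have ct: "pathin C (\<lambda>t. K (s, t))" if "s \<in> {0..1}" for s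
  proof -
    have "continuous_map ?I (prod_topology ?I ?I) (\<lambda>t. (s, t))"
      using that by (auto simp: continuous_map_pairwise o_def intro!: continuous_intros)
    from continuous_map_compose[OF this K(1)] show ?thesis by (simp add: pathin_def o_def)
  qed
  have const: "K (1, t) = K (0, t)" if t: "t \<in> {0, 1}" for t
  proof -
    have "K (0, t) \<in> topspace C" using K(1) t by (force simp: continuous_map_def)
    then show ?thesis
      using covering_map_lift_path_unique[OF cov cs, of t "\<lambda>_. K (0, t)" 1] t K(3) F(4)
      by (auto simp: pathin_def)
  qed
  have "K (1, 1) = k 1"
  proof (rule covering_map_lift_path_unique[OF cov ct k])
    show "K (1, 0) = k 0" using const[of 0] K(2) hk by simp
    show "p (K (1, t)) = p (k t)" if "t \<in> {0..1}" for t using that K(3) F(3) g by simp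
  qed auto
  then show ?thesis using const[of 1] K(2) by simp
qed

text \<open>A path is homotopic, relative to its end points, to the image of the other three sides of
  the square under the contraction applied along the path; this image depends only on the end
  points.\<close>

lemma contractible_space_homotopic_paths:
  assumes C: "contractible_space C" and g: "pathin C g" and h: "pathin C h"
    and eq: "g 0 = x" "h 0 = x" "g 1 = y" "h 1 = y"
  shows "homotopic_with (\<lambda>r. r 0 = x \<and> r 1 = y) (top_of_set {0..1}) C g h"
proof -
  let ?I = "{0..1::real}"
  obtain a H where H: "continuous_map (prod_topology (top_of_set ?I) C) C H"
      "\<And>z. H (0, z) = z" "\<And>z. H (1, z) = a"
    using C unfolding contractible_space_def homotopic_with_def by auto
  \<comment> \<open>In the first third of the time \<open>e2\<close> runs from 0 to 1 with
    \<open>e1\<close> at 0, in the second \<open>e1\<close> runs from 0 to 1 with \<open>e2\<close>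
    at 1, in the last \<open>e2\<close> returns to 0 with \<open>e1\<close> at 1. So
    \<open>s \<mapsto> (e2 s, e1 s)\<close> traverses the other three sides of the square, and on
    the middle one the contraction is already constant.\<close>
  define e1 :: "real \<Rightarrow> real" where "e1 s = max 0 (min 1 (3 * s - 1))" for s
  define e2 :: "real \<Rightarrow> real" where "e2 s = max 0 (min 1 (min (3 * s) (3 * (1 - s))))" for s
  let ?G = "\<lambda>g s. H (e2 s, g (e1 s))"
  have e: "e1 0 = 0" "e1 1 = 1" "e2 0 = 0" "e2 1 = 0" by (simp_all add: e1_def e2_def)
  have e01: "e1 s \<in> ?I" "e2 s \<in> ?I" for s by (simp_all add: e1_def e2_def)
  have *: "homotopic_with (\<lambda>r. r 0 = x \<and> r 1 = y) (top_of_set ?I) C k (?G k)"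
    if k: "pathin C k" "k 0 = x" "k 1 = y" for k
    unfolding homotopic_with_def
  proof (intro exI conjI)
    \<comment> \<open>Straight-line homotopy in the square from the side \<open>(0, s)\<close> to
      the route \<open>(e2 s, e1 s)\<close>; both have the same ends.\<close>
    let ?u = "\<lambda>z. fst z * e2 (snd z)" and ?v = "\<lambda>z. (1 - fst z) * snd z + fst z * e1 (snd z)"
    let ?K = "\<lambda>z. H (?u z, k (?v z))"
    let ?II = "prod_topology (top_of_set ?I) (top_of_set ?I)"
    have II: "?II = top_of_set (?I \<times> ?I)" by simp
    have "continuous_on (?I \<times> ?I) ?u" "continuous_on (?I \<times> ?I) ?v"
      unfolding e1_def e2_def by (intro continuous_intros)+
    moreover have "?u z \<in> ?I" "?v z \<in> ?I" if "z \<in> ?I \<times> ?I" for z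
    proof -
      have z: "fst z \<in> ?I" "snd z \<in> ?I" using that by auto
      show "?u z \<in> ?I" using z e01[of "snd z"] by (auto intro: mult_le_one)
      show "?v z \<in> ?I" using convexD[of ?I "snd z" "e1 (snd z)" "1 - fst z" "fst z"] z e01 by auto
    qed
    ultimately have "continuous_map ?II (top_of_set ?I) ?u" "continuous_map ?II (top_of_set ?I) ?v"
      unfolding II by (auto simp: continuous_map_in_subtopology)
    then have "continuous_map ?II (prod_topology (top_of_set ?I) C) (\<lambda>z. (?u z, k (?v z)))"
      using k(1) continuous_map_compose[of ?II "top_of_set ?I" ?v C k]
      unfolding pathin_def by (simp add: continuous_map_pairwise o_def)
    from continuous_map_compose[OF this H(1)] show "continuous_map ?II C ?K" by (simp add: o_def)
  qed (auto simp: H e k)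
  have "homotopic_with (\<lambda>r. r 0 = x \<and> r 1 = y) (top_of_set ?I) C (?G g) (?G h)"
  proof (rule homotopic_with_equal)
    show "continuous_map (top_of_set ?I) C (?G g)"
      using homotopic_with_imp_continuous_maps[OF *[OF g eq(1,3)]] by blast
    fix s assume "s \<in> topspace (top_of_set ?I)"
    have "s \<le> 1/3 \<or> 2/3 \<le> s \<or> 1/3 \<le> s \<and> s \<le> 2/3" by linarith
    then show "?G g s = ?G h s"
    proof (elim disjE)
      assume "s \<le> 1/3" then have "e1 s = 0" by (simp add: e1_def)
      then show ?thesis by (simp add: eq)
    next
      assume "2/3 \<le> s" then have "e1 s = 1" by (simp add: e1_def)
      then show ?thesis by (simp add: eq)
    next
      assume "1/3 \<le> s \<and> s \<le> 2/3" then have "e2 s = 1" by (simp add: e2_def)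
      then show ?thesis by (simp add: H)
    qed
  qed (simp_all add: e eq H)
  with *[OF g eq(1,3)] *[OF h eq(2,4)] show ?thesis
    by (metis (no_types, lifting) homotopic_with_trans homotopic_with_symD)
qed

lemma contractible_imp_simply_connected_space:
  assumes "contractible_space C"
  shows "simply_connected_space C"
  unfolding simply_connected_space_def
proof (intro conjI ballI)
  show "path_connected_space C" using assms by (rule contractible_imp_path_connected_space)
  fix x assume x: "x \<in> topspace C"
  have "loop_homotopy C x = loops_at C x \<times> loops_at C x"
    using contractible_space_homotopic_paths[OF assms]
    by (auto simp: loop_homotopy_def loops_at_def)
  moreover have "(\<lambda>_. x) \<in> loops_at C x" using x by (simp add: loops_at_def pathin_def)
  ultimately show "carrier (fundamental_group C x) = {\<one>\<^bsub>fundamental_group C x\<^esub>}"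
    by (auto simp: fundamental_group_def quotient_def)
qed

section \<open>The fundamental group of the base of a regular covering\<close>

lemma pathin_path_concat:
  assumes "pathin C g" "pathin C h" "g 1 = h 0"
  shows "pathin C (path_concat g h)"
  unfolding pathin_def path_concat_def
proof (rule continuous_map_cases_le)
  let ?I = "{0..1::real}"
  have *: "continuous_map (subtopology (top_of_set ?I) S) C (k \<circ> f)"
    if "pathin C k" "continuous_on UNIV f" "\<And>t. t \<in> ?I \<Longrightarrow> t \<in> S \<Longrightarrow> f t \<in> ?I" for k f S
  proof (rule continuous_map_compose[of _ "top_of_set ?I"])
    show "continuous_map (subtopology (top_of_set ?I) S) (top_of_set ?I) f"
      using that continuous_on_subset[OF that(2)]
      by (auto simp: subtopology_subtopology continuous_map_in_subtopology)
  qed (use that in \<open>simp add: pathin_def\<close>)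
  show "continuous_map (subtopology (top_of_set ?I) {t \<in> topspace (top_of_set ?I). t \<le> 1/2}) C
      (\<lambda>t. g (2 * t))"
    by (rule *[unfolded o_def, OF assms(1)]) (auto intro!: continuous_intros)
  show "continuous_map (subtopology (top_of_set ?I) {t \<in> topspace (top_of_set ?I). 1/2 \<le> t}) C
      (\<lambda>t. h (2 * t - 1))"
    by (rule *[unfolded o_def, OF assms(2)]) (auto intro!: continuous_intros)
  show "g (2 * t) = h (2 * t - 1)" if "t \<in> topspace (top_of_set ?I)" "t = 1/2" for t
  proof -
    have "2 * t = 1" "2 * t - 1 = 0" using that(2) by simp_all
    then show ?thesis using assms(3) by metis
  qed
qed (auto intro!: continuous_intros)

text \<open>The map \<open>\<phi>\<close> lives on loops, so a covering argument can define it by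
  lifting single loops; passing to homotopy classes is done here once, through a chosen
  representative of each class.\<close>

lemma fundamental_group_iso_fibres:
  assumes "group G" and surj: "\<phi> ` loops_at X x = carrier G"
    and ker: "\<And>p q. p \<in> loops_at X x \<Longrightarrow> q \<in> loops_at X x \<Longrightarrow>
      (p, q) \<in> loop_homotopy X x \<longleftrightarrow> \<phi> p = \<phi> q"
    and mult: "\<And>p q. p \<in> loops_at X x \<Longrightarrow> q \<in> loops_at X x \<Longrightarrow>
      path_concat p q \<in> loops_at X x \<and> \<phi> (path_concat p q) = \<phi> p \<otimes>\<^bsub>G\<^esub> \<phi> q"
  shows "fundamental_group X x \<cong> G"
proof -
  let ?L = "loops_at X x" and ?P = "fundamental_group X x"
  let ?cl = "\<lambda>p. loop_homotopy X x `` {p}"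
  have cl: "?cl p = {q \<in> ?L. \<phi> q = \<phi> p}" if "p \<in> ?L" for p
    using ker that by (auto simp: loop_homotopy_def)
  define F where "F A = \<phi> (SOME p. p \<in> A)" for A
  have F: "F (?cl p) = \<phi> p" if "p \<in> ?L" for p
  proof -
    have "p \<in> ?cl p" using cl that by auto
    then have "(SOME p'. p' \<in> ?cl p) \<in> ?cl p" by (rule someI[of "\<lambda>p'. p' \<in> ?cl p"])
    then show ?thesis unfolding F_def using cl[OF that] by auto
  qed
  have carr: "carrier ?P = ?cl ` ?L" by (auto simp: fundamental_group_def quotient_def)
  have mult_cl: "?cl p \<otimes>\<^bsub>?P\<^esub> ?cl q = ?cl (path_concat p q)" if pq: "p \<in> ?L" "q \<in> ?L" for p q
  proof -
    have "?cl (path_concat p' q') = ?cl (path_concat p q)" if "p' \<in> ?cl p" "q' \<in> ?cl q" for p' q'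
      using that pq cl mult by auto
    then have "(\<Union>p'\<in>?cl p. \<Union>q'\<in>?cl q. ?cl (path_concat p' q')) =
        (\<Union>p'\<in>?cl p. \<Union>q'\<in>?cl q. ?cl (path_concat p q))"
      by (intro SUP_cong HOL.refl) blast
    moreover have "?cl p \<noteq> {}" "?cl q \<noteq> {}" using cl pq by auto
    ultimately show ?thesis by (simp add: fundamental_group_def)
  qed
  have "F \<in> iso ?P G"
    unfolding iso_def hom_def bij_betw_def
  proof (intro CollectI conjI ballI)
    show "F \<in> carrier ?P \<rightarrow> carrier G" using F surj carr by auto
    show "F (a \<otimes>\<^bsub>?P\<^esub> b) = F a \<otimes>\<^bsub>G\<^esub> F b" if ab: "a \<in> carrier ?P" "b \<in> carrier ?P" for a b
    proof -
      obtain p q where "a = ?cl p" "b = ?cl q" "p \<in> ?L" "q \<in> ?L" using ab carr by auto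
      then show ?thesis using mult_cl F mult by simp
    qed
    show "inj_on F (carrier ?P)"
    proof (rule inj_onI)
      fix a b assume ab: "a \<in> carrier ?P" "b \<in> carrier ?P" "F a = F b"
      obtain p q where "a = ?cl p" "b = ?cl q" "p \<in> ?L" "q \<in> ?L" using ab carr by auto
      then show "a = b" using ab(3) F cl by auto
    qed
    have "F ` carrier ?P = \<phi> ` ?L"
      unfolding carr image_image by (rule image_cong) (simp_all add: F)
    then show "F ` carrier ?P = carrier G" using surj by simp
  qed
  then show ?thesis by (auto simp: is_iso_def)
qed

text \<open>The isomorphism sends a loop \<open>g\<close> to the group element that moves the base point \<open>c0\<close> of
  \<open>C\<close> to the end of the lift of \<open>g\<close>.\<close>

theorem fundamental_group_regular_covering:
  assumes cov: "covering_map C p X" and C: "contractible_space C" and G: "group G"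
    and act: "\<And>a. a \<in> carrier G \<Longrightarrow> continuous_map C C (act a)"
    and act_mult: "\<And>a b c. a \<in> carrier G \<Longrightarrow> b \<in> carrier G \<Longrightarrow> c \<in> topspace C \<Longrightarrow>
      act (a \<otimes>\<^bsub>G\<^esub> b) c = act a (act b c)"
    and deck: "\<And>a c. a \<in> carrier G \<Longrightarrow> c \<in> topspace C \<Longrightarrow> p (act a c) = p c"
    and free: "\<And>a b c. a \<in> carrier G \<Longrightarrow> b \<in> carrier G \<Longrightarrow> c \<in> topspace C \<Longrightarrow>
      act a c = act b c \<Longrightarrow> a = b"
    and trans: "\<And>c c'. c \<in> topspace C \<Longrightarrow> c' \<in> topspace C \<Longrightarrow> p c = p c' \<Longrightarrow>
      \<exists>a\<in>carrier G. c' = act a c"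
    and x: "x \<in> topspace X"
  shows "fundamental_group X x \<cong> G"
proof -
  let ?L = "loops_at X x"
  have "x \<in> p ` topspace C" using covering_map_image[OF cov] x by simp
  then obtain c0 where c0: "c0 \<in> topspace C" "p c0 = x" by blast
  have lift: "\<exists>h. pathin C h \<and> h 0 = c0 \<and> (\<forall>t\<in>{0..1}. p (h t) = g t)" if g: "g \<in> ?L" for g
  proof -
    have "pathin X g" "p c0 = g 0" using g c0 by (auto simp: loops_at_def)
    then show ?thesis using covering_map_lift_path[OF cov _ c0(1)] by metis
  qed
  have ex: "\<exists>a\<in>carrier G. \<forall>h. pathin C h \<longrightarrow> h 0 = c0 \<longrightarrow> (\<forall>t\<in>{0..1}. p (h t) = g t) \<longrightarrow>
      h 1 = act a c0" if g: "g \<in> ?L" for g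
  proof -
    obtain h where h: "pathin C h" "h 0 = c0" "\<forall>t\<in>{0..1}. p (h t) = g t" using lift[OF g] by blast
    have "h 1 \<in> topspace C" using h(1) by (auto simp: pathin_def continuous_map_def)
    moreover have "p c0 = p (h 1)" using h(3) g c0 by (auto simp: loops_at_def)
    ultimately obtain a where a: "a \<in> carrier G" "h 1 = act a c0" using trans c0(1) by blast
    have "k 1 = h 1" if k: "pathin C k" "k 0 = c0" "\<forall>t\<in>{0..1}. p (k t) = g t" for k
      by (rule covering_map_lift_path_unique[OF cov k(1) h(1)]) (use h k in auto)
    with a show ?thesis by auto
  qed
  define \<phi> where "\<phi> g = (SOME a. a \<in> carrier G \<and> (\<forall>h. pathin C h \<longrightarrow> h 0 = c0 \<longrightarrow>
      (\<forall>t\<in>{0..1}. p (h t) = g t) \<longrightarrow> h 1 = act a c0))" for g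
  have \<phi>: "\<phi> g \<in> carrier G" "\<And>h. pathin C h \<Longrightarrow> h 0 = c0 \<Longrightarrow>
      (\<And>t. t \<in> {0..1} \<Longrightarrow> p (h t) = g t) \<Longrightarrow> h 1 = act (\<phi> g) c0" if "g \<in> ?L" for g
    using someI_ex[of "\<lambda>a. a \<in> carrier G \<and> (\<forall>h. pathin C h \<longrightarrow> h 0 = c0 \<longrightarrow>
      (\<forall>t\<in>{0..1}. p (h t) = g t) \<longrightarrow> h 1 = act a c0)"] ex[OF that] unfolding \<phi>_def by blast+
  have actC: "act a c \<in> topspace C" if "a \<in> carrier G" "c \<in> topspace C" for a c
    using act[OF that(1)] that(2) by (auto simp: continuous_map_def)
  show ?thesis
  proof (rule fundamental_group_iso_fibres[OF G])
    show "\<phi> ` ?L = carrier G"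
    proof (intro equalityI subsetI)
      fix a assume a: "a \<in> carrier G"
      obtain h where h: "pathin C h" "h 0 = c0" "h 1 = act a c0"
        using contractible_imp_path_connected_space[OF C] c0(1) actC[OF a c0(1)]
        unfolding path_connected_space_def by blast
      have "p \<circ> h \<in> ?L"
        using h c0 deck[OF a c0(1)] covering_map_continuous[OF cov]
        by (auto simp: loops_at_def pathin_def intro: continuous_map_compose)
      moreover from \<phi>(2)[OF this h(1,2)] have "act (\<phi> (p \<circ> h)) c0 = act a c0" using h(3) by simp
      ultimately have "\<phi> (p \<circ> h) = a" using free[OF \<phi>(1) a c0(1)] by blast
      with \<open>p \<circ> h \<in> ?L\<close> show "a \<in> \<phi> ` ?L" by blast
    qed (use \<phi>(1) in blast)
  next
    fix f g assume fg: "f \<in> ?L" "g \<in> ?L"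
    obtain h where h: "pathin C h" "h 0 = c0" "\<forall>t\<in>{0..1}. p (h t) = f t" using lift[OF fg(1)] by blast
    obtain k where k: "pathin C k" "k 0 = c0" "\<forall>t\<in>{0..1}. p (k t) = g t" using lift[OF fg(2)] by blast
    have h1: "h 1 = act (\<phi> f) c0" using \<phi>(2)[OF fg(1) h(1,2)] h(3) by blast
    have k1: "k 1 = act (\<phi> g) c0" using \<phi>(2)[OF fg(2) k(1,2)] k(3) by blast
    show "(f, g) \<in> loop_homotopy X x \<longleftrightarrow> \<phi> f = \<phi> g"
    proof
      assume "(f, g) \<in> loop_homotopy X x"
      then have "h 1 = k 1"
        using h k by (intro covering_map_monodromy[OF cov h(1) k(1)]) (auto simp: loop_homotopy_def)
      then show "\<phi> f = \<phi> g" using h1 k1 free[OF \<phi>(1)[OF fg(1)] \<phi>(1)[OF fg(2)] c0(1)] by simp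
    next
      assume eq: "\<phi> f = \<phi> g"
      have p1: "p (h 1) = x" using h(3) fg by (auto simp: loops_at_def)
      \<comment> \<open>Lifts with the same ends are homotopic in the contractible space, and the
        homotopy projects to \<open>X\<close>.\<close>
      have "homotopic_with (\<lambda>r. r 0 = c0 \<and> r 1 = h 1) (top_of_set {0..1}) C h k"
        using h k h1 k1 eq by (intro contractible_space_homotopic_paths[OF C]) auto
      then have hk: "homotopic_with (\<lambda>r. r 0 = x \<and> r 1 = x) (top_of_set {0..1}) X (p \<circ> h) (p \<circ> k)"
        by (rule homotopic_with_compose_continuous_map_left[OF _ covering_map_continuous[OF cov]])
          (auto simp: c0 p1)
      \<comment> \<open>The projected lift agrees with the given loop only on \<open>{0..1}\<close>,
        so even this identification is made by a homotopy.\<close>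
      have "homotopic_with (\<lambda>r. r 0 = x \<and> r 1 = x) (top_of_set {0..1}) X f (p \<circ> h)"
        using fg h p1 c0 by (intro homotopic_with_equal) (auto simp: loops_at_def pathin_def)
      moreover have "homotopic_with (\<lambda>r. r 0 = x \<and> r 1 = x) (top_of_set {0..1}) X (p \<circ> k) g"
        using fg k p1 c0 h1 k1 eq
        by (intro homotopic_with_symD[OF homotopic_with_equal]) (auto simp: loops_at_def pathin_def)
      ultimately show "(f, g) \<in> loop_homotopy X x"
        using fg hk unfolding loop_homotopy_def by (auto intro: homotopic_with_trans)
    qed
    have concat: "path_concat f g \<in> ?L"
      using fg pathin_path_concat[of X f g] by (auto simp: loops_at_def path_concat_def)
    \<comment> \<open>The lift of \<open>g\<close> that continues \<open>h\<close> is the translate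
      of \<open>k\<close> by \<open>\<phi> f\<close>; its end shows that concatenation becomes
      multiplication.\<close>
    let ?k = "act (\<phi> f) \<circ> k"
    have k': "pathin C ?k" "?k 0 = h 1" "\<forall>t\<in>{0..1}. p (?k t) = g t"
    proof -
      show "pathin C ?k" using k(1) act[OF \<phi>(1)[OF fg(1)]] unfolding pathin_def
        by (rule continuous_map_compose)
      show "?k 0 = h 1" by (simp add: k h1)
      have "k t \<in> topspace C" if "t \<in> {0..1}" for t
        using k(1) that by (auto simp: pathin_def continuous_map_def)
      then show "\<forall>t\<in>{0..1}. p (?k t) = g t" using deck[OF \<phi>(1)[OF fg(1)]] k(3) by simp
    qed
    have "path_concat h ?k 1 = act (\<phi> (path_concat f g)) c0"
    proof (rule \<phi>(2)[OF concat])
      show "pathin C (path_concat h ?k)" using h(1) k' by (intro pathin_path_concat) auto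
      show "path_concat h ?k 0 = c0" by (simp add: path_concat_def h)
      show "p (path_concat h ?k t) = path_concat f g t" if "t \<in> {0..1}" for t
        using that h(3) k'(3) by (auto simp: path_concat_def)
    qed
    moreover have "path_concat h ?k 1 = act (\<phi> f \<otimes>\<^bsub>G\<^esub> \<phi> g) c0"
      using act_mult[OF \<phi>(1)[OF fg(1)] \<phi>(1)[OF fg(2)] c0(1)] k1 by (simp add: path_concat_def)
    ultimately have "\<phi> (path_concat f g) = \<phi> f \<otimes>\<^bsub>G\<^esub> \<phi> g"
      using free[OF \<phi>(1)[OF concat] _ c0(1)] \<phi>(1)[OF fg(1)] \<phi>(1)[OF fg(2)]
        group.is_monoid[OF G] monoid.m_closed by metis
    with concat show "path_concat f g \<in> ?L \<and> \<phi> (path_concat f g) = \<phi> f \<otimes>\<^bsub>G\<^esub> \<phi> g" by blast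
  qed
qed

text \<open>Reversed, the contraction of \<open>C0\<close> leads from a constant map to the
  identity. Its projection to \<open>X\<close> lifts to \<open>C\<close>, starting at a constant,
  and the final stage \<open>f\<close> is a map of \<open>C0\<close> to \<open>C\<close> over
  \<open>X\<close>. It turns out to be a homeomorphism.\<close>

theorem universal_covering_contractible:
  assumes cov0: "covering_map C0 p0 X" and C0: "contractible_space C0" "topspace C0 \<noteq> {}"
    and uni: "universal_covering C p X"
  shows "contractible_space C"
proof -
  let ?I = "{0..1::real}"
  have cov: "covering_map C p X" and sc: "simply_connected_space C"
    using uni by (auto simp: universal_covering_def)
  obtain a where "homotopic_with (\<lambda>_. True) C0 C0 id (\<lambda>_. a)"
    using C0(1) unfolding contractible_space_def by blast
  from homotopic_with_symD[OF this] obtain H where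
    H: "continuous_map (prod_topology (top_of_set ?I) C0) C0 H"
      "\<And>z. H (0, z) = a" "\<And>z. H (1, z) = z"
    unfolding homotopic_with_def by auto
  obtain z where "z \<in> topspace C0" using C0(2) by blast
  then have "(0, z) \<in> topspace (prod_topology (top_of_set ?I) C0)" by simp
  then have "H (0, z) \<in> topspace C0" using H(1) unfolding continuous_map_def by blast
  then have a: "a \<in> topspace C0" by (simp add: H(2))
  then have "p0 a \<in> p ` topspace C" using covering_map_image[OF cov] covering_map_image[OF cov0] by auto
  then obtain c where c: "c \<in> topspace C" "p c = p0 a" by auto
  have "continuous_map (prod_topology (top_of_set ?I) C0) X (p0 \<circ> H)"
    by (rule continuous_map_compose[OF H(1) covering_map_continuous[OF cov0]])
  then obtain K where K: "continuous_map (prod_topology (top_of_set ?I) C0) C K"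
      "\<And>t y. t \<in> ?I \<Longrightarrow> y \<in> topspace C0 \<Longrightarrow> p (K (t, y)) = (p0 \<circ> H) (t, y)"
    by (rule covering_map_lift_homotopy[OF cov, of C0 _ "\<lambda>_. c"]) (use c H in auto)
  define f where "f = K \<circ> (\<lambda>z. (1, z))"
  have f: "continuous_map C0 C f"
    unfolding f_def by (rule continuous_map_compose[OF _ K(1)]) (simp add: continuous_map_pairwise o_def)
  have fC: "f z \<in> topspace C" if "z \<in> topspace C0" for z
    using f that by (auto simp: continuous_map_def)
  have pf: "p (f z) = p0 z" if "z \<in> topspace C0" for z using K(2)[of 1 z] that H(3) by (simp add: f_def)
  \<comment> \<open>A path from \<open>u\<close> to \<open>v\<close> becomes a loop in
    \<open>C\<close>, which is null-homotopic there. Its projection to \<open>X\<close> is then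
    null-homotopic as well, and monodromy in \<open>C0\<close> compares the path with the constant
    path at \<open>u\<close>.\<close>
  have inj: "inj_on f (topspace C0)"
  proof (rule inj_onI)
    fix u v assume uv: "u \<in> topspace C0" "v \<in> topspace C0" "f u = f v"
    obtain g where g: "pathin C0 g" "g 0 = u" "g 1 = v"
      using contractible_imp_path_connected_space[OF C0(1)] uv
      unfolding path_connected_space_def by blast
    have "f \<circ> g \<in> loops_at C (f u)"
      using g f uv(3) by (auto simp: loops_at_def pathin_def intro: continuous_map_compose)
    moreover have "(\<lambda>_. f u) \<in> loops_at C (f u)" using fC[OF uv(1)] by (simp add: loops_at_def pathin_def)
    moreover have "carrier (fundamental_group C (f u)) = {\<one>\<^bsub>fundamental_group C (f u)\<^esub>}"
      using sc fC[OF uv(1)] unfolding simply_connected_space_def by blast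
    ultimately have "loop_homotopy C (f u) `` {f \<circ> g} = loop_homotopy C (f u) `` {\<lambda>_. f u}"
      using quotientI[of "f \<circ> g" "loops_at C (f u)" "loop_homotopy C (f u)"]
      unfolding fundamental_group_def by simp
    moreover have "(\<lambda>_. f u) \<in> loop_homotopy C (f u) `` {\<lambda>_. f u}"
      using fC[OF uv(1)] by (simp add: loop_homotopy_def loops_at_def pathin_def)
    ultimately have "(f \<circ> g, \<lambda>_. f u) \<in> loop_homotopy C (f u)" by blast
    then have hom: "homotopic_with (\<lambda>r. r 0 = f u \<and> r 1 = f u) (top_of_set ?I) C (f \<circ> g) (\<lambda>_. f u)"
      by (simp add: loop_homotopy_def)
    have "homotopic_with (\<lambda>r. r 0 = p0 u \<and> r 1 = p0 u) (top_of_set ?I) X (p \<circ> (f \<circ> g)) (p \<circ> (\<lambda>_. f u))"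
      by (rule homotopic_with_compose_continuous_map_left[OF hom covering_map_continuous[OF cov]])
        (use pf[OF uv(1)] pf[OF uv(2)] uv in auto)
    then have "g 1 = (\<lambda>_. u) 1"
    proof (rule covering_map_monodromy[OF cov0 g(1), rotated 2])
      show "p0 (g t) = (p \<circ> (f \<circ> g)) t" if "t \<in> ?I" for t
      proof -
        have "g t \<in> topspace C0" using g(1) that by (auto simp: pathin_def continuous_map_def)
        from pf[OF this] show ?thesis by simp
      qed
    qed (use g uv pf[OF uv(1)] pf[OF uv(2)] in \<open>auto simp: pathin_def\<close>)
    then show "u = v" using g by simp
  qed
  \<comment> \<open>A path in \<open>C\<close> from \<open>f a\<close> is the \<open>f\<close>-image
    of the lift of its projection to \<open>C0\<close>.\<close>
  have surj: "f ` topspace C0 = topspace C"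
  proof (intro equalityI subsetI)
    fix d assume d: "d \<in> topspace C"
    obtain g where g: "pathin C g" "g 0 = f a" "g 1 = d"
      using sc d fC[OF a] unfolding simply_connected_space_def path_connected_space_def by blast
    have "pathin X (p \<circ> g)"
      using g(1) covering_map_continuous[OF cov] unfolding pathin_def by (rule continuous_map_compose)
    then obtain h where h: "pathin C0 h" "h 0 = a" "\<And>t. t \<in> ?I \<Longrightarrow> p0 (h t) = (p \<circ> g) t"
      by (rule covering_map_lift_path[OF cov0 _ a]) (use g pf[OF a] in auto)
    have hC: "h t \<in> topspace C0" if "t \<in> ?I" for t
      using h(1) that by (auto simp: pathin_def continuous_map_def)
    have "(f \<circ> h) 1 = g 1"
    proof (rule covering_map_lift_path_unique[OF cov _ g(1)])
      show "pathin C (f \<circ> h)" using h(1) f unfolding pathin_def by (rule continuous_map_compose)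
      show "p ((f \<circ> h) t) = p (g t)" if "t \<in> ?I" for t using pf[OF hC[OF that]] h(3)[OF that] by simp
    qed (use g h in auto)
    then show "d \<in> f ` topspace C0" using g hC[of 1] by auto
  qed (use fC in blast)
  have "open_map C0 C f"
    unfolding open_map_def
  proof (intro allI impI, subst openin_subopen, intro ballI)
    fix W d assume W: "openin C0 W" "d \<in> f ` W"
    then obtain w where w: "w \<in> W" "d = f w" by blast
    have WC: "W \<subseteq> topspace C0" using W(1) openin_subset by blast
    have "p d \<in> topspace X" using w WC fC covering_map_image[OF cov] by blast
    from covering_map_sheets[OF cov this] obtain T where T: "openin X T" "p d \<in> T"
      "\<forall>c\<in>topspace C. p c \<in> T \<longrightarrow>
      (\<exists>U s. c \<in> U \<and> sheet C p X T U s)"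
      by (elim exE conjE) (rule that)
    have dC: "d \<in> topspace C" using w WC fC by blast
    obtain U s where U: "openin C U" "d \<in> U" "\<forall>u\<in>U. s (p u) = u"
      using T(3)[rule_format, OF dC T(2)] unfolding sheet_def by (elim exE conjE) (rule that)
    define W' where "W' = W \<inter> {z \<in> topspace C0. f z \<in> U}"
    have W': "openin C0 W'"
      unfolding W'_def by (intro openin_Int W openin_continuous_map_preimage[OF f] U)
    \<comment> \<open>Inside the sheet \<open>U\<close> a point is determined by its projection, so
      a point of \<open>U\<close> over \<open>p0 w'\<close> must be \<open>f w'\<close>.\<close>
    let ?V = "U \<inter> {c \<in> topspace C. p c \<in> p0 ` W'}"
    have "openin C ?V"
      by (intro openin_Int U openin_continuous_map_preimage[OF covering_map_continuous[OF cov]]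
          covering_map_open[OF cov0 W'])
    moreover have "d \<in> ?V" using U(2) w WC dC pf by (auto simp: W'_def)
    moreover have "?V \<subseteq> f ` W"
    proof
      fix u assume u: "u \<in> ?V"
      then obtain w' where w': "w' \<in> W" "w' \<in> topspace C0" "f w' \<in> U" "p u = p0 w'" "u \<in> U"
        by (auto simp: W'_def)
      have "u = s (p u)" using bspec[OF U(3) w'(5)] by (rule HOL.sym)
      also have "\<dots> = s (p (f w'))" using w' pf by simp
      also have "\<dots> = f w'" by (rule bspec[OF U(3) w'(3)])
      finally show "u \<in> f ` W" using w'(1) by blast
    qed
    ultimately show "\<exists>V. openin C V \<and> d \<in> V \<and> V \<subseteq> f ` W" by blast
  qed
  then have "homeomorphic_map C0 C f"
    using f inj surj by (simp add: bijective_open_imp_homeomorphic_map)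
  then show ?thesis
    using C0(1) homeomorphic_map_imp_homeomorphic_space homeomorphic_space_contractibility by blast
qed

section \<open>Transport of coverings to other spaces and types\<close>

lemma covering_map_compose_homeomorphic:
  assumes cov: "covering_map C p X" and h: "homeomorphic_map D C h"
  shows "covering_map D (p \<circ> h) X"
  unfolding covering_map_def
proof (intro conjI ballI)
  have hc: "continuous_map D C h" and hi: "h ` topspace D = topspace C"
    using h homeomorphic_imp_continuous_map homeomorphic_imp_surjective_map by blast+
  show "continuous_map D X (p \<circ> h)"
    by (rule continuous_map_compose[OF hc covering_map_continuous[OF cov]])
  show "(p \<circ> h) ` topspace D = topspace X"
    using covering_map_image[OF cov] hi by (metis image_comp)
  fix x assume x: "x \<in> topspace X"
  obtain T \<U> where T: "x \<in> T" "openin X T" "\<Union>\<U> = {c \<in> topspace C. p c \<in> T}"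
      and op: "\<forall>U\<in>\<U>. openin C U" and dis: "pairwise disjnt \<U>"
      and hom: "\<forall>U\<in>\<U>. homeomorphic_map (subtopology C U) (subtopology X T) p"
    using covering_map_evenly[OF cov x] by (elim exE conjE) (rule that)
  define g where "g U = {d \<in> topspace D. h d \<in> U}" for U
  have hg: "homeomorphic_map (subtopology D (g U)) (subtopology C U) h" if "U \<in> \<U>" for U
  proof (rule homeomorphic_map_subtopologies[OF h])
    show "h ` (topspace D \<inter> g U) = topspace C \<inter> U" using hi by (auto simp: g_def)
  qed
  show "\<exists>T. x \<in> T \<and> openin X T \<and> (\<exists>\<U>. \<Union>\<U> = {c \<in> topspace D. (p \<circ> h) c \<in> T} \<and>
      (\<forall>U\<in>\<U>. openin D U) \<and> pairwise disjnt \<U> \<and>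
      (\<forall>U\<in>\<U>. homeomorphic_map (subtopology D U) (subtopology X T) (p \<circ> h)))"
  proof (intro exI[of _ T] exI[of _ "g ` \<U>"] conjI ballI T)
    have "\<Union>(g ` \<U>) = {d \<in> topspace D. h d \<in> \<Union>\<U>}" by (auto simp: g_def)
    then show "\<Union>(g ` \<U>) = {c \<in> topspace D. (p \<circ> h) c \<in> T}" using T(3) hi by auto
    show "pairwise disjnt (g ` \<U>)"
      using dis unfolding pairwise_def disjnt_def g_def by blast
  next
    fix W assume "W \<in> g ` \<U>"
    then obtain U where U: "U \<in> \<U>" "W = g U" by blast
    show "openin D W"
      unfolding U(2) g_def using hc op U(1) openin_continuous_map_preimage by blast
    show "homeomorphic_map (subtopology D W) (subtopology X T) (p \<circ> h)"
      unfolding U(2) using homeomorphic_map_compose[OF hg[OF U(1)]] hom U(1) by blast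
  qed
qed

text \<open>An injection into another type carries the topology along; in this way a covering space
  is copied to the type prescribed by the theorem.\<close>

lemma homeomorphic_map_pullback_topology:
  assumes j: "inj_on j (topspace C)"
  shows "homeomorphic_map (pullback_topology (j ` topspace C) (inv_into (topspace C) j) C) C
    (inv_into (topspace C) j)"
proof -
  let ?i = "inv_into (topspace C) j"
  let ?D = "pullback_topology (j ` topspace C) ?i C"
  have top: "topspace ?D = j ` topspace C"
    using j by (auto simp: topspace_pullback_topology)
  have "continuous_map ?D C ?i"
    using continuous_map_pullback[OF continuous_map_id, of _ ?i C] by simp
  moreover have "continuous_map C ?D j"
    by (rule continuous_map_pullback') (auto simp: j intro: continuous_map_eq[OF continuous_map_id])
  ultimately have "homeomorphic_maps ?D C ?i j"
    using j by (auto simp: homeomorphic_maps_def top f_inv_into_f)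
  then show ?thesis using homeomorphic_map_maps by blast
qed

text \<open>A point \<open>c\<close> is recorded by the set of projections of the paths from a base point
  to \<open>c\<close>.\<close>

theorem universal_covering_on_path_classes:
  fixes X :: "'b topology"
  assumes cov: "covering_map C p X" and C: "contractible_space C" and c0: "c0 \<in> topspace C"
  shows "\<exists>(D :: (real \<Rightarrow> 'b) set topology) q. universal_covering D q X"
proof -
  define j where "j c = {p \<circ> g | g. pathin C g \<and> g 0 = c0 \<and> g 1 = c}" for c
  have "inj_on j (topspace C)"
  proof (rule inj_onI)
    fix c d assume cd: "c \<in> topspace C" "d \<in> topspace C" "j c = j d"
    obtain g where g: "pathin C g" "g 0 = c0" "g 1 = c"
      using contractible_imp_path_connected_space[OF C] c0 cd(1)
      unfolding path_connected_space_def by blast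
    then have "p \<circ> g \<in> j d" using cd(3) by (auto simp: j_def)
    then obtain h where h: "pathin C h" "h 0 = c0" "h 1 = d" "p \<circ> g = p \<circ> h"
      by (auto simp: j_def)
    \<comment> \<open>Paths from \<open>c0\<close> with the same projection coincide on
      \<open>{0..1}\<close>, so a projected path determines the end point.\<close>
    have "g 1 = h 1"
      by (rule covering_map_lift_path_unique[OF cov g(1) h(1)])
        (use g h in \<open>auto simp: o_def fun_eq_iff\<close>)
    then show "c = d" using g h by simp
  qed
  note hom = homeomorphic_map_pullback_topology[OF this]
  let ?D = "pullback_topology (j ` topspace C) (inv_into (topspace C) j) C"
  have "contractible_space ?D"
    using hom C homeomorphic_map_imp_homeomorphic_space homeomorphic_space_contractibility by blast
  then have "universal_covering ?D (p \<circ> inv_into (topspace C) j) X"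
    unfolding universal_covering_def
    using covering_map_compose_homeomorphic[OF cov hom] contractible_imp_simply_connected_space by blast
  then show ?thesis by blast
qed

section \<open>Graph groups and pilings\<close>

definition lsign :: "bool \<Rightarrow> int" where
  "lsign e = (if e then 1 else - 1)"

lemma lsign_simps [simp]:
  "lsign True = 1" "lsign False = - 1" "lsign (\<not> e) = - lsign e"
  "lsign e \<noteq> 0" "0 \<noteq> lsign e" "lsign e = lsign d \<longleftrightarrow> e = d"
  "- lsign e = lsign d \<longleftrightarrow> e \<noteq> d" "lsign e = - lsign d \<longleftrightarrow> e \<noteq> d"
  "lsign e \<noteq> - lsign e"
  by (auto simp: lsign_def)

lemma lsign_cases: "k \<in> {-1, 0, 1} \<Longrightarrow> k \<noteq> 0 \<Longrightarrow> \<exists>e. k = lsign e"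
  by (metis lsign_simps(1,2) insertE singletonD)

locale simplicial_graph =
  fixes V :: "'v set" and E :: "'v set set"
  assumes finite_graph: "finite_simplicial_graph V E"
begin

abbreviation "G \<equiv> graph_group V E"

abbreviation "Gs \<equiv> carrier G"

abbreviation one_G ("\<e>") where "\<e> \<equiv> \<one>\<^bsub>G\<^esub>"

abbreviation mult_G (infixl "\<cdot>" 70) where "x \<cdot> y \<equiv> x \<otimes>\<^bsub>G\<^esub> y"

definition adj :: "'v \<Rightarrow> 'v \<Rightarrow> bool" where "adj u v \<longleftrightarrow> {u, v} \<in> E"

lemma adj_sym: "adj u v \<longleftrightarrow> adj v u"
  by (simp add: adj_def insert_commute)

lemma adjD: assumes "adj u v" shows "u \<in> V" "v \<in> V" "u \<noteq> v"
proof -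
  have "{u, v} \<subseteq> V" "card {u, v} = 2"
    using assms finite_graph by (auto simp: adj_def finite_simplicial_graph_def)
  then show "u \<in> V" "v \<in> V" "u \<noteq> v" by auto
qed

lemma adj_irrefl [simp]: "\<not> adj u u" using adjD by blast

lemma finite_V: "finite V" using finite_graph by (simp add: finite_simplicial_graph_def)

lemma cliques_iff: "Q \<in> cliques V E \<longleftrightarrow> Q \<subseteq> V \<and> (\<forall>x\<in>Q. \<forall>y\<in>Q. x \<noteq> y \<longrightarrow> adj x y)"
  by (simp add: cliques_def adj_def)

lemma cliques_subset: "Q \<in> cliques V E \<Longrightarrow> P \<subseteq> Q \<Longrightarrow> P \<in> cliques V E"
  by (auto simp: cliques_def)

definition "relators = {([(x, True), (y, True)], [(y, True), (x, True)]) | x y. {x, y} \<in> E}"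

abbreviation "gcong \<equiv> presentation_cong V relators"

definition cls :: "'v gword \<Rightarrow> 'v gword set" where "cls w = gcong `` {w}"

definition lt :: "'v \<Rightarrow> bool \<Rightarrow> 'v gword set" where "lt v e = cls [(v, e)]"

lemma G_eq: "G = presented_group V relators"
  by (simp add: graph_group_def relators_def)

lemma group_G: "group G" by (simp add: G_eq group_presented_group)

sublocale G: group G by (rule group_G)

lemma carrier_G: "Gs = cls ` gwords V"
  by (auto simp: G_eq presented_group_def cls_def quotient_def)

lemma cls_closed: "w \<in> gwords V \<Longrightarrow> cls w \<in> Gs" by (simp add: carrier_G)

lemma one_eq_cls: "\<e> = cls []" by (simp add: G_eq presented_group_def cls_def)

lemma cls_append: "u \<in> gwords V \<Longrightarrow> w \<in> gwords V \<Longrightarrow> cls u \<cdot> cls w = cls (u @ w)"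
  by (simp add: G_eq cls_def presented_group_mult)

lemma cls_eq: "(u, w) \<in> gcong \<Longrightarrow> cls u = cls w"
  unfolding cls_def by (rule equiv_class_eq[OF equiv_presentation_cong])

lemma gwords_simps [simp]:
  "[] \<in> gwords V" "(v, e) # w \<in> gwords V \<longleftrightarrow> v \<in> V \<and> w \<in> gwords V"
  "u @ w \<in> gwords V \<longleftrightarrow> u \<in> gwords V \<and> w \<in> gwords V"
  by (auto simp: gwords_def)

lemma lt_closed [simp]: "v \<in> V \<Longrightarrow> lt v e \<in> Gs"
  by (simp add: lt_def cls_closed)

lemma cls_snoc: "w \<in> gwords V \<Longrightarrow> v \<in> V \<Longrightarrow> cls (w @ [(v, e)]) = cls w \<cdot> lt v e"
  by (simp add: lt_def cls_append)

lemma lt_cancel: assumes "v \<in> V" shows "lt v e \<cdot> lt v (\<not> e) = \<e>"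
  using assms cls_eq[OF presentation_cong.cancel[of v V "[]" "[]" e relators]]
  by (simp add: lt_def cls_append one_eq_cls)

lemma inv_lt: "v \<in> V \<Longrightarrow> inv\<^bsub>G\<^esub> lt v e = lt v (\<not> e)"
  using lt_cancel[of v "\<not> e"] by (intro G.inv_equality) auto

lemma commute_inv:
  assumes "x \<in> Gs" "y \<in> Gs" "x \<cdot> y = y \<cdot> x"
  shows "x \<cdot> inv\<^bsub>G\<^esub> y = inv\<^bsub>G\<^esub> y \<cdot> x"
  by (metis G.inv_solve_left G.inv_solve_right assms G.inv_closed G.m_assoc G.m_closed)

lemma lt_commute: assumes "adj u v" shows "lt u d \<cdot> lt v e = lt v e \<cdot> lt u d"
proof -
  note V = adjD[OF assms]
  have "(([(u, True), (v, True)], [(v, True), (u, True)])) \<in> relators"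
    using assms by (auto simp: relators_def adj_def)
  from presentation_cong.relation[OF this, of V "[]" "[]"] V
  have 1: "lt u True \<cdot> lt v True = lt v True \<cdot> lt u True"
    by (simp add: lt_def cls_append cls_eq)
  have 2: "lt u True \<cdot> lt v e = lt v e \<cdot> lt u True" for e
    using commute_inv[OF _ _ 1] 1 V inv_lt[of v True] by (cases e) auto
  show ?thesis
    using commute_inv[OF _ _ HOL.sym[OF 2[of e]]] 2[of e] V inv_lt[of u True] by (cases d) auto
qed

section \<open>Functions of words that descend to the group; exponent sums\<close>

definition lift_word :: "('v gword \<Rightarrow> 'b) \<Rightarrow> 'v gword set \<Rightarrow> 'b" where
  "lift_word F g = F (SOME w. w \<in> g)"

lemma lift_word_cls:
  assumes F: "\<And>u w. (u, w) \<in> gcong \<Longrightarrow> F u = F w" and w: "w \<in> gwords V"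
  shows "lift_word F (cls w) = F w"
proof -
  have "w \<in> cls w" using w by (simp add: cls_def presentation_cong.refl)
  then have "(SOME w'. w' \<in> cls w) \<in> cls w" by (rule someI[of "\<lambda>w'. w' \<in> cls w"])
  then show ?thesis using F unfolding cls_def lift_word_def by auto
qed

definition abw :: "'v gword \<Rightarrow> 'v \<Rightarrow> int" where
  "abw w v = (\<Sum>x\<leftarrow>w. if fst x = v then lsign (snd x) else 0)"

lemma abw_cong: "(u, w) \<in> gcong \<Longrightarrow> abw u = abw w"
  by (induction rule: presentation_cong.induct) (auto simp: abw_def relators_def fun_eq_iff)

text \<open>The abelianization in coordinates. Inside a flat it recovers the integer coordinates of
  a vertex relative to another one.\<close>

definition ab :: "'v gword set \<Rightarrow> 'v \<Rightarrow> int" where "ab = lift_word abw"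

lemma ab_cls: "w \<in> gwords V \<Longrightarrow> ab (cls w) = abw w"
  unfolding ab_def by (rule lift_word_cls[OF abw_cong])

lemma ab_mult:
  assumes "g \<in> Gs" "h \<in> Gs" shows "ab (g \<cdot> h) v = ab g v + ab h v"
  using assms by (auto simp: carrier_G cls_append ab_cls abw_def)

lemma ab_one [simp]: "ab \<e> v = 0" by (simp add: one_eq_cls ab_cls abw_def)

lemma ab_inv: assumes "g \<in> Gs" shows "ab (inv\<^bsub>G\<^esub> g) v = - ab g v"
  using ab_mult[OF assms G.inv_closed[OF assms], of v] assms by simp

lemma ab_lt: "v \<in> V \<Longrightarrow> ab (lt v e) u = (if u = v then lsign e else 0)"
  by (simp add: lt_def ab_cls abw_def)

text \<open>One stack of beads for each vertex, with the top at the head of the list. A letter puts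
  a signed bead on its own stack and a neutral 0 on the stacks of the other vertices that do not
  commute with it. Commuting letters leave no trace on each other's stacks, so their order is
  forgotten.\<close>

definition push :: "'v \<times> bool \<Rightarrow> ('v \<Rightarrow> int list) \<Rightarrow> 'v \<Rightarrow> int list" where
  "push x \<pi> u = (if u = fst x then lsign (snd x) # \<pi> u
    else if adj u (fst x) then \<pi> u else 0 # \<pi> u)"

definition pop :: "'v \<Rightarrow> ('v \<Rightarrow> int list) \<Rightarrow> 'v \<Rightarrow> int list" where
  "pop v \<pi> u = (if adj u v then \<pi> u else tl (\<pi> u))"

definition ptop :: "('v \<Rightarrow> int list) \<Rightarrow> 'v \<Rightarrow> int" where
  "ptop \<pi> v = (if \<pi> v = [] then 0 else hd (\<pi> v))"

text \<open>An opposite bead on top of the letter's own stack is cancelled, together with the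
  neutral beads that came with it. That these are on top of their stacks holds for stacks built from
  words; hence the hypothesis \<open>piling\<close> below.\<close>

definition pile :: "'v \<times> bool \<Rightarrow> ('v \<Rightarrow> int list) \<Rightarrow> 'v \<Rightarrow> int list" where
  "pile x \<pi> = (if ptop \<pi> (fst x) = - lsign (snd x) then pop (fst x) \<pi> else push x \<pi>)"

lemma top_push: "ptop (push x \<pi>) u =
    (if u = fst x then lsign (snd x) else if adj u (fst x) then ptop \<pi> u else 0)"
  by (simp add: ptop_def push_def)

lemma pop_push: "pop (fst x) (push x \<pi>) = \<pi>"
  by (auto simp: pop_def push_def fun_eq_iff)

text \<open>Words in which no letter cancels while being piled, together with the resulting
  stacks.\<close>

inductive reduced :: "'v gword \<Rightarrow> ('v \<Rightarrow> int list) \<Rightarrow> bool" where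
  Nil: "reduced [] (\<lambda>_. [])"
| snoc: "reduced w \<pi> \<Longrightarrow> v \<in> V \<Longrightarrow> ptop \<pi> v \<noteq> - lsign e \<Longrightarrow>
    reduced (w @ [(v, e)]) (push (v, e) \<pi>)"

lemma reduced_gwords: "reduced w \<pi> \<Longrightarrow> w \<in> gwords V"
  by (induction rule: reduced.induct) auto

lemma top_reduced: "reduced w \<pi> \<Longrightarrow> ptop \<pi> u \<in> {-1, 0, 1}"
proof (induction arbitrary: u rule: reduced.induct)
  case Nil
  then show ?case by (simp add: ptop_def)
next
  case (snoc w \<pi> v e)
  then show ?case by (auto simp: top_push lsign_def)
qed

text \<open>A bead visible on top of its stack can be made the last letter of the word. If the last
  letter \<open>u\<close> is different from \<open>v\<close>, it must commute with \<open>v\<close>,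
  as its neutral bead would otherwise cover the stack of \<open>v\<close>; so the letter found by
  induction moves past it.\<close>

lemma reduced_pop:
  assumes "reduced w \<pi>" "v \<in> V" "ptop \<pi> v = lsign e"
  shows "\<exists>w'. reduced w' (pop v \<pi>) \<and> cls w = cls w' \<cdot> lt v e \<and>
    push (v, e) (pop v \<pi>) = \<pi> \<and> ptop (pop v \<pi>) v \<noteq> - lsign e"
  using assms
proof (induction rule: reduced.induct)
  case Nil
  then show ?case by (simp add: ptop_def)
next
  case (snoc w \<pi> u d)
  show ?case
  proof (cases "u = v")
    case True
    with snoc have "d = e" by (simp add: top_push)
    with True snoc show ?thesis
      using pop_push[of "(v, e)" \<pi>]
      by (intro exI[of _ w]) (auto simp: cls_snoc reduced_gwords)
  next
    case False
    with snoc.prems have uv: "adj v u" and ptop: "ptop \<pi> v = lsign e"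
      by (auto simp: top_push split: if_splits)
    obtain w' where w': "reduced w' (pop v \<pi>)" "cls w = cls w' \<cdot> lt v e"
        "push (v, e) (pop v \<pi>) = \<pi>" "ptop (pop v \<pi>) v \<noteq> - lsign e"
      using snoc.IH snoc.prems ptop by blast
    \<comment> \<open>Stacks not commuting with \<open>v\<close> have a neutral bead on top, so
      \<open>tl\<close> really removes a 0 there; this makes popping \<open>v\<close> commute with
      pushing \<open>u\<close>.\<close>
    have col: "0 # tl (\<pi> x) = \<pi> x" if "x \<noteq> v" "\<not> adj x v" for x
      using fun_cong[OF w'(3), of x] that by (simp add: push_def pop_def)
    have col': "0 # tl (\<pi> x) = \<pi> x" if "\<not> adj x u" "\<not> adj x v" for x
      using col[of x] that uv by blast
    have eq: "pop v (push (u, d) \<pi>) = push (u, d) (pop v \<pi>)"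
      using uv adjD(3)[OF uv] by (auto simp: push_def pop_def fun_eq_iff col' adj_sym[of u v])
    have topu: "ptop (pop v \<pi>) u = ptop \<pi> u" using uv by (simp add: ptop_def pop_def adj_sym)
    have red: "reduced (w' @ [(u, d)]) (pop v (push (u, d) \<pi>))"
      unfolding eq using w'(1) snoc.hyps topu by (intro reduced.snoc) auto
    have gw: "w \<in> gwords V" "w' \<in> gwords V" using reduced_gwords snoc.hyps w'(1) by blast+
    have "cls (w @ [(u, d)]) = (cls w' \<cdot> lt v e) \<cdot> lt u d"
      using gw snoc.hyps by (simp add: cls_snoc w')
    also have "\<dots> = (cls w' \<cdot> lt u d) \<cdot> lt v e"
      using gw snoc.hyps snoc.prems lt_commute[OF uv, of e d] by (simp add: G.m_assoc cls_closed)
    finally have "cls (w @ [(u, d)]) = cls (w' @ [(u, d)]) \<cdot> lt v e"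
      using gw snoc.hyps by (simp add: cls_snoc)
    moreover have "push (v, e) (pop v (push (u, d) \<pi>)) = push (u, d) \<pi>"
      using uv col False fun_cong[OF w'(3), of v]
      by (auto simp: push_def pop_def fun_eq_iff adj_sym)
    moreover have "ptop (pop v (push (u, d) \<pi>)) v \<noteq> - lsign e"
      unfolding eq using uv w'(4) False by (simp add: top_push)
    ultimately show ?thesis using red by blast
  qed
qed

definition "piling \<pi> \<longleftrightarrow> (\<exists>w. reduced w \<pi>)"

lemma piling_empty: "piling (\<lambda>_. [])" using reduced.Nil by (auto simp: piling_def)

lemma reduced_pile:
  assumes "reduced w \<pi>" "v \<in> V"
  shows "\<exists>w'. reduced w' (pile (v, e) \<pi>) \<and> cls w' = cls w \<cdot> lt v e"
proof (cases "ptop \<pi> v = - lsign e")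
  case True
  then have "ptop \<pi> v = lsign (\<not> e)" by simp
  from reduced_pop[OF assms this] obtain w' where
    w': "reduced w' (pop v \<pi>)" "cls w = cls w' \<cdot> lt v (\<not> e)" by blast
  have "cls w' \<in> Gs" using w'(1) reduced_gwords cls_closed by blast
  then have "cls w \<cdot> lt v e = cls w'"
    using w'(2) assms(2) lt_cancel[of v "\<not> e"] by (simp add: G.m_assoc)
  with w' True show ?thesis by (auto simp: pile_def)
next
  case False
  with reduced.snoc[OF assms False] show ?thesis
    using reduced_gwords[OF assms(1)] assms(2)
    by (intro exI[of _ "w @ [(v, e)]"]) (auto simp: pile_def cls_snoc)
qed

lemma piling_pile: "piling \<pi> \<Longrightarrow> v \<in> V \<Longrightarrow> piling (pile (v, e) \<pi>)"
  using reduced_pile unfolding piling_def by blast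

lemma piling_push_pop:
  assumes "piling \<pi>" "v \<in> V" "ptop \<pi> v = lsign e"
  shows "push (v, e) (pop v \<pi>) = \<pi>" "ptop (pop v \<pi>) v \<noteq> - lsign e"
  using assms reduced_pop unfolding piling_def by blast+

lemma piling_column:
  assumes "piling \<pi>" "v \<in> V" "ptop \<pi> v \<noteq> 0" "x \<noteq> v" "\<not> adj x v"
  shows "0 # tl (\<pi> x) = \<pi> x"
proof -
  obtain e where "ptop \<pi> v = lsign e"
    using assms(1,3) top_reduced lsign_cases unfolding piling_def by metis
  from fun_cong[OF piling_push_pop(1)[OF assms(1,2) this], of x] show ?thesis
    using assms(4,5) by (simp add: push_def pop_def)
qed

lemma pile_cancel:
  assumes "piling \<pi>" "v \<in> V"
  shows "pile (v, \<not> e) (pile (v, e) \<pi>) = \<pi>"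
proof (cases "ptop \<pi> v = - lsign e")
  case True
  then have "ptop \<pi> v = lsign (\<not> e)" by simp
  from piling_push_pop[OF assms this] True show ?thesis by (simp add: pile_def)
next
  case False
  then show ?thesis using pop_push[of "(v, e)" \<pi>] by (simp add: pile_def top_push)
qed

lemma top_pile: "adj u v \<Longrightarrow> ptop (pile (v, e) \<pi>) u = ptop \<pi> u"
  using adjD(3)[of u v] by (simp add: pile_def top_push) (simp add: ptop_def pop_def)

text \<open>With \<open>pile_cancel\<close> this checks the defining relations. Adjacent letters do
  not touch each other's stacks, so each decides independently whether to push or to pop. When one
  pushes and the other pops, a stack commuting with neither gains and loses a bead; both orders
  agree because that stack has a 0 on top.\<close>

lemma pile_commute:
  assumes "piling \<pi>" "adj u v"
  shows "pile (u, d) (pile (v, e) \<pi>) = pile (v, e) (pile (u, d) \<pi>)"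
proof -
  note uv = adjD[OF assms(2)]
  have vu: "adj v u" using assms(2) adj_sym by blast
  have col: "0 # tl (\<pi> x) = \<pi> x"
    if "ptop \<pi> w \<noteq> 0" "w \<in> {u, v}" "x \<noteq> w" "\<not> adj x w" for x w
    using piling_column[OF assms(1) _ that(1,3,4)] that(2) uv by blast
  have tops: "ptop (pile (v, e) \<pi>) u = ptop \<pi> u" "ptop (pile (u, d) \<pi>) v = ptop \<pi> v"
    using top_pile[OF assms(2)] top_pile[OF vu] by auto
  show ?thesis
  proof (cases "ptop \<pi> u = - lsign d"; cases "ptop \<pi> v = - lsign e")
    assume *: "ptop \<pi> u = - lsign d" "ptop \<pi> v = - lsign e"
    then show ?thesis
      using tops by (auto simp: pile_def pop_def fun_eq_iff)
  next
    assume *: "ptop \<pi> u = - lsign d" "ptop \<pi> v \<noteq> - lsign e"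
    then have "ptop \<pi> u \<noteq> 0" by simp
    then have c: "0 # tl (\<pi> x) = \<pi> x" if "\<not> adj x u" "\<not> adj x v" for x
      using col[of _ x] that vu assms(2) by blast
    show ?thesis
      using * tops vu assms(2) uv by (auto simp: pile_def pop_def push_def fun_eq_iff c)
  next
    assume *: "ptop \<pi> u \<noteq> - lsign d" "ptop \<pi> v = - lsign e"
    then have "ptop \<pi> v \<noteq> 0" by simp
    then have c: "0 # tl (\<pi> x) = \<pi> x" if "\<not> adj x u" "\<not> adj x v" for x
      using col[of _ x] that vu assms(2) by blast
    show ?thesis
      using * tops vu assms(2) uv by (auto simp: pile_def pop_def push_def fun_eq_iff c)
  next
    assume *: "ptop \<pi> u \<noteq> - lsign d" "ptop \<pi> v \<noteq> - lsign e"
    then show ?thesis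
      using tops vu assms(2) uv by (auto simp: pile_def push_def fun_eq_iff)
  qed
qed

lemma piling_fold: "piling \<pi> \<Longrightarrow> w \<in> gwords V \<Longrightarrow> piling (fold pile w \<pi>)"
  by (induction w arbitrary: \<pi>) (auto simp: piling_pile)

lemma fold_pile_cong:
  "(u, w) \<in> gcong \<Longrightarrow> piling \<pi> \<Longrightarrow> fold pile u \<pi> = fold pile w \<pi>"
proof (induction arbitrary: \<pi> rule: presentation_cong.induct)
  case (cancel v a b e)
  then show ?case using pile_cancel[OF piling_fold] by simp
next
  case (relation u w a b)
  then obtain x y where xy: "u = [(x, True), (y, True)]" "w = [(y, True), (x, True)]" "adj y x"
    by (auto simp: relators_def adj_def insert_commute)
  show ?case
    using pile_commute[OF piling_fold[OF relation.prems relation.hyps(4)] xy(3)] xy by simp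
qed auto

definition pil :: "'v gword set \<Rightarrow> 'v \<Rightarrow> int list" where
  "pil = lift_word (\<lambda>w. fold pile w (\<lambda>_. []))"

lemma pil_cls: "w \<in> gwords V \<Longrightarrow> pil (cls w) = fold pile w (\<lambda>_. [])"
  unfolding pil_def by (rule lift_word_cls) (auto intro: fold_pile_cong piling_empty)

lemma pil_lt:
  assumes "g \<in> Gs" "v \<in> V" shows "pil (g \<cdot> lt v e) = pile (v, e) (pil g)"
proof -
  obtain w where "w \<in> gwords V" "g = cls w" using assms by (auto simp: carrier_G)
  with assms(2) show ?thesis by (simp add: cls_snoc[symmetric] pil_cls)
qed

lemma piling_pil: "g \<in> Gs \<Longrightarrow> piling (pil g)"
  by (auto simp: carrier_G pil_cls intro!: piling_fold piling_empty)

text \<open>Ties the stacks back to the group: \<open>pil g\<close> is the piling of a reduced word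
  for \<open>g\<close> itself. Hence length 0 forces the identity and balls are finite.\<close>

lemma reduced_representative:
  assumes "g \<in> Gs" shows "\<exists>w. reduced w (pil g) \<and> cls w = g"
proof -
  obtain w where w: "w \<in> gwords V" "g = cls w" using assms by (auto simp: carrier_G)
  have "\<exists>w'. reduced w' (pil (cls w)) \<and> cls w' = cls w" using w(1)
  proof (induction w rule: rev_induct)
    case Nil
    then show ?case using reduced.Nil by (auto simp: pil_cls)
  next
    case (snoc x w)
    obtain v e where x: "x = (v, e)" by (cases x)
    obtain w' where "reduced w' (pil (cls w))" "cls w' = cls w" using snoc x by auto
    then show ?case
      using reduced_pile[of w' "pil (cls w)" v e] snoc.prems x by (auto simp: cls_snoc pil_lt cls_closed)
  qed
  with w show ?thesis by simp
qed

text \<open>Each letter of a reduced word contributes one non-zero bead and otherwise only zeros, so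
  this counts its letters.\<close>

definition plen :: "('v \<Rightarrow> int list) \<Rightarrow> nat" where
  "plen \<pi> = (\<Sum>v\<in>V. length (filter (\<lambda>k. k \<noteq> 0) (\<pi> v)))"

lemma plen_push: assumes "v \<in> V" shows "plen (push (v, e) \<pi>) = Suc (plen \<pi>)"
proof -
  have "plen (push (v, e) \<pi>) =
      (\<Sum>u\<in>V. length (filter (\<lambda>k. k \<noteq> 0) (\<pi> u)) + (if u = v then 1 else 0))"
    unfolding plen_def by (rule sum.cong) (auto simp: push_def)
  also have "\<dots> = Suc (plen \<pi>)"
    using assms finite_V by (simp add: sum.distrib plen_def)
  finally show ?thesis .
qed

lemma plen_reduced: "reduced w \<pi> \<Longrightarrow> plen \<pi> = length w"
proof (induction rule: reduced.induct)
  case Nil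
  then show ?case by (simp add: plen_def)
qed (simp add: plen_push)

definition len :: "'v gword set \<Rightarrow> nat" where "len g = plen (pil g)"

text \<open>The sign of the letter at \<open>v\<close> with which a reduced word for
  \<open>g\<close> can end, by \<open>reduced_pop\<close>, or 0 if there is none.\<close>

definition lastl :: "'v gword set \<Rightarrow> 'v \<Rightarrow> int" where "lastl g = ptop (pil g)"

lemma lastl_values: "g \<in> Gs \<Longrightarrow> lastl g v \<in> {-1, 0, 1}"
  using piling_pil top_reduced by (auto simp: lastl_def piling_def)

lemma len_lt:
  assumes g: "g \<in> Gs" and v: "v \<in> V"
  shows "lastl g v = - lsign e \<Longrightarrow> Suc (len (g \<cdot> lt v e)) = len g"
    and "lastl g v \<noteq> - lsign e \<Longrightarrow> len (g \<cdot> lt v e) = Suc (len g)"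
proof -
  assume *: "lastl g v = - lsign e"
  then have "ptop (pil g) v = lsign (\<not> e)" by (simp add: lastl_def)
  from piling_push_pop(1)[OF piling_pil[OF g] v this]
  have "plen (pil g) = Suc (plen (pop v (pil g)))" using plen_push[OF v] by metis
  then show "Suc (len (g \<cdot> lt v e)) = len g"
    using * by (simp add: len_def pil_lt[OF g v] pile_def lastl_def)
next
  assume "lastl g v \<noteq> - lsign e"
  then show "len (g \<cdot> lt v e) = Suc (len g)"
    by (simp add: len_def pil_lt[OF g v] pile_def lastl_def plen_push[OF v])
qed

lemma len_lt_le: "g \<in> Gs \<Longrightarrow> v \<in> V \<Longrightarrow> len (g \<cdot> lt v e) \<le> Suc (len g)"
  using len_lt[of g v e] by (cases "lastl g v = - lsign e") auto

text \<open>The combinatorial core: possible last letters span a clique. A signed bead on top of the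
  stack of \<open>v\<close> means that the stacks not commuting with \<open>v\<close> show its
  neutral bead.\<close>

lemma lastl_adj:
  assumes "g \<in> Gs" "u \<in> V" "v \<in> V" "lastl g u \<noteq> 0" "lastl g v \<noteq> 0" "u \<noteq> v"
  shows "adj u v"
proof (rule ccontr)
  assume "\<not> adj u v"
  with piling_column[OF piling_pil[OF assms(1)] assms(3), of u] assms
  have "0 # tl (pil g u) = pil g u" by (simp add: lastl_def)
  then obtain xs where "pil g u = 0 # xs" by (rule that[OF HOL.sym])
  then have "ptop (pil g) u = 0" by (simp add: ptop_def)
  with assms(4) show False by (simp add: lastl_def)
qed

lemma lastl_lt: "g \<in> Gs \<Longrightarrow> adj u v \<Longrightarrow> lastl (g \<cdot> lt v e) u = lastl g u"
  using adjD[of u v] by (simp add: lastl_def pil_lt top_pile)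

lemma len_one [simp]: "len \<e> = 0"
  by (simp add: one_eq_cls len_def pil_cls plen_def)

lemma len_zero: assumes "g \<in> Gs" "len g = 0" shows "g = \<e>"
proof -
  obtain w where w: "reduced w (pil g)" "cls w = g" using reduced_representative[OF assms(1)] by blast
  have "w = []" using plen_reduced[OF w(1)] assms(2) by (simp add: len_def)
  with w show ?thesis by (simp add: one_eq_cls)
qed

lemma len_pos_lastl: assumes "g \<in> Gs" "len g \<noteq> 0" shows "\<exists>v\<in>V. lastl g v \<noteq> 0"
proof -
  obtain w where w: "reduced w (pil g)" "cls w = g" using reduced_representative[OF assms(1)] by blast
  from w(1) show ?thesis
  proof cases
    case Nil
    then show ?thesis using assms(2) by (simp add: len_def plen_def)
  next
    case (snoc w \<pi> v e)
    then show ?thesis by (intro bexI[of _ v]) (auto simp: lastl_def top_push)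
  qed
qed

lemma finite_len: "finite {g \<in> Gs. len g \<le> n}"
proof (rule finite_subset)
  show "{g \<in> Gs. len g \<le> n} \<subseteq> cls ` {w. set w \<subseteq> V \<times> UNIV \<and> length w \<le> n}"
  proof
    fix g assume g: "g \<in> {g \<in> Gs. len g \<le> n}"
    then obtain w where w: "reduced w (pil g)" "cls w = g" using reduced_representative by blast
    have "w \<in> gwords V" "length w \<le> n"
      using reduced_gwords[OF w(1)] plen_reduced[OF w(1)] g by (simp_all add: len_def)
    then show "g \<in> cls ` {w. set w \<subseteq> V \<times> UNIV \<and> length w \<le> n}"
      using w(2) by (intro image_eqI[of _ _ w]) (auto simp: gwords_def)
  qed
  show "finite (cls ` {w. set w \<subseteq> V \<times> (UNIV :: bool set) \<and> length w \<le> n})"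
    by (intro finite_imageI finite_lists_length_le) (simp add: finite_V)
qed

section \<open>Powers of generators and their products over cliques\<close>

lemma int_pow_add_one:
  assumes "x \<in> Gs"
  shows "x [^]\<^bsub>G\<^esub> (k + 1 :: int) = x [^]\<^bsub>G\<^esub> k \<cdot> x"
    and "x [^]\<^bsub>G\<^esub> (k - 1 :: int) = x [^]\<^bsub>G\<^esub> k \<cdot> inv\<^bsub>G\<^esub> x"
  using G.int_pow_mult[OF assms, of k 1] G.int_pow_mult[OF assms, of k "- 1"] assms
  by (simp_all add: G.int_pow_neg)

lemma commute_int_pow:
  assumes x: "x \<in> Gs" and y: "y \<in> Gs" and xy: "x \<cdot> y = y \<cdot> x"
  shows "x [^]\<^bsub>G\<^esub> (k::int) \<cdot> y = y \<cdot> x [^]\<^bsub>G\<^esub> k"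
proof (induction k rule: int_induct[of _ 0])
  case base
  then show ?case using y by simp
next
  case (step1 i)
  then show ?case using x y xy
    by (simp add: int_pow_add_one[OF x] G.m_assoc) (simp flip: G.m_assoc)
next
  case (step2 i)
  have "inv\<^bsub>G\<^esub> x \<cdot> y = y \<cdot> inv\<^bsub>G\<^esub> x" using commute_inv[OF y x] xy by simp
  with step2 show ?case using x y
    by (simp add: int_pow_add_one[OF x] G.m_assoc) (simp flip: G.m_assoc)
qed

definition pw :: "'v \<Rightarrow> int \<Rightarrow> 'v gword set" where "pw v k = lt v True [^]\<^bsub>G\<^esub> k"

lemma pw_closed [simp]: "v \<in> V \<Longrightarrow> pw v k \<in> Gs" by (simp add: pw_def)

lemma pw_zero [simp]: "pw v 0 = \<e>" by (simp add: pw_def)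

lemma pw_sign: "v \<in> V \<Longrightarrow> pw v (lsign e) = lt v e"
  using G.int_pow_neg[of "lt v True" 1] by (cases e) (auto simp: pw_def inv_lt)

lemma pw_add: "v \<in> V \<Longrightarrow> pw v (j + k) = pw v j \<cdot> pw v k"
  by (simp add: pw_def G.int_pow_mult)

lemma ab_pw: assumes "v \<in> V" shows "ab (pw v k) u = (if u = v then k else 0)"
proof (induction k rule: int_induct[of _ 0])
  case base
  then show ?case by simp
next
  case (step1 i)
  then show ?case using pw_add[OF assms, of i 1] pw_sign[OF assms, of True] assms
    by (simp add: ab_mult ab_lt)
next
  case (step2 i)
  then show ?case using pw_add[OF assms, of i "- 1"] pw_sign[OF assms, of False] assms
    by (simp add: ab_mult ab_lt)
qed

lemma pw_commute: assumes "adj u v \<or> u = v" "u \<in> V" "v \<in> V"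
  shows "pw u j \<cdot> pw v k = pw v k \<cdot> pw u j"
proof -
  have "lt u True \<cdot> lt v True = lt v True \<cdot> lt u True" using assms(1) lt_commute[of u v True True]
    by (elim disjE) simp_all
  from commute_int_pow[OF _ _ this, of j] assms
  have "lt v True \<cdot> pw u j = pw u j \<cdot> lt v True" by (simp add: pw_def)
  from commute_int_pow[OF _ _ this, of k] assms show ?thesis by (simp add: pw_def)
qed

primrec eltl :: "'v list \<Rightarrow> ('v \<Rightarrow> int) \<Rightarrow> 'v gword set" where
  "eltl [] n = \<e>"
| "eltl (v # vs) n = pw v (n v) \<cdot> eltl vs n"

lemma eltl_closed: "set vs \<subseteq> V \<Longrightarrow> eltl vs n \<in> Gs"
  by (induction vs) auto

text \<open>Polymorphic because it serves integer exponents as well as real coordinates.\<close>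

definition clique_supp :: "('v \<Rightarrow> 'b::zero) \<Rightarrow> bool" where
  "clique_supp n \<longleftrightarrow> {v. n v \<noteq> 0} \<in> cliques V E"

lemma eltl_commute:
  assumes "set vs \<subseteq> V" "x \<in> Gs"
    and "\<And>v. v \<in> set vs \<Longrightarrow> x \<cdot> pw v (n v) = pw v (n v) \<cdot> x"
  shows "x \<cdot> eltl vs n = eltl vs n \<cdot> x"
  using assms
proof (induction vs)
  case (Cons v vs)
  have c: "pw v (n v) \<in> Gs" "eltl vs n \<in> Gs" using Cons.prems eltl_closed by auto
  have "x \<cdot> eltl (v # vs) n = (x \<cdot> pw v (n v)) \<cdot> eltl vs n"
    using c Cons.prems(2) by (simp add: G.m_assoc)
  also have "\<dots> = pw v (n v) \<cdot> (x \<cdot> eltl vs n)"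
    using c Cons.prems by (simp add: G.m_assoc)
  also have "x \<cdot> eltl vs n = eltl vs n \<cdot> x" using Cons by auto
  finally show ?case using c Cons.prems(2) by (simp add: G.m_assoc)
qed simp

lemma eltl_add:
  assumes "set vs \<subseteq> V" and Q: "Q \<in> cliques V E" "\<And>v. v \<notin> Q \<Longrightarrow> m v = 0 \<and> n v = 0"
  shows "eltl vs (\<lambda>v. m v + n v) = eltl vs m \<cdot> eltl vs n"
  using assms(1)
proof (induction vs)
  case (Cons v vs)
  have c: "pw v (n v) \<in> Gs" "pw v (m v) \<in> Gs" "eltl vs m \<in> Gs"
    "eltl vs n \<in> Gs"
    using Cons.prems eltl_closed by auto
  have comm: "pw v (n v) \<cdot> eltl vs m = eltl vs m \<cdot> pw v (n v)"
  proof (rule eltl_commute)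
    show "pw v (n v) \<cdot> pw u (m u) = pw u (m u) \<cdot> pw v (n v)" if u: "u \<in> set vs" for u
    proof (cases "u \<in> Q \<and> v \<in> Q")
      case True
      then have "adj v u \<or> v = u" using Q(1) by (auto simp: cliques_iff)
      then show ?thesis using u Cons.prems by (intro pw_commute) auto
    next
      case False
      then have "m u = 0 \<or> n v = 0" using Q(2) by blast
      then show ?thesis using u Cons.prems by auto
    qed
  qed (use Cons.prems in auto)
  have "eltl (v # vs) (\<lambda>v. m v + n v) = (pw v (m v) \<cdot> pw v (n v)) \<cdot> (eltl vs m \<cdot> eltl vs n)"
    using Cons by (simp add: pw_add)
  also have "\<dots> = pw v (m v) \<cdot> ((pw v (n v) \<cdot> eltl vs m) \<cdot> eltl vs n)"
    using c by (simp add: G.m_assoc)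
  also have "\<dots> = eltl (v # vs) m \<cdot> eltl (v # vs) n"
    unfolding comm using c by (simp add: G.m_assoc)
  finally show ?case .
qed simp

lemma ab_eltl:
  "distinct vs \<Longrightarrow> set vs \<subseteq> V \<Longrightarrow> ab (eltl vs n) u = (if u \<in> set vs then n u else 0)"
  by (induction vs) (auto simp: ab_mult ab_pw eltl_closed)

lemma eltl_zero: "(\<And>v. v \<in> set vs \<Longrightarrow> n v = 0) \<Longrightarrow> eltl vs n = \<e>"
  by (induction vs) auto

lemma eltl_single:
  assumes "distinct vs" "set vs \<subseteq> V" "v \<in> set vs"
  shows "eltl vs (\<lambda>u. if u = v then k else 0) = pw v k"
  using assms
proof (induction vs)
  case (Cons u vs)
  show ?case
  proof (cases "u = v")
    case True
    then have "eltl vs (\<lambda>u. if u = v then k else 0) = \<e>"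
      using Cons.prems by (intro eltl_zero) auto
    then show ?thesis using True Cons.prems by simp
  next
    case False
    moreover have "v \<in> V" using Cons.prems by auto
    ultimately show ?thesis using Cons by simp
  qed
qed simp

lemma len_eltl_le:
  "set vs \<subseteq> V \<Longrightarrow> g \<in> Gs \<Longrightarrow> (\<And>v. v \<in> set vs \<Longrightarrow> n v \<in> {-1, 0, 1}) \<Longrightarrow>
    len (g \<cdot> eltl vs n) \<le> len g + length vs"
proof (induction vs arbitrary: g)
  case (Cons v vs)
  have "len (g \<cdot> pw v (n v)) \<le> Suc (len g)"
  proof (cases "n v = 0")
    case True
    then show ?thesis using Cons.prems by simp
  next
    case False
    then obtain e where "n v = lsign e" using Cons.prems(3)[of v] lsign_cases by auto
    then show ?thesis using Cons.prems pw_sign len_lt_le by simp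
  qed
  moreover have "len ((g \<cdot> pw v (n v)) \<cdot> eltl vs n) \<le> len (g \<cdot> pw v (n v)) + length vs"
    using Cons.prems by (intro Cons.IH) auto
  ultimately show ?case using Cons.prems by (simp add: G.m_assoc eltl_closed)
qed simp

text \<open>Cancelling some of the letters that \<open>g\<close> can end with does not interfere with the others.\<close>

lemma len_eltl_cancel:
  assumes "distinct vs" "set vs \<subseteq> V" "g \<in> Gs"
    "\<And>v. v \<in> set vs \<Longrightarrow> n v \<noteq> 0 \<Longrightarrow> n v = - lastl g v"
  shows "len (g \<cdot> eltl vs n) \<le> len g \<and>
    ((\<exists>v\<in>set vs. n v \<noteq> 0) \<longrightarrow> len (g \<cdot> eltl vs n) < len g)"
  using assms
proof (induction vs arbitrary: g)
  case (Cons v vs)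
  have v: "v \<in> V" using Cons.prems by simp
  have assoc: "g \<cdot> eltl (v # vs) n = (g \<cdot> pw v (n v)) \<cdot> eltl vs n"
    using Cons.prems by (simp add: G.m_assoc eltl_closed)
  show ?case
  proof (cases "n v = 0")
    case True
    then show ?thesis using Cons by (simp add: eltl_closed)
  next
    case False
    then have nv: "n v = - lastl g v" using Cons.prems by simp
    then have "lastl g v \<noteq> 0" "n v \<in> {-1, 0, 1}"
      using False lastl_values[OF Cons.prems(3), of v] by auto
    then obtain e where e: "n v = lsign e" using False lsign_cases by metis
    let ?g = "g \<cdot> lt v e"
    have g': "?g \<in> Gs" using Cons.prems by simp
    have l: "lastl g v = - lsign e" using nv e by simp
    \<comment> \<open>The remaining letters are adjacent to \<open>v\<close> by
      \<open>lastl_adj\<close>, and piling an adjacent letter leaves the top of their stacks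
      unchanged.\<close>
    have "n u = - lastl ?g u" if u: "u \<in> set vs" "n u \<noteq> 0" for u
    proof -
      have nu: "n u = - lastl g u" using Cons.prems u by simp
      have "u \<noteq> v" "u \<in> V" using u Cons.prems by auto
      moreover from this have "adj u v"
        using lastl_adj[OF Cons.prems(3), of u v] nu u(2) v \<open>lastl g v \<noteq> 0\<close> by simp
      ultimately show ?thesis using nu lastl_lt[OF Cons.prems(3)] by simp
    qed
    then have "len (?g \<cdot> eltl vs n) \<le> len ?g"
      using Cons.IH[OF _ _ g'] Cons.prems by simp
    moreover have "Suc (len ?g) = len g" by (rule len_lt(1)[OF Cons.prems(3) v l])
    ultimately show ?thesis unfolding assoc e pw_sign[OF v] by simp
  qed
qed simp

definition vlist :: "'v list" where "vlist = (SOME vs. set vs = V \<and> distinct vs)"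

lemma vlist: "set vlist = V" "distinct vlist"
  using someI_ex[OF finite_distinct_list[OF finite_V]] unfolding vlist_def by auto

text \<open>The order of \<open>vlist\<close> is arbitrary. It makes the product defined for all
  exponents; exponents supported in a common clique give the additive behaviour of a lattice
  (\<open>elt_add\<close>).\<close>

definition elt :: "('v \<Rightarrow> int) \<Rightarrow> 'v gword set" where "elt n = eltl vlist n"

lemma elt_closed [simp]: "elt n \<in> Gs" by (simp add: elt_def eltl_closed vlist)

lemma elt_add:
  assumes "Q \<in> cliques V E" "\<And>v. v \<notin> Q \<Longrightarrow> m v = 0 \<and> n v = 0"
  shows "elt (\<lambda>v. m v + n v) = elt m \<cdot> elt n"
  unfolding elt_def by (rule eltl_add[OF _ assms]) (simp_all add: vlist)

lemma ab_elt: "ab (elt n) v = (if v \<in> V then n v else 0)"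
  by (simp add: elt_def ab_eltl vlist)

lemma elt_zero [simp]: "elt (\<lambda>_. 0) = \<e>" by (simp add: elt_def eltl_zero)

lemma elt_single: "v \<in> V \<Longrightarrow> elt (\<lambda>u. if u = v then k else 0) = pw v k"
  by (simp add: elt_def eltl_single vlist)

lemma len_elt_le:
  assumes "g \<in> Gs" "\<And>v. n v \<in> {-1, 0, 1}"
  shows "len (g \<cdot> elt n) \<le> len g + card V"
proof -
  have "length vlist = card V" using distinct_card[OF vlist(2)] vlist(1) by simp
  then show ?thesis
    unfolding elt_def using len_eltl_le[OF _ assms(1), of vlist n] assms(2) vlist by simp
qed

lemma len_elt_cancel:
  assumes "g \<in> Gs" "\<And>v. v \<in> V \<Longrightarrow> n v \<noteq> 0 \<Longrightarrow> n v = - lastl g v"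
  shows "len (g \<cdot> elt n) \<le> len g" "v \<in> V \<Longrightarrow> n v \<noteq> 0 \<Longrightarrow> len (g \<cdot> elt n) < len g"
  unfolding elt_def using len_eltl_cancel[OF vlist(2) _ assms(1)] assms(2) vlist by auto

section \<open>The universal covering\<close>

text \<open>Points of the covering space are probability measures on the group: the point \<open>\<sigma> g y\<close> of the
  flat spanned at the vertex \<open>g\<close> by a clique is recorded by its multilinear barycentric
  coordinates with respect to the vertices of the cube that contains it.\<close>

definition hat :: "real \<Rightarrow> real" where "hat t = max 0 (1 - \<bar>t\<bar>)"

lemma hat_pos_iff: "hat t > 0 \<longleftrightarrow> \<bar>t\<bar> < 1" by (auto simp: hat_def)

lemma hat_nonneg [simp]: "hat t \<ge> 0" by (simp add: hat_def)

text \<open>The vertex with integer coordinates \<open>n\<close> in a flat at \<open>g\<close> is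
  \<open>g \<cdot> elt n\<close>, and \<open>n\<close> is recovered as a difference of exponent
  sums. The clique stays implicit: where \<open>y v = 0\<close>, the factor \<open>hat\<close>
  vanishes at every vertex with a non-zero exponent at \<open>v\<close>.\<close>

definition \<sigma> :: "'v gword set \<Rightarrow> ('v \<Rightarrow> real) \<Rightarrow> 'v gword set \<Rightarrow> real" where
  "\<sigma> g y h = (if h \<in> Gs \<and> h = g \<cdot> elt (\<lambda>v. ab h v - ab g v)
    then \<Prod>v\<in>V. hat (y v - of_int (ab h v - ab g v)) else 0)"

lemma \<sigma>_pos_iff: "\<sigma> g y h > 0 \<longleftrightarrow> h \<in> Gs \<and> h = g \<cdot> elt (\<lambda>v. ab h v - ab g v) \<and>
    (\<forall>v\<in>V. \<bar>y v - of_int (ab h v - ab g v)\<bar> < 1)"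
proof -
  have "(\<Prod>v\<in>V. hat (y v - of_int (ab h v - ab g v))) > 0 \<longleftrightarrow>
      (\<forall>v\<in>V. hat (y v - of_int (ab h v - ab g v)) > 0)"
  proof
    assume *: "(\<Prod>v\<in>V. hat (y v - of_int (ab h v - ab g v))) > 0"
    show "\<forall>v\<in>V. hat (y v - of_int (ab h v - ab g v)) > 0"
    proof
      fix v assume "v \<in> V"
      then have "hat (y v - of_int (ab h v - ab g v)) \<noteq> 0"
        using * prod_zero[OF finite_V] by (metis less_irrefl)
      then show "hat (y v - of_int (ab h v - ab g v)) > 0" using hat_nonneg less_le by metis
    qed
  qed (simp add: prod_pos)
  then show ?thesis by (auto simp: \<sigma>_def hat_pos_iff)
qed

lemma \<sigma>_nonneg: "\<sigma> g y h \<ge> 0" by (simp add: \<sigma>_def prod_nonneg)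

lemma continuous_on_\<sigma>: "continuous_on S (\<sigma> g)"
proof (rule continuous_on_coordinatewise_then_product)
  show "continuous_on S (\<lambda>y. \<sigma> g y h)" for h
  proof (cases "h \<in> Gs \<and> h = g \<cdot> elt (\<lambda>v. ab h v - ab g v)")
    case True
    show ?thesis
      unfolding \<sigma>_def if_P[OF True] hat_def
      by (intro continuous_intros continuous_on_product_coordinates[THEN continuous_on_subset]) simp
  next
    case False
    show ?thesis unfolding \<sigma>_def if_not_P[OF False] by (rule continuous_on_const)
  qed
qed

end

text \<open>The translates of the image of one section over \<open>T\<close> fill the preimage of
  \<open>T\<close>, and freeness makes them disjoint. So one open section image near each point
  supplies all sheets.\<close>

lemma covering_map_from_sections:
  assumes p: "continuous_map C X p" "p ` topspace C = topspace X" and G: "group G"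
    and act: "\<And>a. a \<in> carrier G \<Longrightarrow> continuous_map C C (act a)"
    and act_one: "\<And>c. c \<in> topspace C \<Longrightarrow> act \<one>\<^bsub>G\<^esub> c = c"
    and act_mult: "\<And>a b c. a \<in> carrier G \<Longrightarrow> b \<in> carrier G \<Longrightarrow> c \<in> topspace C \<Longrightarrow>
      act (a \<otimes>\<^bsub>G\<^esub> b) c = act a (act b c)"
    and deck: "\<And>a c. a \<in> carrier G \<Longrightarrow> c \<in> topspace C \<Longrightarrow> p (act a c) = p c"
    and free: "\<And>a b c. a \<in> carrier G \<Longrightarrow> b \<in> carrier G \<Longrightarrow> c \<in> topspace C \<Longrightarrow>
      act a c = act b c \<Longrightarrow> a = b"
    and sect: "\<And>x. x \<in> topspace X \<Longrightarrow> \<exists>T s. openin X T \<and> x \<in> T \<and>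
      continuous_map (subtopology X T) C s \<and> (\<forall>x\<in>T. p (s x) = x) \<and> openin C (s ` T) \<and>
      (\<forall>c\<in>topspace C. p c \<in> T \<longrightarrow> (\<exists>a\<in>carrier G. c = act a (s (p c))))"
  shows "covering_map C p X"
  unfolding covering_map_def
proof (intro conjI ballI p)
  interpret G: group G by (rule G)
  fix x assume "x \<in> topspace X"
  from sect[OF this] obtain T s where T: "openin X T" "x \<in> T" "continuous_map (subtopology X T) C s"
    "\<forall>x\<in>T. p (s x) = x" "openin C (s ` T)"
    "\<forall>c\<in>topspace C. p c \<in> T \<longrightarrow> (\<exists>a\<in>carrier G. c = act a (s (p c)))"
    by (elim exE conjE) (rule that)
  have actC: "act a c \<in> topspace C" if "a \<in> carrier G" "c \<in> topspace C" for a c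
    using act[OF that(1)] that(2) by (auto simp: continuous_map_def)
  have sC: "s y \<in> topspace C" if "y \<in> T" for y using openin_subset[OF T(5)] that by blast
  have TX: "T \<subseteq> topspace X" using T(1) openin_subset by blast
  have inv: "act (inv\<^bsub>G\<^esub> a) (act a c) = c" "act a (act (inv\<^bsub>G\<^esub> a) c) = c"
    if "a \<in> carrier G" "c \<in> topspace C" for a c
    using that act_mult[of "inv\<^bsub>G\<^esub> a" a c] act_mult[of a "inv\<^bsub>G\<^esub> a" c] act_one by auto
  define U where "U a = act a ` s ` T" for a
  have op: "openin C (U a)" if a: "a \<in> carrier G" for a
  proof -
    have "U a = {c \<in> topspace C. act (inv\<^bsub>G\<^esub> a) c \<in> s ` T}"
    proof (intro equalityI subsetI)
      fix c assume "c \<in> {c \<in> topspace C. act (inv\<^bsub>G\<^esub> a) c \<in> s ` T}"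
      then show "c \<in> U a"
        unfolding U_def using inv(2)[OF a] by (metis (mono_tags, lifting) image_eqI mem_Collect_eq)
    qed (use a sC actC inv(1) in \<open>auto simp: U_def\<close>)
    then show ?thesis
      using openin_continuous_map_preimage[OF act[of "inv\<^bsub>G\<^esub> a"] T(5)] a by simp
  qed
  have hom: "homeomorphic_map (subtopology C (U a)) (subtopology X T) p" if a: "a \<in> carrier G" for a
  proof -
    have tU: "topspace (subtopology C (U a)) = U a" "topspace (subtopology X T) = T"
      using openin_subset[OF op[OF a]] TX by auto
    have UT: "p ` U a \<subseteq> T" using deck[OF a] sC T(4) by (auto simp: U_def)
    have "homeomorphic_maps (subtopology C (U a)) (subtopology X T) p (act a \<circ> s)"
      unfolding homeomorphic_maps_def tU
    proof (intro conjI ballI)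
      show "continuous_map (subtopology C (U a)) (subtopology X T) p"
        using UT p(1) tU by (auto simp: continuous_map_in_subtopology intro: continuous_map_from_subtopology)
      have "continuous_map (subtopology X T) C (act a \<circ> s)"
        by (rule continuous_map_compose[OF T(3) act[OF a]])
      then show "continuous_map (subtopology X T) (subtopology C (U a)) (act a \<circ> s)"
        using tU by (auto simp: continuous_map_in_subtopology U_def)
      show "(act a \<circ> s) (p c) = c" if "c \<in> U a" for c
        using that deck[OF a] sC T(4) by (auto simp: U_def)
      show "p ((act a \<circ> s) y) = y" if "y \<in> T" for y
        using that deck[OF a] sC T(4) by auto
    qed
    then show ?thesis using homeomorphic_map_maps by blast
  qed
  have disj: "U a \<inter> U b = {}" if ab: "a \<in> carrier G" "b \<in> carrier G" "a \<noteq> b" for a b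
  proof (rule ccontr)
    assume "U a \<inter> U b \<noteq> {}"
    then obtain y z where yz: "y \<in> T" "z \<in> T" "act a (s y) = act b (s z)" by (auto simp: U_def)
    then have "p (s y) = p (s z)" using deck ab sC by metis
    then have "y = z" using yz T(4) by simp
    then show False using free[OF ab(1,2) sC[OF yz(1)]] yz(3) ab(3) by blast
  qed
  show "\<exists>T. x \<in> T \<and> openin X T \<and> (\<exists>\<U>. \<Union>\<U> = {c \<in> topspace C. p c \<in> T} \<and>
      (\<forall>U\<in>\<U>. openin C U) \<and> pairwise disjnt \<U> \<and>
      (\<forall>U\<in>\<U>. homeomorphic_map (subtopology C U) (subtopology X T) p))"
  proof (intro exI[of _ T] exI[of _ "U ` carrier G"] conjI T)
    show "\<Union>(U ` carrier G) = {c \<in> topspace C. p c \<in> T}"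
    proof (intro equalityI subsetI)
      fix c assume c: "c \<in> {c \<in> topspace C. p c \<in> T}"
      then obtain a where "a \<in> carrier G" "c = act a (s (p c))" using T(6) by blast
      with c show "c \<in> \<Union>(U ` carrier G)" unfolding U_def by blast
    qed (use deck sC T(4) actC in \<open>auto simp: U_def\<close>)
    show "pairwise disjnt (U ` carrier G)"
      using disj by (auto simp: pairwise_def disjnt_def)
  qed (use op hom in auto)
qed

lemma covering_map_homeomorphic_target:
  assumes cov: "covering_map C p X" and k: "homeomorphic_map X Y k"
  shows "covering_map C (k \<circ> p) Y"
  unfolding covering_map_def
proof (intro conjI ballI)
  have kc: "continuous_map X Y k" and ki: "k ` topspace X = topspace Y"
    and kinj: "inj_on k (topspace X)" and ko: "open_map X Y k"
    using k by (auto simp: homeomorphic_eq_everything_map)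
  show "continuous_map C Y (k \<circ> p)"
    by (rule continuous_map_compose[OF covering_map_continuous[OF cov] kc])
  show "(k \<circ> p) ` topspace C = topspace Y"
    using covering_map_image[OF cov] ki by (metis image_comp)
  fix y assume "y \<in> topspace Y"
  then obtain x where x: "x \<in> topspace X" "y = k x" using ki by blast
  obtain T \<U> where T: "x \<in> T" "openin X T" "\<Union>\<U> = {c \<in> topspace C. p c \<in> T}"
      and op: "\<forall>U\<in>\<U>. openin C U" and dis: "pairwise disjnt \<U>"
      and hom: "\<forall>U\<in>\<U>. homeomorphic_map (subtopology C U) (subtopology X T) p"
    using covering_map_evenly[OF cov x(1)] by (elim exE conjE) (rule that)
  have TX: "T \<subseteq> topspace X" using T(2) openin_subset by blast
  have kT: "homeomorphic_map (subtopology X T) (subtopology Y (k ` T)) k"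
    by (rule homeomorphic_map_subtopologies[OF k]) (use TX ki in blast)
  show "\<exists>T. y \<in> T \<and> openin Y T \<and> (\<exists>\<U>. \<Union>\<U> = {c \<in> topspace C. (k \<circ> p) c \<in> T} \<and>
      (\<forall>U\<in>\<U>. openin C U) \<and> pairwise disjnt \<U> \<and>
      (\<forall>U\<in>\<U>. homeomorphic_map (subtopology C U) (subtopology Y T) (k \<circ> p)))"
  proof (intro exI[of _ "k ` T"] exI[of _ \<U>] conjI op dis ballI)
    show "y \<in> k ` T" using x T(1) by blast
    show "openin Y (k ` T)" using ko T(2) by (simp add: open_map_def)
    have "p c \<in> T \<longleftrightarrow> k (p c) \<in> k ` T" if "c \<in> topspace C" for c
      using inj_on_image_mem_iff[OF kinj, of "p c" T] TX covering_map_image[OF cov] that by blast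
    then show "\<Union>\<U> = {c \<in> topspace C. (k \<circ> p) c \<in> k ` T}" using T(3) by auto
    show "homeomorphic_map (subtopology C U) (subtopology Y (k ` T)) (k \<circ> p)" if "U \<in> \<U>" for U
      using homeomorphic_map_compose[OF _ kT] hom that by blast
  qed
qed

context simplicial_graph
begin

section \<open>Change of base vertex, translations and local coordinates\<close>

lemma ab_outside: assumes "g \<in> Gs" "v \<notin> V" shows "ab g v = 0"
proof -
  have "abw w v = 0" if "w \<in> gwords V" for w
    using that assms(2) by (induction w) (auto simp: abw_def)
  then show ?thesis using assms(1) by (auto simp: carrier_G ab_cls)
qed

lemma clique_supp_outside: "clique_supp y \<Longrightarrow> v \<notin> V \<Longrightarrow> y v = 0"
  by (auto simp: clique_supp_def cliques_iff)

lemma clique_supp_subset: "clique_supp y \<Longrightarrow> (\<And>v. y v = 0 \<Longrightarrow> z v = 0) \<Longrightarrow> clique_supp z"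
  unfolding clique_supp_def by (erule cliques_subset) auto

lemma clique_supp_zero: "clique_supp (\<lambda>_. 0)" by (simp add: clique_supp_def cliques_def)

text \<open>Changes the base vertex of a flat by an integer vector. The hypothesis on
  \<open>m\<close> keeps all exponents in the clique spanned by \<open>y\<close>, where
  \<open>elt\<close> is additive; a vertex with an exponent outside that clique has weight 0 on both
  sides.\<close>

lemma \<sigma>_shift:
  assumes g: "g \<in> Gs" and y: "clique_supp y" and m: "\<And>v. y v = 0 \<Longrightarrow> m v = 0"
  shows "\<sigma> g y = \<sigma> (g \<cdot> elt m) (\<lambda>v. y v - of_int (m v))"
proof
  fix h
  let ?g = "g \<cdot> elt m" and ?n = "\<lambda>v. ab h v - ab g v"
  have abg: "ab ?g v = ab g v + m v" for v
    using g m clique_supp_outside[OF y, of v] by (auto simp: ab_mult ab_elt)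
  have P: "(\<Prod>v\<in>V. hat (y v - of_int (m v) - of_int (ab h v - ab ?g v))) = (\<Prod>v\<in>V. hat (y v - of_int (?n v)))"
    by (rule prod.cong) (simp_all add: abg algebra_simps)
  show "\<sigma> g y h = \<sigma> ?g (\<lambda>v. y v - of_int (m v)) h"
  proof (cases "h \<in> Gs \<and> (\<forall>v. y v = 0 \<longrightarrow> ?n v = 0)")
    case True
    have "elt (\<lambda>v. m v + (ab h v - ab ?g v)) = elt m \<cdot> elt (\<lambda>v. ab h v - ab ?g v)"
      by (rule elt_add[OF y[unfolded clique_supp_def]]) (use m True abg in auto)
    then have "elt ?n = elt m \<cdot> elt (\<lambda>v. ab h v - ab ?g v)" by (simp add: abg)
    then have "g \<cdot> elt ?n = ?g \<cdot> elt (\<lambda>v. ab h v - ab ?g v)" using g by (simp add: G.m_assoc)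
    then show ?thesis unfolding \<sigma>_def P by simp
  next
    case False
    show ?thesis
    proof (cases "h \<in> Gs")
      case True
      with False obtain v where v: "y v = 0" "?n v \<noteq> 0" by blast
      then have "v \<in> V" using ab_outside[OF g] ab_outside[OF True] by fastforce
      moreover have "hat (y v - of_int (?n v)) = 0"
      proof -
        have "\<bar>?n v\<bar> \<ge> 1" using v(2) by linarith
        then have "\<bar>real_of_int (?n v)\<bar> \<ge> 1" by linarith
        then show ?thesis using v(1) by (simp add: hat_def)
      qed
      ultimately have "(\<Prod>v\<in>V. hat (y v - of_int (?n v))) = 0" using finite_V by (simp add: prod_zero_iff) blast
      then show ?thesis unfolding \<sigma>_def P by simp
    qed (simp add: \<sigma>_def)
  qed
qed

definition act :: "'v gword set \<Rightarrow> ('v gword set \<Rightarrow> real) \<Rightarrow> 'v gword set \<Rightarrow> real" where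
  "act a b h = (if h \<in> Gs then b (inv\<^bsub>G\<^esub> a \<cdot> h) else 0)"

lemma act_\<sigma>:
  assumes a: "a \<in> Gs" and g: "g \<in> Gs"
  shows "act a (\<sigma> g y) = \<sigma> (a \<cdot> g) y"
proof
  fix h
  show "act a (\<sigma> g y) h = \<sigma> (a \<cdot> g) y h"
  proof (cases "h \<in> Gs")
    case True
    have n: "ab (inv\<^bsub>G\<^esub> a \<cdot> h) v - ab g v = ab h v - ab (a \<cdot> g) v" for v
      using a g True by (simp add: ab_mult ab_inv)
    let ?e = "elt (\<lambda>v. ab h v - ab (a \<cdot> g) v)"
    have "inv\<^bsub>G\<^esub> a \<cdot> h = g \<cdot> ?e \<longleftrightarrow> h = a \<cdot> g \<cdot> ?e"
      using a g True G.inv_solve_left[of "g \<cdot> ?e" a h]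
      by (simp add: G.m_assoc eq_commute[of "inv\<^bsub>G\<^esub> a \<cdot> h"])
    then show ?thesis using a True by (simp add: act_def \<sigma>_def n)
  qed (simp add: act_def \<sigma>_def)
qed

text \<open>Inverts \<open>\<sigma> g\<close> on the open star of \<open>g\<close>. The weights of
  \<open>g\<close> and of a neighbour in direction \<open>v\<close> share the factors of the other
  coordinates, which cancel in each quotient; the two quotients give the positive and the negative
  part of the coordinate.\<close>

definition coord :: "'v gword set \<Rightarrow> ('v gword set \<Rightarrow> real) \<Rightarrow> 'v \<Rightarrow> real" where
  "coord g b v = b (g \<cdot> lt v True) / (b g + b (g \<cdot> lt v True))
    - b (g \<cdot> lt v False) / (b g + b (g \<cdot> lt v False))"

lemma \<sigma>_vertex: assumes "g \<in> Gs" shows "\<sigma> g y g = (\<Prod>v\<in>V. hat (y v))"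
  using assms by (simp add: \<sigma>_def)

lemma \<sigma>_vertex_lt:
  assumes g: "g \<in> Gs" and v: "v \<in> V"
  shows "\<sigma> g y (g \<cdot> lt v e) = hat (y v - of_int (lsign e)) * (\<Prod>u\<in>V - {v}. hat (y u))"
proof -
  have n: "ab (g \<cdot> lt v e) u - ab g u = (if u = v then lsign e else 0)" for u
    using g v by (simp add: ab_mult ab_lt)
  have "\<sigma> g y (g \<cdot> lt v e) =
      (\<Prod>u\<in>V. hat (y u - of_int (if u = v then lsign e else 0)))"
    unfolding \<sigma>_def n using g v by (simp add: elt_single pw_sign)
  also have "\<dots> = hat (y v - of_int (lsign e)) * (\<Prod>u\<in>V - {v}. hat (y u))"
    using v finite_V by (subst prod.remove[of V v]) auto
  finally show ?thesis .
qed

text \<open>Turns a non-zero coordinate into a neighbour with positive weight, so that length bounds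
  on such vertices restrict the letter in that direction.\<close>

lemma \<sigma>_neighbour_pos:
  assumes "g \<in> Gs" "v \<in> V" "y v \<noteq> 0" "\<And>u. \<bar>y u\<bar> < 1"
  shows "\<sigma> g y (g \<cdot> lt v (y v > 0)) > 0"
proof -
  have "hat (y v - of_int (lsign (y v > 0))) > 0"
    using assms(3) assms(4)[of v] unfolding hat_pos_iff lsign_def
    by (cases "y v > 0") (simp_all add: abs_less_iff)
  moreover have "(\<Prod>u\<in>V - {v}. hat (y u)) > 0"
    using assms(4) by (intro prod_pos) (simp add: hat_pos_iff)
  ultimately show ?thesis using assms(1,2) by (simp add: \<sigma>_vertex_lt)
qed

lemma hat_ratio: assumes "\<bar>t\<bar> < 1"
  shows "hat (t - 1) / (hat t + hat (t - 1)) - hat (t + 1) / (hat t + hat (t + 1)) = t"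
  using assms by (cases "t \<ge> 0") (simp_all add: hat_def)

lemma coord_\<sigma>:
  assumes g: "g \<in> Gs" and v: "v \<in> V" and y: "\<And>u. u \<in> V \<Longrightarrow> \<bar>y u\<bar> < 1"
  shows "coord g (\<sigma> g y) v = y v"
proof -
  let ?P = "\<Prod>u\<in>V - {v}. hat (y u)"
  have P: "?P > 0" using y by (intro prod_pos) (simp add: hat_pos_iff)
  have "\<sigma> g y g = hat (y v) * ?P"
    using v finite_V g by (simp add: \<sigma>_vertex prod.remove)
  then have "coord g (\<sigma> g y) v = hat (y v - 1) * ?P / ((hat (y v) + hat (y v - 1)) * ?P)
      - hat (y v + 1) * ?P / ((hat (y v) + hat (y v + 1)) * ?P)"
    using g v by (simp add: coord_def \<sigma>_vertex_lt algebra_simps)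
  also have "\<dots> = y v"
    using P hat_ratio[OF y[OF v]] by simp
  finally show ?thesis .
qed

definition UC :: "('v gword set \<Rightarrow> real) set" where
  "UC = {\<sigma> g y | g y. g \<in> Gs \<and> clique_supp y}"

lemma UC_I: "g \<in> Gs \<Longrightarrow> clique_supp y \<Longrightarrow> \<sigma> g y \<in> UC" by (auto simp: UC_def)

text \<open>Every vertex of positive weight can serve as base vertex, with coordinates strictly
  between -1 and 1. The shift is allowed because an integer of absolute value below 1 is 0, which
  handles the vanishing coordinates.\<close>

lemma UC_star:
  assumes b: "b \<in> UC" "b h > 0"
  obtains y where "h \<in> Gs" "clique_supp y" "\<And>v. \<bar>y v\<bar> < 1" "b = \<sigma> h y"
proof -
  obtain g y where gy: "g \<in> Gs" "clique_supp y" "b = \<sigma> g y" using b(1) by (auto simp: UC_def)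
  let ?m = "\<lambda>v. ab h v - ab g v"
  have h: "h \<in> Gs" "h = g \<cdot> elt ?m" and m: "\<And>v. v \<in> V \<Longrightarrow> \<bar>y v - of_int (?m v)\<bar> < 1"
    using b(2) unfolding gy(3) \<sigma>_pos_iff by blast+
  have out: "?m v = 0" if "v \<notin> V" for v using ab_outside that gy(1) h(1) by simp
  have m0: "?m v = 0" if "y v = 0" for v
  proof (cases "v \<in> V")
    case True
    then have "\<bar>real_of_int (?m v)\<bar> < 1" using m[OF True] that by simp
    then show ?thesis by linarith
  qed (rule out)
  show ?thesis
  proof
    show "b = \<sigma> h (\<lambda>v. y v - of_int (?m v))"
      using \<sigma>_shift[OF gy(1,2) m0] h(2) gy(3) by simp
    show "clique_supp (\<lambda>v. y v - of_int (?m v))"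
      using gy(2) by (rule clique_supp_subset) (simp add: m0)
    show "\<bar>y v - of_int (?m v)\<bar> < 1" for v
      using m out clique_supp_outside[OF gy(2)] by (cases "v \<in> V") auto
  qed (rule h)
qed

lemma UC_shift:
  assumes "g \<in> Gs" "clique_supp y" "\<And>v. y v = 0 \<Longrightarrow> m v = 0"
  obtains h where "h \<in> Gs" "\<sigma> g y = \<sigma> h (\<lambda>v. y v - of_int (m v))"
    "clique_supp (\<lambda>v. y v - of_int (m v))"
proof
  show "\<sigma> g y = \<sigma> (g \<cdot> elt m) (\<lambda>v. y v - of_int (m v))" by (rule \<sigma>_shift[OF assms])
  show "clique_supp (\<lambda>v. y v - of_int (m v))"
    using assms(2) by (rule clique_supp_subset) (simp add: assms(3))
qed (use assms(1) in simp)

lemma UC_canonical: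
  assumes "b \<in> UC"
  obtains g y where "g \<in> Gs" "clique_supp y" "\<And>v. 0 \<le> y v \<and> y v < 1" "b = \<sigma> g y"
proof -
  obtain g y where gy: "g \<in> Gs" "clique_supp y" "b = \<sigma> g y" using assms by (auto simp: UC_def)
  obtain h where h: "h \<in> Gs" "\<sigma> g y = \<sigma> h (\<lambda>v. y v - of_int \<lfloor>y v\<rfloor>)"
    "clique_supp (\<lambda>v. y v - of_int \<lfloor>y v\<rfloor>)"
    by (rule UC_shift[OF gy(1,2), of "\<lambda>v. \<lfloor>y v\<rfloor>"]) auto
  show ?thesis
  proof (rule that[OF h(1,3)])
    show "0 \<le> y v - of_int \<lfloor>y v\<rfloor> \<and> y v - of_int \<lfloor>y v\<rfloor> < 1" for v by linarith
  qed (simp add: h(2) gy(3))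
qed

lemma \<sigma>_vertex_pos: "g \<in> Gs \<Longrightarrow> (\<And>v. \<bar>y v\<bar> < 1) \<Longrightarrow> \<sigma> g y g > 0"
  by (simp add: \<sigma>_pos_iff)

text \<open>Each of the two base vertices has positive weight in the other description. With
  coordinates in \<open>[0, 1)\<close> the integer differences of their exponents and the negatives
  of these exceed -1, so they vanish; \<open>coord\<close> then recovers the coordinates.\<close>

lemma \<sigma>_inject:
  assumes g: "g \<in> Gs" "g' \<in> Gs" and y: "clique_supp y" "clique_supp y'"
    and bd: "\<And>v. 0 \<le> y v \<and> y v < 1" "\<And>v. 0 \<le> y' v \<and> y' v < 1" and eq: "\<sigma> g y = \<sigma> g' y'"
  shows "g = g'" "y = y'"
proof -
  have "\<sigma> g y g > 0" "\<sigma> g' y' g' > 0" using g bd by (simp_all add: \<sigma>_vertex_pos abs_less_iff)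
  then have "\<sigma> g' y' g > 0" "\<sigma> g y g' > 0" using eq by simp_all
  then have 1: "g = g' \<cdot> elt (\<lambda>v. ab g v - ab g' v)"
    and 2: "\<And>v. v \<in> V \<Longrightarrow> \<bar>y' v - of_int (ab g v - ab g' v)\<bar> < 1"
      "\<And>v. v \<in> V \<Longrightarrow> \<bar>y v - of_int (ab g' v - ab g v)\<bar> < 1"
    unfolding \<sigma>_pos_iff by blast+
  have "ab g v - ab g' v = 0" for v
  proof (cases "v \<in> V")
    case True
    have "- 1 < real_of_int (ab g v - ab g' v)" "- 1 < real_of_int (ab g' v - ab g v)"
      using 2[OF True] bd[of v] by linarith+
    then show ?thesis by linarith
  qed (simp add: ab_outside g)
  with 1 g show gg: "g = g'" by simp
  show "y = y'"
  proof
    fix v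
    show "y v = y' v"
    proof (cases "v \<in> V")
      case True
      have "coord g (\<sigma> g y) v = y v" "coord g (\<sigma> g' y') v = y' v"
        unfolding gg[symmetric] using bd by (auto intro!: coord_\<sigma> g True simp: abs_less_iff intro: less_le_trans)
      then show ?thesis using eq by simp
    qed (use y clique_supp_outside in metis)
  qed
qed

text \<open>The cell complex as a subspace of the torus with one circle for each vertex.\<close>

definition TC :: "('v \<Rightarrow> complex) set" where
  "TC = {z. (\<forall>v. cmod (z v) = 1) \<and> {v. z v \<noteq> 1} \<in> cliques V E}"

definition cexp :: "('v \<Rightarrow> real) \<Rightarrow> 'v \<Rightarrow> complex" where
  "cexp y v = cis (2 * pi * y v)"

lemma cexp_in_TC: assumes "clique_supp y" shows "cexp y \<in> TC"
proof -
  have "{v. cexp y v \<noteq> 1} \<subseteq> {v. y v \<noteq> 0}" by (auto simp: cexp_def)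
  with assms cliques_subset show ?thesis by (auto simp: TC_def clique_supp_def cexp_def)
qed

lemma cexp_shift: "cexp (\<lambda>v. y v - of_int (m v)) = cexp y"
proof
  fix v
  have "cis (2 * pi * y v - 2 * pi * of_int (m v)) = cis (2 * pi * y v) / cis (2 * pi * of_int (m v))"
    by (simp only: cis_divide)
  moreover have "cis (2 * pi * of_int (m v)) = 1" by (rule cis_multiple_2pi) simp
  ultimately show "cexp (\<lambda>v. y v - of_int (m v)) v = cexp y v"
    unfolding cexp_def right_diff_distrib by simp
qed

definition pr :: "('v gword set \<Rightarrow> real) \<Rightarrow> 'v \<Rightarrow> complex" where
  "pr b = (SOME z. \<exists>g y. g \<in> Gs \<and> clique_supp y \<and> b = \<sigma> g y \<and> z = cexp y)"

lemma \<sigma>_eq_imp_cexp_eq: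
  assumes g: "g \<in> Gs" "g' \<in> Gs" and y: "clique_supp y" "clique_supp y'"
    and eq: "\<sigma> g y = \<sigma> g' y'"
  shows "cexp y = cexp y'"
proof -
  let ?f = "\<lambda>y v. y v - of_int \<lfloor>y v\<rfloor> :: real"
  obtain h where h: "h \<in> Gs" "\<sigma> g y = \<sigma> h (?f y)" "clique_supp (?f y)"
    by (rule UC_shift[OF g(1) y(1), of "\<lambda>v. \<lfloor>y v\<rfloor>"]) auto
  obtain h' where h': "h' \<in> Gs" "\<sigma> g' y' = \<sigma> h' (?f y')" "clique_supp (?f y')"
    by (rule UC_shift[OF g(2) y(2), of "\<lambda>v. \<lfloor>y' v\<rfloor>"]) auto
  have "0 \<le> ?f z v \<and> ?f z v < 1" for z and v :: 'v by linarith
  then have "?f y = ?f y'"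
    using \<sigma>_inject(2)[OF h(1) h'(1) h(3) h'(3)] h(2) h'(2) eq by simp
  then show ?thesis using cexp_shift[of y "\<lambda>v. \<lfloor>y v\<rfloor>"] cexp_shift[of y' "\<lambda>v. \<lfloor>y' v\<rfloor>"] by simp
qed

lemma pr_\<sigma>: assumes "g \<in> Gs" "clique_supp y" shows "pr (\<sigma> g y) = cexp y"
proof -
  have "\<exists>z g' y'. g' \<in> Gs \<and> clique_supp y' \<and> \<sigma> g y = \<sigma> g' y' \<and> z = cexp y'"
    using assms by blast
  from someI_ex[OF this] have "\<exists>g' y'. g' \<in> Gs \<and> clique_supp y' \<and>
      \<sigma> g y = \<sigma> g' y' \<and> pr (\<sigma> g y) = cexp y'"
    unfolding pr_def .
  then show ?thesis using \<sigma>_eq_imp_cexp_eq assms by metis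
qed

lemma continuous_on_coord: "g \<in> Gs \<Longrightarrow> v \<in> V \<Longrightarrow>
    continuous_on {b \<in> UC. b g > 0} (\<lambda>b. coord g b v)"
  unfolding coord_def
proof (intro continuous_intros continuous_on_product_coordinates[THEN continuous_on_subset])
  have "b h \<ge> 0" if "b \<in> UC" for b h using that \<sigma>_nonneg by (auto simp: UC_def)
  then have "\<forall>x\<in>{b \<in> UC. b g > 0}. x g + x (g \<cdot> lt v e) \<noteq> 0" for e
    by (metis (mono_tags, lifting) add_pos_nonneg less_irrefl mem_Collect_eq)
  then show "\<forall>x\<in>{b \<in> UC. b g > 0}. x g + x (g \<cdot> lt v True) \<noteq> 0"
    "\<forall>x\<in>{b \<in> UC. b g > 0}. x g + x (g \<cdot> lt v False) \<noteq> 0" by blast+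
qed simp_all

lemma openin_star: "openin (top_of_set UC) {b \<in> UC. b g > 0}"
proof -
  have "open ((\<lambda>b::'v gword set \<Rightarrow> real. b g) -` {0<..})"
    by (intro open_vimage open_greaterThan continuous_on_product_coordinates)
  then have "openin (top_of_set UC) (UC \<inter> (\<lambda>b. b g) -` {0<..})" by (rule openin_open_Int)
  moreover have "UC \<inter> (\<lambda>b. b g) -` {0<..} = {b \<in> UC. b g > 0}" by auto
  ultimately show ?thesis by simp
qed

lemma UC_vertex: assumes "b \<in> UC" obtains g where "g \<in> Gs" "b g > 0"
proof -
  obtain g y where gy: "g \<in> Gs" "clique_supp y" "\<And>v. 0 \<le> y v \<and> y v < 1" "b = \<sigma> g y"
    by (rule UC_canonical[OF assms]) blast
  have "\<sigma> g y g > 0" by (rule \<sigma>_vertex_pos[OF gy(1)]) (use gy(3) in \<open>simp add: abs_less_iff less_le_trans\<close>)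
  then show ?thesis using that gy by blast
qed

lemma coord_star:
  assumes "b \<in> UC" "b g > 0"
  shows "g \<in> Gs" "clique_supp (\<lambda>v. if v \<in> V then coord g b v else 0)"
    "b = \<sigma> g (\<lambda>v. if v \<in> V then coord g b v else 0)" "v \<in> V \<Longrightarrow> \<bar>coord g b v\<bar> < 1"
proof -
  obtain y where y: "g \<in> Gs" "clique_supp y" "\<And>v. \<bar>y v\<bar> < 1" "b = \<sigma> g y"
    by (rule UC_star[OF assms]) blast
  have c: "coord g b v = y v" if "v \<in> V" for v
    using coord_\<sigma>[OF y(1) that] y(3,4) by simp
  have eq: "(\<lambda>v. if v \<in> V then coord g b v else 0) = y"
    using c clique_supp_outside[OF y(2)] by auto
  show "g \<in> Gs" by (rule y(1))
  show "clique_supp (\<lambda>v. if v \<in> V then coord g b v else 0)"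
    "b = \<sigma> g (\<lambda>v. if v \<in> V then coord g b v else 0)" unfolding eq by (rule y)+
  show "v \<in> V \<Longrightarrow> \<bar>coord g b v\<bar> < 1" using c y(3) by simp
qed

lemma pr_star:
  assumes "b \<in> UC" "b g > 0"
  shows "pr b = cexp (\<lambda>v. if v \<in> V then coord g b v else 0)"
proof -
  note c = coord_star[OF assms]
  show ?thesis by (rule HOL.trans[OF arg_cong[where f = pr, OF c(3)] pr_\<sigma>[OF c(1,2)]])
qed

lemma continuous_map_pr: "continuous_map (top_of_set UC) (top_of_set TC) pr"
proof (rule pasting_lemma[where I = "Gs" and T = "\<lambda>g. {b \<in> UC. b g > 0}" and f = "\<lambda>_. pr"])
  fix g assume g: "g \<in> Gs"
  let ?U = "{b \<in> UC. b g > 0}"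
  show "openin (top_of_set UC) ?U" by (rule openin_star)
  have "continuous_on ?U (\<lambda>b. cexp (\<lambda>v. if v \<in> V then coord g b v else 0))"
  proof (rule continuous_on_coordinatewise_then_product)
    show "continuous_on ?U (\<lambda>b. cexp (\<lambda>v. if v \<in> V then coord g b v else 0) v)" for v
      unfolding cexp_def
      by (cases "v \<in> V") (auto intro!: continuous_intros continuous_on_coord g)
  qed
  then have "continuous_on ?U pr"
    by (rule continuous_on_eq) (rule HOL.sym, rule pr_star; simp)
  moreover have "pr b \<in> TC" if "b \<in> UC" for b
    using that by (auto simp: UC_def pr_\<sigma> cexp_in_TC)
  ultimately show "continuous_map (subtopology (top_of_set UC) ?U) (top_of_set TC) pr"
    by (auto simp: subtopology_subtopology continuous_map_in_subtopology Int_absorb1 subset_eq)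
qed (use UC_vertex in auto)

lemma pr_act: assumes "a \<in> Gs" "b \<in> UC" shows "act a b \<in> UC" "pr (act a b) = pr b"
proof -
  obtain g y where "g \<in> Gs" "clique_supp y" "b = \<sigma> g y" using assms(2) by (auto simp: UC_def)
  then show "act a b \<in> UC" "pr (act a b) = pr b"
    using assms(1) by (simp_all add: act_\<sigma> UC_I pr_\<sigma>)
qed

lemma continuous_map_act: assumes "a \<in> Gs"
  shows "continuous_map (top_of_set UC) (top_of_set UC) (act a)"
proof -
  have "continuous_on UC (act a)"
  proof (rule continuous_on_coordinatewise_then_product)
    show "continuous_on UC (\<lambda>b. act a b h)" for h
      unfolding act_def
      by (cases "h \<in> Gs")
        (auto intro!: continuous_intros continuous_on_product_coordinates[THEN continuous_on_subset])
  qed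
  then show ?thesis using pr_act(1)[OF assms] by (auto simp: continuous_map_in_subtopology)
qed

lemma act_mult:
  assumes "a \<in> Gs" "b \<in> Gs" shows "act (a \<cdot> b) c = act a (act b c)"
  using assms by (auto simp: act_def fun_eq_iff G.inv_mult_group G.m_assoc)

lemma act_one: "b \<in> UC \<Longrightarrow> act \<e> b = b"
  by (auto simp: UC_def act_\<sigma>)

lemma act_free:
  assumes "a \<in> Gs" "a' \<in> Gs" "b \<in> UC" "act a b = act a' b"
  shows "a = a'"
proof -
  obtain g y where gy: "g \<in> Gs" "clique_supp y" "\<And>v. 0 \<le> y v \<and> y v < 1" "b = \<sigma> g y"
    by (rule UC_canonical[OF assms(3)]) blast
  then have "\<sigma> (a \<cdot> g) y = \<sigma> (a' \<cdot> g) y" using assms by (simp add: act_\<sigma>)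
  then have "a \<cdot> g = a' \<cdot> g"
    by (rule \<sigma>_inject(1)[OF _ _ gy(2) gy(2) gy(3) gy(3), rotated 2]) (use assms gy in auto)
  then show ?thesis using assms gy by simp
qed

text \<open>A branch of the logarithm on the set \<open>ev Q\<close> of points whose \<open>Q\<close>-coordinates avoid \<open>1\<close> and
  whose other coordinates avoid \<open>- 1\<close>.\<close>

definition clog :: "'v set \<Rightarrow> ('v \<Rightarrow> complex) \<Rightarrow> 'v \<Rightarrow> real" where
  "clog Q z v = (if v \<in> Q then Arg (- z v) / (2 * pi) + 1 / 2 else Arg (z v) / (2 * pi))"

definition ev :: "'v set \<Rightarrow> ('v \<Rightarrow> complex) set" where
  "ev Q = {z \<in> TC. (\<forall>v\<in>Q. z v \<noteq> 1) \<and> (\<forall>v\<in>V - Q. z v \<noteq> - 1)}"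

lemma unit_circle_nonpos_Reals: assumes "cmod z = 1" "z \<in> \<real>\<^sub>\<le>\<^sub>0" shows "z = - 1"
proof -
  obtain r where r: "z = of_real r" "r \<le> 0" using assms(2) by (auto elim: nonpos_Reals_cases)
  then have "\<bar>r\<bar> = 1" using assms(1) by simp
  then have "r = - 1" using r(2) by simp
  then show ?thesis using r(1) by simp
qed

lemma TC_outside: "z \<in> TC \<Longrightarrow> v \<notin> V \<Longrightarrow> z v = 1"
  by (auto simp: TC_def cliques_iff)

lemma ev_nonpos:
  assumes "z \<in> ev Q"
  shows "v \<in> Q \<Longrightarrow> - z v \<notin> \<real>\<^sub>\<le>\<^sub>0" "v \<notin> Q \<Longrightarrow> z v \<notin> \<real>\<^sub>\<le>\<^sub>0"
proof -
  have c: "cmod (z v) = 1" using assms by (auto simp: ev_def TC_def)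
  show "- z v \<notin> \<real>\<^sub>\<le>\<^sub>0" if "v \<in> Q"
    using unit_circle_nonpos_Reals[of "- z v"] c that assms by (auto simp: ev_def)
  show "z v \<notin> \<real>\<^sub>\<le>\<^sub>0" if "v \<notin> Q"
    using unit_circle_nonpos_Reals[of "z v"] c that assms TC_outside[of z v]
    by (cases "v \<in> V") (auto simp: ev_def)
qed

lemma Arg_less_pi: "z \<notin> \<real>\<^sub>\<le>\<^sub>0 \<Longrightarrow> \<bar>Arg z\<bar> < pi"
  using Arg_bounded[of z] Arg_eq_pi[of z] by (fastforce simp: complex_nonpos_Reals_iff abs_less_iff)

lemma clog_bounds:
  assumes "z \<in> ev Q"
  shows "v \<in> Q \<Longrightarrow> 0 < clog Q z v \<and> clog Q z v < 1" "v \<notin> Q \<Longrightarrow> \<bar>clog Q z v\<bar> < 1 / 2"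
proof -
  show "0 < clog Q z v \<and> clog Q z v < 1" if "v \<in> Q"
    using Arg_less_pi[OF ev_nonpos(1)[OF assms that]] that
    by (simp add: clog_def field_simps abs_less_iff)
  show "\<bar>clog Q z v\<bar> < 1 / 2" if "v \<notin> Q"
    using Arg_less_pi[OF ev_nonpos(2)[OF assms that]] that
    by (simp add: clog_def field_simps abs_less_iff)
qed

lemma cexp_clog: assumes "z \<in> TC" shows "cexp (clog Q z) = z"
proof
  fix v
  have c: "cmod (z v) = 1" using assms by (simp add: TC_def)
  then have "z v \<noteq> 0" by auto
  with c have "cis (Arg (z v)) = z v" "cis (Arg (- z v)) = - z v" by (simp_all add: cis_Arg sgn_div_norm)
  moreover have "cis (t + pi) = - cis t" for t by (simp flip: cis_mult)
  ultimately show "cexp (clog Q z) v = z v"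
    by (simp add: cexp_def clog_def distrib_left)
qed

lemma clique_supp_clog: assumes "z \<in> ev Q" shows "clique_supp (clog Q z)"
proof -
  have "{v. clog Q z v \<noteq> 0} \<subseteq> {v. z v \<noteq> 1}"
    using assms by (auto simp: clog_def ev_def)
  then show ?thesis using assms cliques_subset by (auto simp: clique_supp_def ev_def TC_def)
qed

lemma clog_cexp:
  assumes "\<And>v. v \<in> Q \<Longrightarrow> 0 < y v \<and> y v < 1" "\<And>v. v \<notin> Q \<Longrightarrow> \<bar>y v\<bar> < 1 / 2"
  shows "clog Q (cexp y) = y"
proof
  fix v
  show "clog Q (cexp y) v = y v"
  proof (cases "v \<in> Q")
    case True
    have "cis (2 * pi * y v - pi) = - cexp y v" by (simp add: cexp_def flip: cis_divide)
    moreover have "2 * pi * y v < 2 * pi" "0 < 2 * pi * y v" using assms(1)[OF True] by simp_all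
    ultimately have "Arg (- cexp y v) = 2 * pi * y v - pi"
      using Arg_cis[of "2 * pi * y v - pi"] by simp
    then show ?thesis using True by (simp add: clog_def field_simps)
  next
    case False
    have "y v < 1 / 2" "- (1 / 2) < y v" using assms(2)[OF False] by linarith+
    then have "2 * pi * y v < 2 * pi * (1 / 2)" "2 * pi * (- (1 / 2)) < 2 * pi * y v"
      by (intro mult_strict_left_mono; simp)+
    then have "Arg (cexp y v) = 2 * pi * y v" unfolding cexp_def by (intro Arg_cis) simp
    then show ?thesis using False by (simp add: clog_def)
  qed
qed

lemma continuous_on_clog: "continuous_on (ev Q) (clog Q)"
proof (rule continuous_on_coordinatewise_then_product)
  show "continuous_on (ev Q) (\<lambda>z. clog Q z v)" for v
    unfolding clog_def
    by (cases "v \<in> Q")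
      (auto intro!: continuous_intros continuous_on_product_coordinates[THEN continuous_on_subset]
        dest: ev_nonpos)
qed

lemma ev_openin: assumes "Q \<subseteq> V" shows "openin (top_of_set TC) (ev Q)"
proof -
  have fin: "finite Q" "finite (V - Q)" using assms finite_V finite_subset by auto
  have op: "open {z::'v \<Rightarrow> complex. z v \<noteq> c}" for v c
  proof -
    have "open ((\<lambda>z::'v \<Rightarrow> complex. z v) -` (- {c}))"
      by (intro open_vimage continuous_on_product_coordinates) auto
    moreover have "(\<lambda>z::'v \<Rightarrow> complex. z v) -` (- {c}) = {z. z v \<noteq> c}" by auto
    ultimately show ?thesis by simp
  qed
  have "ev Q = TC \<inter> ((\<Inter>v\<in>Q. {z. z v \<noteq> 1}) \<inter> (\<Inter>v\<in>V - Q. {z. z v \<noteq> - 1}))"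
    by (auto simp: ev_def)
  moreover have "open ((\<Inter>v\<in>Q. {z. z v \<noteq> (1::complex)}) \<inter> (\<Inter>v\<in>V - Q. {z. z v \<noteq> - 1}))"
    using fin op by (intro open_Int open_INT) auto
  ultimately show ?thesis by (auto simp: openin_open)
qed

text \<open>Describes the image by strict inequalities between coordinates that are continuous on
  the star of the identity; this is how it is seen to be open. The upper bound 1 on the coordinates
  in \<open>Q\<close> comes from the star itself.\<close>

lemma section_image:
  assumes Q: "Q \<subseteq> V"
  shows "(\<lambda>z. \<sigma> \<e> (clog Q z)) ` ev Q = {b \<in> UC. b \<e> > 0} \<inter>
    {b \<in> {b \<in> UC. b \<e> > 0}. \<forall>v\<in>V. if v \<in> Q then coord \<e> b v > 0
      else \<bar>coord \<e> b v\<bar> < 1 / 2}" (is "_ = ?R")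
proof (intro equalityI subsetI)
  fix b assume "b \<in> (\<lambda>z. \<sigma> \<e> (clog Q z)) ` ev Q"
  then obtain z where z: "z \<in> ev Q" "b = \<sigma> \<e> (clog Q z)" by blast
  have bd: "\<bar>clog Q z v\<bar> < 1" for v
    using clog_bounds[OF z(1), of v] by (cases "v \<in> Q") auto
  have "coord \<e> b v = clog Q z v" if "v \<in> V" for v
    unfolding z(2) using that bd by (intro coord_\<sigma>) auto
  then show "b \<in> ?R"
    using clog_bounds[OF z(1)] UC_I[OF _ clique_supp_clog[OF z(1)]] \<sigma>_vertex_pos[OF _ bd] z(2) by auto
next
  fix b assume b: "b \<in> ?R"
  let ?y = "\<lambda>v. if v \<in> V then coord \<e> b v else 0"
  have b': "b \<in> UC" "b \<e> > 0" using b by auto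
  note y = coord_star[OF b']
  have bd: "0 < ?y v \<and> ?y v < 1" if "v \<in> Q" for v
    using b that Q y(4)[of v] by (auto simp: abs_less_iff)
  have bd': "\<bar>?y v\<bar> < 1 / 2" if "v \<notin> Q" for v
    using b that by auto
  have "cexp ?y \<in> ev Q"
  proof -
    have "cexp ?y v \<noteq> 1" if "v \<in> Q" for v
    proof
      assume "cexp ?y v = 1"
      \<comment> \<open>At the excluded value the branch takes its boundary value, since
        \<open>Arg (- 1)\<close> is \<open>pi\<close>.\<close>
      then have "clog Q (cexp ?y) v = 1" using that Arg_eq_pi[of "- 1"] by (simp add: clog_def)
      then show False using clog_cexp[OF bd bd'] bd[OF that] by simp
    qed
    moreover have "cexp ?y v \<noteq> - 1" if "v \<notin> Q" for v
    proof
      assume "cexp ?y v = - 1"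
      then have "clog Q (cexp ?y) v = 1 / 2" using that Arg_eq_pi[of "- 1"] by (simp add: clog_def)
      then show False using clog_cexp[OF bd bd'] bd'[OF that] by simp
    qed
    ultimately show ?thesis using cexp_in_TC[OF y(2)] by (auto simp: ev_def)
  qed
  moreover have "clog Q (cexp ?y) = ?y" by (rule clog_cexp[OF bd bd'])
  then have "\<sigma> \<e> (clog Q (cexp ?y)) = \<sigma> \<e> ?y" by (rule arg_cong)
  then have "b = \<sigma> \<e> (clog Q (cexp ?y))" using y(3) by (rule HOL.trans[OF _ HOL.sym, rotated])
  ultimately show "b \<in> (\<lambda>z. \<sigma> \<e> (clog Q z)) ` ev Q" by blast
qed

lemma section_open:
  assumes "Q \<subseteq> V"
  shows "openin (top_of_set UC) ((\<lambda>z. \<sigma> \<e> (clog Q z)) ` ev Q)"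
proof -
  let ?U = "{b \<in> UC. b \<e> > 0}"
  let ?W = "\<lambda>v. if v \<in> Q then {0<..} else {-1/2<..<1/2::real}"
  have W: "t \<in> ?W v \<longleftrightarrow> (if v \<in> Q then t > 0 else \<bar>t\<bar> < 1 / 2)" for t v
  proof -
    have "t \<in> {-1/2<..<1/2} \<longleftrightarrow> \<bar>t\<bar> < 1 / 2" unfolding greaterThanLessThan_iff by linarith
    then show ?thesis by (cases "v \<in> Q") simp_all
  qed
  have "openin (top_of_set ?U) {b \<in> ?U. coord \<e> b v \<in> ?W v}" if "v \<in> V" for v
  proof -
    have "openin (top_of_set ?U) (?U \<inter> (\<lambda>b. coord \<e> b v) -` ?W v)"
      using continuous_on_coord[OF G.one_closed that] by (rule continuous_openin_preimage_gen) simp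
    moreover have "?U \<inter> (\<lambda>b. coord \<e> b v) -` ?W v = {b \<in> ?U. coord \<e> b v \<in> ?W v}" by auto
    ultimately show ?thesis by simp
  qed
  from openin_INT[OF finite_V this]
  have "openin (top_of_set ?U) ((\<Inter>v\<in>V. {b \<in> ?U. coord \<e> b v \<in> ?W v}) \<inter> ?U)" by simp
  moreover have "(\<Inter>v\<in>V. {b \<in> ?U. coord \<e> b v \<in> ?W v}) \<inter> ?U =
      (\<lambda>z. \<sigma> \<e> (clog Q z)) ` ev Q"
    unfolding section_image[OF assms] W by blast
  ultimately have "openin (top_of_set ?U) ((\<lambda>z. \<sigma> \<e> (clog Q z)) ` ev Q)" by simp
  then show ?thesis using openin_star openin_trans by blast
qed

lemma section_orbit:
  assumes b: "b \<in> UC" "pr b \<in> ev Q"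
  shows "\<exists>a\<in>Gs. b = act a (\<sigma> \<e> (clog Q (pr b)))"
proof -
  obtain g y where gy: "g \<in> Gs" "clique_supp y" "b = \<sigma> g y" using b(1) by (auto simp: UC_def)
  have z: "pr b = cexp y" using gy pr_\<sigma> by simp
  \<comment> \<open>Rounding down for the coordinates in \<open>Q\<close> and to the nearest integer
    for the others moves \<open>y\<close> into the range of the branch \<open>clog Q\<close>; the
    boundary values 0 and -1/2 are then excluded by \<open>ev Q\<close>.\<close>
  define m where "m v = (if v \<in> Q then \<lfloor>y v\<rfloor> else \<lfloor>y v + 1 / 2\<rfloor>)" for v
  let ?y = "\<lambda>v. y v - of_int (m v)"
  have m0: "m v = 0" if "y v = 0" for v using that by (simp add: m_def)
  obtain h where h: "h \<in> Gs" "\<sigma> g y = \<sigma> h ?y" "clique_supp ?y"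
    by (rule UC_shift[OF gy(1,2) m0])
  have zy: "pr b = cexp ?y" using z cexp_shift by simp
  have 1: "0 < ?y v \<and> ?y v < 1" if "v \<in> Q" for v
  proof -
    have "0 \<le> ?y v \<and> ?y v < 1" using that by (simp add: m_def) linarith
    moreover have "?y v \<noteq> 0"
    proof
      assume "?y v = 0"
      then have "cexp ?y v = 1" by (simp add: cexp_def)
      then show False using b(2) that zy by (simp add: ev_def)
    qed
    ultimately show ?thesis by simp
  qed
  have 2: "\<bar>?y v\<bar> < 1 / 2" if "v \<notin> Q" for v
  proof -
    have "- 1 / 2 \<le> ?y v \<and> ?y v < 1 / 2" using that by (simp add: m_def) linarith
    moreover have "?y v \<noteq> - 1 / 2"
    proof
      assume *: "?y v = - 1 / 2"
      then have "v \<in> V" using clique_supp_outside[OF h(3), of v] by auto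
      moreover have "cexp ?y v = cis (- pi)" using * by (simp add: cexp_def)
      then have "cexp ?y v = - 1" by (simp flip: cis_inverse)
      ultimately show False using b(2) that zy by (simp add: ev_def)
    qed
    ultimately show ?thesis by linarith
  qed
  have "clog Q (pr b) = ?y" unfolding zy by (rule clog_cexp[OF 1 2])
  then have "b = act h (\<sigma> \<e> (clog Q (pr b)))" using h gy by (simp add: act_\<sigma>)
  with h(1) show ?thesis by blast
qed

theorem covering_map_pr: "covering_map (top_of_set UC) pr (top_of_set TC)"
proof (rule covering_map_from_sections[OF continuous_map_pr _ group_G continuous_map_act])
  have "z \<in> pr ` UC" if "z \<in> TC" for z
  proof -
    have "z \<in> ev {v. z v \<noteq> 1}" using that by (auto simp: ev_def)
    from UC_I[OF G.one_closed clique_supp_clog[OF this]] pr_\<sigma>[OF G.one_closed clique_supp_clog[OF this]]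
    show ?thesis using cexp_clog[OF that] by (metis image_eqI)
  qed
  then show "pr ` topspace (top_of_set UC) = topspace (top_of_set TC)"
    using continuous_map_pr by (auto simp: continuous_map_def)
next
  fix z assume "z \<in> topspace (top_of_set TC)"
  then have z: "z \<in> TC" by simp
  \<comment> \<open>With this choice \<open>z\<close> lies in \<open>ev ?Q\<close>: its coordinates
    outside are equal to 1 and hence avoid -1.\<close>
  let ?Q = "{v. z v \<noteq> 1}"
  let ?s = "\<lambda>z. \<sigma> \<e> (clog ?Q z)"
  have Q: "?Q \<subseteq> V" using z by (auto simp: TC_def cliques_iff)
  show "\<exists>T s. openin (top_of_set TC) T \<and> z \<in> T \<and>
      continuous_map (subtopology (top_of_set TC) T) (top_of_set UC) s \<and> (\<forall>x\<in>T. pr (s x) = x) \<and>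
      openin (top_of_set UC) (s ` T) \<and>
      (\<forall>c\<in>topspace (top_of_set UC). pr c \<in> T \<longrightarrow> (\<exists>a\<in>Gs. c = act a (s (pr c))))"
  proof (intro exI[of _ "ev ?Q"] exI[of _ ?s] conjI ballI impI)
    show "openin (top_of_set TC) (ev ?Q)" by (rule ev_openin[OF Q])
    show "z \<in> ev ?Q" using z by (auto simp: ev_def)
    have "continuous_on (ev ?Q) ?s"
      by (rule continuous_on_compose2[OF continuous_on_\<sigma>[of UNIV] continuous_on_clog]) simp
    moreover have "?s x \<in> UC" if "x \<in> ev ?Q" for x
      using UC_I[OF G.one_closed clique_supp_clog[OF that]] .
    moreover have "TC \<inter> ev ?Q = ev ?Q" by (auto simp: ev_def)
    ultimately show "continuous_map (subtopology (top_of_set TC) (ev ?Q)) (top_of_set UC) ?s"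
      by (auto simp: subtopology_subtopology continuous_map_in_subtopology)
    show "pr (?s x) = x" if "x \<in> ev ?Q" for x
      using pr_\<sigma>[OF G.one_closed clique_supp_clog[OF that]] cexp_clog[of x ?Q] that by (simp add: ev_def)
    show "openin (top_of_set UC) (?s ` ev ?Q)" by (rule section_open[OF Q])
    show "\<exists>a\<in>Gs. c = act a (?s (pr c))" if "c \<in> topspace (top_of_set UC)" "pr c \<in> ev ?Q" for c
      using section_orbit[of c ?Q] that by simp
  qed
qed (use act_one act_mult pr_act act_free in simp_all)

lemma pr_transitive:
  assumes "b \<in> UC" "b' \<in> UC" "pr b = pr b'" shows "\<exists>a\<in>Gs. b' = act a b"
proof -
  let ?s = "\<sigma> \<e> (clog {v. pr b v \<noteq> 1} (pr b))"
  have "pr b \<in> TC" using assms(1) continuous_map_pr by (auto simp: continuous_map_def)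
  then have "pr b \<in> ev {v. pr b v \<noteq> 1}" by (auto simp: ev_def)
  then obtain a a' where a: "a \<in> Gs" "b = act a ?s" "a' \<in> Gs" "b' = act a' ?s"
    using section_orbit assms by metis
  have "act (a' \<cdot> inv\<^bsub>G\<^esub> a) b = act (a' \<cdot> inv\<^bsub>G\<^esub> a \<cdot> a) ?s"
    using a by (simp add: act_mult)
  also have "\<dots> = b'" using a by (simp add: G.m_assoc)
  finally show ?thesis using a by (intro bexI[of _ "a' \<cdot> inv\<^bsub>G\<^esub> a"]) auto
qed

end

section \<open>Contractibility\<close>

lemma Hausdorff_space_euclidean_fun:
  "Hausdorff_space (euclidean :: ('i \<Rightarrow> 'a::metric_space) topology)"
  by (simp add: Hausdorff_space_product_topology flip: euclidean_product_topology)

lemma continuous_on_Min: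
  fixes f :: "'i \<Rightarrow> 'a::topological_space \<Rightarrow> real"
  assumes "finite I" "I \<noteq> {}" "\<And>i. i \<in> I \<Longrightarrow> continuous_on S (f i)"
  shows "continuous_on S (\<lambda>x. Min ((\<lambda>i. f i x) ` I))"
  using assms
proof (induction rule: finite_ne_induct)
  case (insert i F)
  then have "continuous_on S (\<lambda>x. min (f i x) (Min ((\<lambda>i. f i x) ` F)))"
    by (intro continuous_on_min) auto
  with insert.hyps show ?case by simp
qed simp

text \<open>The retraction of stage \<open>n + 1\<close> onto stage \<open>n\<close> runs during the time interval
  \<open>[1 / (n + 2), 1 / (n + 1)]\<close>.\<close>

primrec telescope :: "(nat \<Rightarrow> real \<times> 'a \<Rightarrow> 'a) \<Rightarrow> nat \<Rightarrow> real \<times> 'a \<Rightarrow> 'a" where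
  "telescope r 0 = snd"
| "telescope r (Suc n) = (\<lambda>z. if fst z \<le> 1 / (real n + 1)
    then r n (max 0 (min 1 ((fst z - 1 / (real n + 2)) * ((real n + 1) * (real n + 2)))), snd z)
    else telescope r n (fst z, r n (1, snd z)))"

text \<open>A point of \<open>C n\<close> rests until time \<open>1 / (n + 1)\<close>, so only
  finitely many retractions ever move it. By \<open>loc\<close> each point has a neighbourhood
  inside one stage, which makes the union of the finite homotopies continuous, also at time
  0.\<close>

lemma contractible_telescope:
  fixes C :: "nat \<Rightarrow> 'a::topological_space set" and r :: "nat \<Rightarrow> real \<times> 'a \<Rightarrow> 'a"
  assumes C0: "C 0 = {a}" and mono: "\<And>n. C n \<subseteq> C (Suc n)"
    and cont: "\<And>n. continuous_on ({0..1} \<times> C (Suc n)) (r n)"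
    and maps: "\<And>n t x. t \<in> {0..1} \<Longrightarrow> x \<in> C (Suc n) \<Longrightarrow> r n (t, x) \<in> C (Suc n)"
    and zero: "\<And>n x. x \<in> C (Suc n) \<Longrightarrow> r n (0, x) = x"
    and one: "\<And>n x. x \<in> C (Suc n) \<Longrightarrow> r n (1, x) \<in> C n"
    and fixed: "\<And>n t x. t \<in> {0..1} \<Longrightarrow> x \<in> C n \<Longrightarrow> r n (t, x) = x"
    and loc: "\<And>x. x \<in> (\<Union>n. C n) \<Longrightarrow> \<exists>U n. openin (top_of_set (\<Union>n. C n)) U \<and> x \<in> U \<and> U \<subseteq> C n"
  shows "contractible_space (top_of_set (\<Union>n. C n))"
proof -
  let ?S = "\<Union>n. C n" and ?I = "{0..1::real}"
  let ?h = "telescope r"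
  \<comment> \<open>Rescales \<open>[1 / (n + 2), 1 / (n + 1)]\<close>, an interval of length
    \<open>1 / ((n + 1) * (n + 2))\<close>, to the unit interval.\<close>
  let ?c = "\<lambda>n t. max 0 (min 1 ((t - 1 / (real n + 2)) * ((real n + 1) * (real n + 2))))"
  have c01: "?c n t \<in> ?I" for n t by simp
  have c0: "?c n t = 0" if "t \<le> 1 / (real n + 2)" for n t
  proof -
    have "(t - 1 / (real n + 2)) * ((real n + 1) * (real n + 2)) \<le> 0"
      by (rule mult_nonpos_nonneg) (use that in simp_all)
    then show ?thesis by linarith
  qed
  have c1: "?c n (1 / (real n + 1)) = 1" for n
  proof -
    have "1 / (real n + 1) - 1 / (real n + 2) = 1 / ((real n + 1) * (real n + 2))"
      by (simp add: divide_simps)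
    then show ?thesis by simp
  qed
  have early: "?h n (t, x) = x" if "t \<le> 1 / (real n + 1)" "x \<in> C n" for n t x
  proof (cases n)
    case (Suc k)
    have "1 / (real k + 2) \<le> 1 / (real k + 1)" by (simp add: divide_simps)
    with that Suc have "t \<le> 1 / (real k + 2)" "t \<le> 1 / (real k + 1)" by (simp_all add: add.commute)
    then show ?thesis using c0[where n = k and t = t] zero[where n = k and x = x] that Suc by (simp add: add.commute)
  qed simp
  have hC: "?h n (t, x) \<in> C n" if "t \<in> ?I" "x \<in> C n" for n t x
    using that
  proof (induction n arbitrary: x)
    case (Suc n)
    then show ?case using maps[OF c01[where n = n and t = t], where n = n and x = x] one[where x = x and n = n] mono[of n] by (auto simp: add.commute)
  qed simp
  have late: "?h n (1, x) = a" if "x \<in> C n" for n x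
    using that
  proof (induction n arbitrary: x)
    case 0
    then show ?case using C0 by simp
  next
    case (Suc n)
    then show ?case using c1[of n] one[where x = x and n = n] C0 by (cases n) auto
  qed
  \<comment> \<open>The retraction of stage \<open>n + 1\<close> fixes stage \<open>n\<close>, so
    the finite homotopies extend one another.\<close>
  have step: "?h (Suc n) (t, x) = ?h n (t, x)" if "x \<in> C n" for n t x
    using fixed[OF _ that, where t = 1] fixed[OF c01[where n = n and t = t] that] early[where n = n and t = t and x = x] that by (simp add: add.commute)
  have cont_h: "continuous_on (?I \<times> C n) (?h n)" for n
  proof (induction n)
    case 0
    show ?case by (simp add: continuous_on_snd)
  next
    case (Suc n)
    let ?D = "?I \<times> C (Suc n)"
    show ?case
      unfolding telescope.simps
    proof (rule continuous_on_cases_le[where h = fst])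
      show "continuous_on {z \<in> ?D. fst z \<le> 1 / (real n + 1)} (\<lambda>z. r n (?c n (fst z), snd z))"
        by (rule continuous_on_compose2[OF cont[of n]]) (auto intro!: continuous_intros)
      have "continuous_on ?D (\<lambda>z. (fst z, r n (1, snd z)))"
        by (intro continuous_intros continuous_on_compose2[OF cont[of n]]) auto
      then have "continuous_on ?D (\<lambda>z. ?h n (fst z, r n (1, snd z)))"
        by (rule continuous_on_compose2[OF Suc.IH]) (use one in auto)
      then show "continuous_on {z \<in> ?D. 1 / (real n + 1) \<le> fst z} (\<lambda>z. ?h n (fst z, r n (1, snd z)))"
        by (rule continuous_on_subset) auto
      show "r n (?c n (fst z), snd z) = ?h n (fst z, r n (1, snd z))"
        if "z \<in> ?D" "fst z = 1 / (real n + 1)" for z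
        unfolding that(2) c1 using one[where x = "snd z" and n = n] that(1) by (subst early) auto
    qed (intro continuous_intros)
  qed
  have mono': "C m \<subseteq> C n" if "m \<le> n" for m n using lift_Suc_mono_le[of C, OF mono that] .
  have stable: "?h n (t, x) = ?h m (t, x)" if "x \<in> C m" "m \<le> n" for m n t x
    using that(2)
  proof (induction rule: dec_induct)
    case (step k)
    have "x \<in> C k" using mono'[OF step(1)] that(1) by blast
    from \<open>\<And>x n t. x \<in> C n \<Longrightarrow> ?h (Suc n) (t, x) = ?h n (t, x)\<close>[OF this] step show ?case by simp
  qed simp
  define H where "H z = ?h (LEAST n. snd z \<in> C n) z" for z
  have H: "H (t, x) = ?h n (t, x)" if "x \<in> C n" for n t x
    unfolding H_def using stable[OF LeastI[of "\<lambda>n. x \<in> C n", OF that] Least_le[of "\<lambda>n. x \<in> C n", OF that]]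
    by simp
  have "continuous_map (top_of_set (?I \<times> ?S)) (top_of_set ?S) H"
  proof (rule pasting_lemma[where I = "{(U, n). openin (top_of_set ?S) U \<and> U \<subseteq> C n}"
        and T = "\<lambda>(U, n). ?I \<times> U" and f = "\<lambda>(U, n). ?h n"])
    fix i assume i: "i \<in> {(U, n). openin (top_of_set ?S) U \<and> U \<subseteq> C n}"
    obtain U n where Un: "i = (U, n)" by (cases i)
    with i have U: "openin (top_of_set ?S) U" "U \<subseteq> C n" by auto
    show "openin (top_of_set (?I \<times> ?S)) (case i of (U, n) \<Rightarrow> ?I \<times> U)"
      using U by (simp add: Un openin_Times)
    have IU: "?I \<times> ?S \<inter> ?I \<times> U = ?I \<times> U" using openin_imp_subset[OF U(1)] by blast
    have "continuous_on (?I \<times> U) (?h n)"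
      by (rule continuous_on_subset[OF cont_h[of n]]) (use U in auto)
    moreover have "?h n ` (?I \<times> U) \<subseteq> ?S"
    proof (intro image_subsetI)
      fix z assume "z \<in> ?I \<times> U"
      then have "?h n (fst z, snd z) \<in> C n" using U(2) by (intro hC) auto
      then show "?h n z \<in> ?S" by auto
    qed
    ultimately have "continuous_map (top_of_set (?I \<times> U)) (top_of_set ?S) (?h n)"
      by (simp add: continuous_map_in_subtopology image_subset_iff_funcset)
    then show "continuous_map (subtopology (top_of_set (?I \<times> ?S)) (case i of (U, n) \<Rightarrow> ?I \<times> U))
        (top_of_set ?S) (case i of (U, n) \<Rightarrow> ?h n)"
      by (simp only: Un prod.case subtopology_subtopology IU)
  next
    fix i j z assume ij: "i \<in> {(U, n). openin (top_of_set ?S) U \<and> U \<subseteq> C n}"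
      "j \<in> {(U, n). openin (top_of_set ?S) U \<and> U \<subseteq> C n}"
      "z \<in> topspace (top_of_set (?I \<times> ?S)) \<inter> (case i of (U, n) \<Rightarrow> ?I \<times> U) \<inter> (case j of (U, n) \<Rightarrow> ?I \<times> U)"
    obtain U n W m t x where Un: "i = (U, n)" "j = (W, m)" "z = (t, x)" by (cases i, cases j, cases z)
    with ij have "x \<in> C n" "x \<in> C m" by auto
    then show "(case i of (U, n) \<Rightarrow> ?h n) z = (case j of (U, n) \<Rightarrow> ?h n) z"
      using H[where x = x and n = n and t = t] H[where x = x and n = m and t = t] by (simp add: Un)
  next
    fix z assume z: "z \<in> topspace (top_of_set (?I \<times> ?S))"
    obtain t x where tx: "z = (t, x)" by (cases z)
    with z have "x \<in> ?S" "t \<in> ?I" by auto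
    then obtain U n where "openin (top_of_set ?S) U" "x \<in> U" "U \<subseteq> C n" using loc by blast
    then show "\<exists>j. j \<in> {(U, n). openin (top_of_set ?S) U \<and> U \<subseteq> C n} \<and>
        z \<in> (case j of (U, n) \<Rightarrow> ?I \<times> U) \<and> H z = (case j of (U, n) \<Rightarrow> ?h n) z"
      using H[where x = x and n = n and t = t] \<open>t \<in> ?I\<close> by (intro exI[of _ "(U, n)"]) (auto simp: tx)
  qed
  moreover have "H (0, x) = x" "H (1, x) = a" if "x \<in> ?S" for x
    using that H early late by fastforce+
  ultimately have "homotopic_with (\<lambda>_. True) (top_of_set ?S) (top_of_set ?S) id (\<lambda>_. a)"
    by (subst homotopic_with) (auto intro!: exI[of _ H])
  then show ?thesis unfolding contractible_space_def by blast
qed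

context simplicial_graph
begin

text \<open>\<open>sg g v\<close> is the exponent with which the generator \<open>v\<close> shortens \<open>g\<close>, and \<open>0\<close> if there
  is none.\<close>

definition sg :: "'v gword set \<Rightarrow> 'v \<Rightarrow> int" where
  "sg g v = (if v \<in> V then - lastl g v else 0)"

lemma sg_values: "g \<in> Gs \<Longrightarrow> sg g v \<in> {-1, 0, 1}"
  using lastl_values[of g v] by (auto simp: sg_def)

lemma sg_clique: assumes "g \<in> Gs" shows "clique_supp (sg g)"
  using lastl_adj[OF assms] by (auto simp: clique_supp_def cliques_iff sg_def)

text \<open>The cube whose vertex farthest from the base point is \<open>g\<close>.\<close>

definition dcube :: "'v gword set \<Rightarrow> ('v \<Rightarrow> real) set" where
  "dcube g = {y. \<forall>v. \<exists>t\<in>{0..1}. y v = t * of_int (sg g v)}"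

lemma dcubeD: "y \<in> dcube g \<Longrightarrow> \<exists>t\<in>{0..1}. y v = t * of_int (sg g v)"
  by (simp add: dcube_def)

lemma dcube_clique: assumes "g \<in> Gs" "y \<in> dcube g" shows "clique_supp y"
proof (rule clique_supp_subset)
  show "clique_supp (sg g)" by (rule sg_clique[OF assms(1)])
  show "y v = 0" if "sg g v = 0" for v
    using dcubeD[OF assms(2), of v] that by auto
qed

lemma dcube_abs:
  assumes "g \<in> Gs" "y \<in> dcube g"
  shows "\<bar>y v\<bar> \<le> 1" "y v = \<bar>y v\<bar> * of_int (sg g v)"
proof -
  obtain t where "t \<in> {0..1}" "y v = t * of_int (sg g v)"
    using dcubeD[OF assms(2), of v] by blast
  then show "\<bar>y v\<bar> \<le> 1" "y v = \<bar>y v\<bar> * of_int (sg g v)"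
    using sg_values[OF assms(1), of v] by auto
qed

text \<open>A vertex with weight in this cube arises from \<open>g\<close> by cancelling some of its
  possible last letters. These commute, so each cancellation costs one unit of length, and
  \<open>g\<close> is the only farthest vertex.\<close>

lemma dcube_len:
  assumes g: "g \<in> Gs" and y: "y \<in> dcube g" and h: "\<sigma> g y h > 0"
  shows "len h \<le> len g" "len h = len g \<Longrightarrow> h = g"
proof -
  let ?n = "\<lambda>v. ab h v - ab g v"
  have h': "h \<in> Gs" "h = g \<cdot> elt ?n" and n: "\<And>v. v \<in> V \<Longrightarrow> \<bar>y v - of_int (?n v)\<bar> < 1"
    using h unfolding \<sigma>_pos_iff by blast+
  have nv: "?n v = - lastl g v" if v: "v \<in> V" "?n v \<noteq> 0" for v
  proof -
    \<comment> \<open>The coordinate lies between 0 and \<open>sg g v\<close>, and a non-zero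
      integer at distance less than 1 from it can only be \<open>sg g v\<close>.\<close>
    have "?n v = sg g v"
    proof -
      have n': "\<bar>\<bar>y v\<bar> * of_int (sg g v) - of_int (?n v)\<bar> < 1"
        using n[OF v(1)] dcube_abs(2)[OF g y, of v] by simp
      have "0 \<le> \<bar>y v\<bar>" "\<bar>y v\<bar> \<le> 1" using dcube_abs(1)[OF g y] by auto
      note bd = this n' v(2)
      consider "sg g v = 1" | "sg g v = 0" | "sg g v = - 1" using sg_values[OF g, of v] by auto
      then show ?thesis
      proof cases
        case 1
        then show ?thesis using bd by (simp, linarith?)
      next
        case 2
        then show ?thesis using bd by (simp, linarith?)
      next
        case 3
        then show ?thesis using bd by (simp, linarith?)
      qed
    qed
    then show ?thesis using v(1) by (simp add: sg_def)
  qed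
  show "len h \<le> len g" using len_elt_cancel(1)[OF g nv] h'(2) by simp
  show "h = g" if "len h = len g"
  proof -
    have "?n v = 0" for v
    proof (cases "v \<in> V")
      case True
      then show ?thesis using len_elt_cancel(2)[OF g nv True] h'(2) that by (metis less_irrefl)
    qed (simp add: ab_outside g h'(1))
    then have "elt ?n = elt (\<lambda>_. 0)" by (intro arg_cong[of _ _ elt]) (simp add: fun_eq_iff)
    then show ?thesis using h'(2) g by simp
  qed
qed

section \<open>Balls around the identity and the push from one to the next\<close>

definition stage :: "nat \<Rightarrow> ('v gword set \<Rightarrow> real) set" where
  "stage n = {b \<in> UC. \<forall>h. b h > 0 \<longrightarrow> len h \<le> n}"

lemma dcube_stage: "g \<in> Gs \<Longrightarrow> y \<in> dcube g \<Longrightarrow> \<sigma> g y \<in> stage (len g)"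
  using dcube_len(1) by (auto simp: stage_def intro: UC_I dcube_clique)

text \<open>Take a vertex \<open>g\<close> of positive weight and length \<open>n + 1\<close> as
  base vertex. The neighbour on the side of each non-zero coordinate also has positive weight, hence
  is not longer than \<open>g\<close>; so that direction is one that shortens
  \<open>g\<close>.\<close>

lemma stage_new:
  assumes b: "b \<in> stage (Suc n)" "b \<notin> stage n"
  obtains g y where "g \<in> Gs" "len g = Suc n" "y \<in> dcube g" "b = \<sigma> g y"
proof -
  have bU: "b \<in> UC" using b(1) by (simp add: stage_def)
  obtain g where bg: "b g > 0" "len g > n" using b bU by (auto simp: stage_def not_le)
  have lg: "len g = Suc n" using bg b(1) by (force simp: stage_def)
  obtain y where y: "g \<in> Gs" "clique_supp y" "\<And>v. \<bar>y v\<bar> < 1" "b = \<sigma> g y"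
    by (rule UC_star[OF bU bg(1)]) blast
  have "\<exists>t\<in>{0..1}. y v = t * of_int (sg g v)" for v
  proof (cases "y v = 0")
    case False
    then have v: "v \<in> V" using clique_supp_outside[OF y(2)] by blast
    define e where "e = (y v > 0)"
    have ye: "y v = \<bar>y v\<bar> * of_int (lsign e)" using False by (simp add: e_def lsign_def)
    have "b (g \<cdot> lt v e) > 0" unfolding y(4) e_def by (rule \<sigma>_neighbour_pos[where y = y, OF y(1) v False y(3)])
    then have "len (g \<cdot> lt v e) \<le> len g" using b(1) lg by (simp add: stage_def)
    then have "lastl g v = - lsign e" using len_lt(2)[OF y(1) v, of e] by force
    then have "sg g v = lsign e" using v by (simp add: sg_def)
    then show ?thesis using ye y(3)[of v] by (intro bexI[of _ "\<bar>y v\<bar>"]) simp_all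
  qed (auto intro: bexI[of _ 0])
  then have "y \<in> dcube g" by (simp add: dcube_def)
  with that y lg show ?thesis by blast
qed

text \<open>How far all shortening coordinates can be moved away from \<open>g\<close>
  simultaneously before one of them reaches absolute value 1, that is, before a face opposite to
  \<open>g\<close> is hit. For \<open>g\<close> of positive length the minimum is over a non-empty
  set.\<close>

definition slack :: "'v gword set \<Rightarrow> ('v \<Rightarrow> real) \<Rightarrow> real" where
  "slack g y = Min ((\<lambda>v. 1 - \<bar>y v\<bar>) ` {v \<in> V. sg g v \<noteq> 0})"

definition pushd :: "'v gword set \<Rightarrow> real \<Rightarrow> ('v \<Rightarrow> real) \<Rightarrow> 'v \<Rightarrow> real" where
  "pushd g s y v = y v + s * slack g y * of_int (sg g v)"

lemma sg_nonempty:
  assumes "g \<in> Gs" "len g = Suc n" shows "finite {v \<in> V. sg g v \<noteq> 0}" "{v \<in> V. sg g v \<noteq> 0} \<noteq> {}"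
  using len_pos_lastl[OF assms(1)] assms(2) finite_V by (auto simp: sg_def)

lemma slack_bounds:
  assumes g: "g \<in> Gs" "len g = Suc n" and y: "y \<in> dcube g"
  shows "0 \<le> slack g y" "v \<in> V \<Longrightarrow> sg g v \<noteq> 0 \<Longrightarrow> slack g y \<le> 1 - \<bar>y v\<bar>"
    "\<exists>v\<in>V. sg g v \<noteq> 0 \<and> slack g y = 1 - \<bar>y v\<bar>"
proof -
  let ?A = "(\<lambda>v. 1 - \<bar>y v\<bar>) ` {v \<in> V. sg g v \<noteq> 0}"
  have A: "finite ?A" "?A \<noteq> {}" using sg_nonempty[OF g] by auto
  have "slack g y \<in> ?A" unfolding slack_def by (rule Min_in[OF A])
  then show "\<exists>v\<in>V. sg g v \<noteq> 0 \<and> slack g y = 1 - \<bar>y v\<bar>" by auto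
  then show "0 \<le> slack g y" using dcube_abs(1)[OF g(1) y] by auto
  show "slack g y \<le> 1 - \<bar>y v\<bar>" if "v \<in> V" "sg g v \<noteq> 0"
    unfolding slack_def by (rule Min_le[OF A(1)]) (use that in auto)
qed

lemma pushd_dcube:
  assumes g: "g \<in> Gs" "len g = Suc n" and y: "y \<in> dcube g" and s: "s \<in> {0..1}"
  shows "pushd g s y \<in> dcube g"
proof -
  have "\<exists>t\<in>{0..1}. pushd g s y v = t * of_int (sg g v)" for v
  proof (cases "sg g v = 0")
    case True
    then show ?thesis using dcube_abs(2)[OF g(1) y, of v] by (intro bexI[of _ 0]) (auto simp: pushd_def)
  next
    case False
    then have v: "v \<in> V" by (simp add: sg_def split: if_splits)
    have "s * slack g y \<le> 1 * slack g y"
      using slack_bounds(1)[OF g y] s by (intro mult_right_mono) auto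
    then have "\<bar>y v\<bar> + s * slack g y \<in> {0..1}"
      using slack_bounds(1)[OF g y] slack_bounds(2)[OF g y v False] s by auto
    moreover have "pushd g s y v = (\<bar>y v\<bar> + s * slack g y) * of_int (sg g v)"
      using dcube_abs(2)[OF g(1) y, of v] by (simp add: pushd_def distrib_right)
    ultimately show ?thesis by blast
  qed
  then show ?thesis by (simp add: dcube_def)
qed

lemma pushd_zero: "pushd g 0 y = y" by (simp add: pushd_def fun_eq_iff)

text \<open>No weight at \<open>g\<close> means that some coordinate has absolute value 1, so there
  is no room left to push. Thus the push is trivial on the faces where this cube meets
  others.\<close>

lemma slack_zero:
  assumes g: "g \<in> Gs" "len g = Suc n" and y: "y \<in> dcube g" and 0: "\<not> \<sigma> g y g > 0"
  shows "pushd g s y = y"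
proof -
  obtain v where v: "v \<in> V" "\<not> \<bar>y v\<bar> < 1" using 0 g(1) by (auto simp: \<sigma>_pos_iff)
  then have 1: "\<bar>y v\<bar> = 1" using dcube_abs(1)[OF g(1) y, of v] by simp
  then have "sg g v \<noteq> 0" using dcube_abs(2)[OF g(1) y, of v] by auto
  then have "slack g y = 0" using slack_bounds(1)[OF g y] slack_bounds(2)[OF g y v(1)] 1 by simp
  then show ?thesis by (simp add: pushd_def fun_eq_iff)
qed

text \<open>The coordinate that attains the minimum arrives at absolute value 1, which removes the
  weight of the farthest vertex.\<close>

lemma pushd_one:
  assumes g: "g \<in> Gs" "len g = Suc n" and y: "y \<in> dcube g"
  shows "\<not> \<sigma> g (pushd g 1 y) g > 0"
proof -
  obtain v where v: "v \<in> V" "sg g v \<noteq> 0" "slack g y = 1 - \<bar>y v\<bar>" using slack_bounds(3)[OF g y] by blast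
  have "pushd g 1 y v = (\<bar>y v\<bar> + slack g y) * of_int (sg g v)"
    using dcube_abs(2)[OF g(1) y, of v] by (simp add: pushd_def distrib_right)
  then have "\<bar>pushd g 1 y v\<bar> = 1" using v(2,3) sg_values[OF g(1), of v] by auto
  then show ?thesis using v(1) g(1) by (auto simp: \<sigma>_pos_iff intro!: bexI[of _ v])
qed

definition retract :: "nat \<Rightarrow> real \<times> ('v gword set \<Rightarrow> real) \<Rightarrow> 'v gword set \<Rightarrow> real" where
  "retract n z = (if \<exists>g y. g \<in> Gs \<and> len g = Suc n \<and> y \<in> dcube g \<and> snd z = \<sigma> g y
    then SOME b. \<exists>g y. g \<in> Gs \<and> len g = Suc n \<and> y \<in> dcube g \<and> snd z = \<sigma> g y \<and>
      b = \<sigma> g (pushd g (fst z) y)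
    else snd z)"

text \<open>Independence of the chosen cube. If \<open>g\<close> has weight, it is the only farthest
  vertex, so the other description uses the same \<open>g\<close> and, by \<open>coord\<close>, the
  same coordinates. Otherwise neither farthest vertex has weight, and both pushes are
  trivial.\<close>

lemma retract_\<sigma>:
  assumes g: "g \<in> Gs" "len g = Suc n" and y: "y \<in> dcube g"
  shows "retract n (s, \<sigma> g y) = \<sigma> g (pushd g s y)"
proof -
  have unique: "\<sigma> g' (pushd g' s y') = \<sigma> g (pushd g s y)"
    if g': "g' \<in> Gs" "len g' = Suc n" and y': "y' \<in> dcube g'" and eq: "\<sigma> g y = \<sigma> g' y'" for g' y'
  proof (cases "\<sigma> g y g > 0")
    case True
    then have "\<sigma> g' y' g > 0" using eq by simp
    then have gg: "g' = g" using dcube_len(2)[OF g'(1) y', of g] g(2) g'(2) by simp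
    have bd: "\<bar>y v\<bar> < 1" "\<bar>y' v\<bar> < 1" if "v \<in> V" for v
      using True \<open>\<sigma> g' y' g > 0\<close> that unfolding gg by (auto simp: \<sigma>_pos_iff)
    have "y' = y"
    proof
      fix v
      show "y' v = y v"
      proof (cases "v \<in> V")
        case True
        have "coord g (\<sigma> g y) v = y v" "coord g (\<sigma> g y') v = y' v"
          using bd by (auto intro!: coord_\<sigma> g(1) True)
        then show ?thesis using eq gg by simp
      next
        case False
        then show ?thesis
          using clique_supp_outside dcube_clique[OF g(1) y] dcube_clique[OF g'(1) y'] by metis
      qed
    qed
    then show ?thesis using gg by simp
  next
    case False
    have "\<not> \<sigma> g' y' g' > 0"
    proof
      assume *: "\<sigma> g' y' g' > 0"
      then have "\<sigma> g y g' > 0" using eq by simp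
      then have "g' = g" using dcube_len(2)[OF g(1) y, of g'] g(2) g'(2) by simp
      then show False using * False eq by simp
    qed
    then show ?thesis using slack_zero[OF g y False] slack_zero[OF g' y'] eq by simp
  qed
  let ?P = "\<lambda>b. \<exists>g' y'. g' \<in> Gs \<and> len g' = Suc n \<and> y' \<in> dcube g' \<and> \<sigma> g y = \<sigma> g' y' \<and>
      b = \<sigma> g' (pushd g' s y')"
  have "?P (\<sigma> g (pushd g s y))" using g y by blast
  then have "?P (Eps ?P)" by (rule someI[of ?P])
  then have "Eps ?P = \<sigma> g (pushd g s y)" using unique by auto
  moreover have "\<exists>g' y'. g' \<in> Gs \<and> len g' = Suc n \<and> y' \<in> dcube g' \<and> \<sigma> g y = \<sigma> g' y'"
    using g y by blast
  ultimately show ?thesis unfolding retract_def fst_conv snd_conv by (simp only: if_True)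
qed

lemma retract_stage: assumes "b \<in> stage n" shows "retract n (s, b) = b"
proof (cases "\<exists>g y. g \<in> Gs \<and> len g = Suc n \<and> y \<in> dcube g \<and> b = \<sigma> g y")
  case True
  then obtain g y where gy: "g \<in> Gs" "len g = Suc n" "y \<in> dcube g" "b = \<sigma> g y" by blast
  have "\<not> \<sigma> g y g > 0"
  proof
    assume "\<sigma> g y g > 0"
    then have "len g \<le> n" using assms gy(4) by (simp add: stage_def)
    then show False using gy(2) by simp
  qed
  from slack_zero[OF gy(1-3) this] show ?thesis using retract_\<sigma>[OF gy(1-3)] gy(4) by simp
next
  case False
  then show ?thesis unfolding retract_def fst_conv snd_conv by (rule if_not_P)
qed

lemma retract_cases:
  assumes "b \<in> stage (Suc n)"
  obtains "b \<in> stage n" | g y where "g \<in> Gs" "len g = Suc n" "y \<in> dcube g" "b = \<sigma> g y"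
  using stage_new[OF assms] by metis

section \<open>Continuity of the retractions\<close>

lemma compact_dcube: "compact (dcube g)"
proof -
  let ?K = "\<lambda>v. (\<lambda>t. t * of_int (sg g v)) ` {0..1::real}"
  \<comment> \<open>The cube is a product over the whole vertex type, which may be infinite; the
    factors outside \<open>V\<close> are single points.\<close>
  have "compactin (product_topology (\<lambda>_::'v. euclideanreal) UNIV) (PiE UNIV ?K)"
    unfolding compactin_PiE
    by (auto intro!: compact_continuous_image continuous_intros)
  moreover have "PiE UNIV ?K = dcube g" by (auto simp: dcube_def PiE_def Pi_def image_iff)
  ultimately show ?thesis by (simp add: euclidean_product_topology)
qed

lemma continuous_on_pushd:
  assumes g: "g \<in> Gs" "len g = Suc n"
  shows "continuous_on S (\<lambda>z. \<sigma> g (pushd g (fst z) (snd z)))"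
proof (rule continuous_on_compose2[OF continuous_on_\<sigma>[of UNIV]])
  have c: "continuous_on S (\<lambda>z. snd z v)" for v :: 'v and S :: "(real \<times> ('v \<Rightarrow> real)) set"
    by (rule continuous_on_compose2[OF continuous_on_product_coordinates[of v] continuous_on_snd]) auto
  show "continuous_on S (\<lambda>z. pushd g (fst z) (snd z))"
  proof (rule continuous_on_coordinatewise_then_product)
    show "continuous_on S (\<lambda>z. pushd g (fst z) (snd z) v)" for v
      unfolding pushd_def slack_def
      by (intro continuous_intros continuous_on_Min sg_nonempty[OF g] c)
  qed
qed simp

lemma stage_closed: "closedin (top_of_set (stage (Suc n))) (stage n)"
proof -
  have cl: "closed {b::'v gword set \<Rightarrow> real. b h \<le> 0}" for h
  proof -
    have "closed ((\<lambda>b::'v gword set \<Rightarrow> real. b h) -` {..0})"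
      by (intro closed_vimage continuous_on_product_coordinates) auto
    moreover have "(\<lambda>b::'v gword set \<Rightarrow> real. b h) -` {..0} = {b. b h \<le> 0}" by auto
    ultimately show ?thesis by simp
  qed
  have eq: "stage n = stage (Suc n) \<inter> (\<Inter>h\<in>{h. len h > n}. {b. b h \<le> 0})"
  proof (intro equalityI subsetI)
    fix b assume "b \<in> stage (Suc n) \<inter> (\<Inter>h\<in>{h. len h > n}. {b. b h \<le> 0})"
    then have b: "b \<in> UC" "\<And>h. len h > n \<Longrightarrow> b h \<le> 0" by (auto simp: stage_def)
    have "len h \<le> n" if "b h > 0" for h using b(2)[of h] that by linarith
    with b(1) show "b \<in> stage n" by (simp add: stage_def)
  next
    fix b assume "b \<in> stage n"
    then have b: "b \<in> UC" "\<And>h. b h > 0 \<Longrightarrow> len h \<le> n" by (auto simp: stage_def)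
    have "b h \<le> 0" if "len h > n" for h using b(2)[of h] that by linarith
    with b show "b \<in> stage (Suc n) \<inter> (\<Inter>h\<in>{h. len h > n}. {b. b h \<le> 0})"
      by (auto simp: stage_def intro: le_SucI)
  qed
  show ?thesis by (subst eq) (intro closedin_closed_Int closed_INT ballI cl)
qed

lemma continuous_on_retract: "continuous_on ({0..1} \<times> stage (Suc n)) (retract n)"
proof -
  let ?I = "{0..1::real}"
  define A where "A = {g \<in> Gs. len g = Suc n}"
  have finA: "finite A" using finite_len[of "Suc n"] by (rule finite_subset[rotated]) (auto simp: A_def)
  define D where "D g = \<sigma> g ` dcube g" for g
  have D: "D g \<subseteq> stage (Suc n)" if "g \<in> A" for g
    using that dcube_stage[of g] by (auto simp: D_def A_def)
  \<comment> \<open>A finite closed cover: \<open>None\<close> stands for the smaller ball,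
    \<open>Some g\<close> for the cube with farthest vertex \<open>g\<close>. Finiteness comes from
    that of balls in the group.\<close>
  define T where "T i = (case i of None \<Rightarrow> ?I \<times> stage n | Some g \<Rightarrow> ?I \<times> D g)" for i
  let ?X = "top_of_set (?I \<times> stage (Suc n))"
  have "continuous_map ?X euclidean (retract n)"
  proof (rule pasting_lemma_closed[where I = "insert None (Some ` A)" and T = T and f = "\<lambda>_. retract n"])
    show "finite (insert None (Some ` A))" using finA by simp
  next
    fix i assume i: "i \<in> insert None (Some ` A)"
    have mono: "stage n \<subseteq> stage (Suc n)" by (auto simp: stage_def intro: le_SucI)
    show "closedin ?X (T i)"
    proof (cases i)
      case None
      then show ?thesis using stage_closed by (simp add: T_def closedin_Times)
    next
      case (Some g)
      with i have g: "g \<in> A" by auto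
      have "compact (D g)" unfolding D_def by (rule compact_continuous_image[OF continuous_on_\<sigma> compact_dcube])
      then have "closedin (top_of_set (stage (Suc n))) (D g)"
        using D[OF g]
        by (intro compactin_imp_closedin Hausdorff_space_subtopology Hausdorff_space_euclidean_fun)
          (simp add: compactin_subtopology)
      then show ?thesis using Some by (simp add: T_def closedin_Times)
    qed
    show "continuous_map (subtopology ?X (T i)) euclidean (retract n)"
    proof (cases i)
      case None
      have "continuous_on (?I \<times> stage n) (retract n)"
        by (rule continuous_on_eq[OF continuous_on_snd[OF continuous_on_id]]) (auto simp: retract_stage)
      then show ?thesis
        using None by (auto simp: T_def subtopology_subtopology intro: continuous_on_subset)
    next
      case (Some g)
      with i have g: "g \<in> Gs" "len g = Suc n" "g \<in> A" by (auto simp: A_def)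
      let ?q = "\<lambda>z. (fst z, \<sigma> g (snd z))"
      have q: "continuous_on (?I \<times> dcube g) ?q"
        by (intro continuous_intros continuous_on_compose2[OF continuous_on_\<sigma>[of UNIV]]) auto
      have img: "?q ` (?I \<times> dcube g) = ?I \<times> D g" by (force simp: D_def)
      \<comment> \<open>Different coordinates may describe the same point, so continuity on the
        image of the cube descends along a quotient map, obtained from compactness.\<close>
      have quot: "quotient_map (top_of_set (?I \<times> dcube g)) (top_of_set (?I \<times> D g)) ?q"
      proof (rule continuous_imp_quotient_map)
        show "continuous_map (top_of_set (?I \<times> dcube g)) (top_of_set (?I \<times> D g)) ?q"
          using q img by (auto simp: continuous_map_in_subtopology)
        show "compact_space (top_of_set (?I \<times> dcube g))"
          by (simp add: compact_space_subtopology compact_Times compact_dcube)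
        show "Hausdorff_space (top_of_set (?I \<times> D g))"
          unfolding prod_topology_subtopology_eu[symmetric] Hausdorff_space_prod_topology
          by (intro disjI2 conjI Hausdorff_space_subtopology Hausdorff_space_euclidean
              Hausdorff_space_euclidean_fun)
      qed (use img in simp)
      have "continuous_on (?I \<times> dcube g) (retract n \<circ> ?q)"
        by (rule continuous_on_eq[OF continuous_on_pushd[OF g(1,2)]]) (auto simp: retract_\<sigma>[OF g(1,2)])
      then have "continuous_map (top_of_set (?I \<times> D g)) euclidean (retract n)"
        by (intro continuous_compose_quotient_map[OF quot]) simp
      then show ?thesis
        using Some D[OF g(3)] by (auto simp: T_def subtopology_subtopology intro: continuous_on_subset)
    qed
  next
    fix z assume z: "z \<in> topspace ?X"
    then obtain s b where sb: "z = (s, b)" "s \<in> ?I" "b \<in> stage (Suc n)" by auto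
    from sb(3) show "\<exists>j. j \<in> insert None (Some ` A) \<and> z \<in> T j \<and> retract n z = retract n z"
    proof (cases rule: retract_cases)
      case 1
      then show ?thesis using sb by (intro exI[of _ None]) (simp add: T_def)
    next
      case (2 g y)
      then show ?thesis using sb by (intro exI[of _ "Some g"]) (simp add: T_def A_def D_def)
    qed
  qed auto
  then show ?thesis by simp
qed

lemma stage_zero: "stage 0 = {\<sigma> \<e> (\<lambda>_. 0)}"
proof (intro equalityI subsetI)
  fix b assume b: "b \<in> stage 0"
  then have bU: "b \<in> UC" by (simp add: stage_def)
  obtain g where g: "g \<in> Gs" "b g > 0" by (rule UC_vertex[OF bU])
  then have g1: "g = \<e>" using b len_zero by (simp add: stage_def)
  obtain y where y: "g \<in> Gs" "clique_supp y" "\<And>v. \<bar>y v\<bar> < 1" "b = \<sigma> g y"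
    by (rule UC_star[OF bU g(2)]) blast
  have "y v = 0" for v
  proof (rule ccontr)
    assume 0: "y v \<noteq> 0"
    then have v: "v \<in> V" using clique_supp_outside[OF y(2)] by blast
    define e where "e = (y v > 0)"
    have "b (g \<cdot> lt v e) > 0" unfolding y(4) e_def by (rule \<sigma>_neighbour_pos[where y = y, OF y(1) v 0 y(3)])
    then have "len (g \<cdot> lt v e) = 0" using b by (simp add: stage_def)
    then have "lastl g v = - lsign e" using len_lt(2)[OF y(1) v, of e] by force
    then have "Suc (len (g \<cdot> lt v e)) = len g" by (rule len_lt(1)[OF y(1) v])
    then show False using g1 by simp
  qed
  then have "y = (\<lambda>_. 0)" by (simp add: fun_eq_iff)
  with y(4) g1 show "b \<in> {\<sigma> \<e> (\<lambda>_. 0)}" by simp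
next
  fix b assume "b \<in> {\<sigma> \<e> (\<lambda>_. 0)}"
  then have b: "b = \<sigma> \<e> (\<lambda>_. 0)" by simp
  have "(\<lambda>_. 0) \<in> dcube \<e>" by (auto simp: dcube_def intro!: bexI[of _ 0])
  from dcube_stage[OF G.one_closed this] show "b \<in> stage 0" by (simp add: b)
qed

text \<open>The vertices with weight at a point of the star of \<open>g\<close> differ from
  \<open>g\<close> by exponents in \<open>{-1, 0, 1}\<close>, hence by at most \<open>card V\<close>
  letters. This bounds the star uniformly and provides the neighbourhoods for
  \<open>contractible_telescope\<close>.\<close>

lemma UC_stages: "UC = (\<Union>n. stage n)"
  and star_stage: "b \<in> UC \<Longrightarrow> b g > 0 \<Longrightarrow> b \<in> stage (len g + card V)"
proof -
  show *: "b \<in> stage (len g + card V)" if b: "b \<in> UC" "b g > 0" for b g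
  proof -
    obtain y where y: "g \<in> Gs" "clique_supp y" "\<And>v. \<bar>y v\<bar> < 1" "b = \<sigma> g y"
      by (rule UC_star[OF b]) blast
    have "len h \<le> len g + card V" if h: "b h > 0" for h
    proof -
      let ?n = "\<lambda>v. ab h v - ab g v"
      have h': "h \<in> Gs" "h = g \<cdot> elt ?n" and n: "\<And>v. v \<in> V \<Longrightarrow> \<bar>y v - of_int (?n v)\<bar> < 1"
        using h unfolding y(4) \<sigma>_pos_iff by blast+
      have "?n v \<in> {-1, 0, 1}" for v
      proof (cases "v \<in> V")
        case True
        have "\<bar>real_of_int (?n v)\<bar> < 2" using n[OF True] y(3)[of v] by linarith
        then have "\<bar>?n v\<bar> < 2" by linarith
        then show ?thesis by auto
      qed (simp add: ab_outside y(1) h'(1))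
      from len_elt_le[OF y(1), of ?n, OF this] h'(2) show ?thesis by simp
    qed
    then show ?thesis using b(1) by (simp add: stage_def)
  qed
  show "UC = (\<Union>n. stage n)"
  proof (intro equalityI subsetI)
    fix b assume b: "b \<in> UC"
    obtain g where "b g > 0" by (rule UC_vertex[OF b])
    with *[OF b] show "b \<in> (\<Union>n. stage n)" by blast
  qed (auto simp: stage_def)
qed

theorem contractible_UC: "contractible_space (top_of_set UC)"
  unfolding UC_stages
proof (rule contractible_telescope[where C = stage and r = retract, OF stage_zero])
  fix n
  show "stage n \<subseteq> stage (Suc n)" by (auto simp: stage_def intro: le_SucI)
  show "continuous_on ({0..1} \<times> stage (Suc n)) (retract n)" by (rule continuous_on_retract)
next
  fix n and t :: real and b assume t: "t \<in> {0..1}" and b: "b \<in> stage (Suc n)"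
  from b show "retract n (t, b) \<in> stage (Suc n)"
  proof (cases rule: retract_cases)
    case 1
    then show ?thesis using b by (simp add: retract_stage)
  next
    case (2 g y)
    then show ?thesis using dcube_stage[OF 2(1) pushd_dcube[OF 2(1-3) t]] by (simp add: retract_\<sigma>)
  qed
next
  fix n b assume b: "b \<in> stage (Suc n)"
  from b show "retract n (0, b) = b"
    by (cases rule: retract_cases) (simp_all add: retract_stage retract_\<sigma> pushd_zero)
  from b show "retract n (1, b) \<in> stage n"
  proof (cases rule: retract_cases)
    case 1
    then show ?thesis by (simp add: retract_stage)
  next
    case (2 g y)
    have d: "pushd g 1 y \<in> dcube g" by (rule pushd_dcube[OF 2(1-3)]) simp
    have "len h \<le> n" if "\<sigma> g (pushd g 1 y) h > 0" for h
    proof -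
      have "len h \<le> Suc n" using dcube_len(1)[OF 2(1) d that] 2(2) by simp
      moreover have "len h \<noteq> Suc n"
        using dcube_len(2)[OF 2(1) d that] pushd_one[OF 2(1-3)] that 2(2) by auto
      ultimately show ?thesis by simp
    qed
    then show ?thesis using 2 UC_I[OF 2(1) dcube_clique[OF 2(1) d]] by (simp add: retract_\<sigma> stage_def)
  qed
next
  show "retract n (t, b) = b" if "b \<in> stage n" for n t b using that by (rule retract_stage)
next
  fix b assume "b \<in> (\<Union>n. stage n)"
  then have b: "b \<in> UC" by (simp add: UC_stages)
  obtain g where g: "b g > 0" by (rule UC_vertex[OF b])
  have "{b \<in> UC. b g > 0} \<subseteq> stage (len g + card V)" using star_stage by blast
  then show "\<exists>U n. openin (top_of_set (\<Union>n. stage n)) U \<and> b \<in> U \<and> U \<subseteq> stage n"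
    using openin_star[of g] b g unfolding UC_stages[symmetric] by blast
qed

end

section \<open>Comparison with the cell complex\<close>

lemma glue_class_self: "x \<in> glue_class r x" by (simp add: glue_class_def)

lemma glue_class_eq: assumes "(x, y) \<in> r" shows "glue_class r x = glue_class r y"
proof -
  have "(x, y) \<in> (r \<union> r\<inverse>)\<^sup>*" "(y, x) \<in> (r \<union> r\<inverse>)\<^sup>*" using assms by auto
  then show ?thesis unfolding glue_class_def by (auto intro: rtrancl_trans)
qed

lemma glue_class_invariant:
  assumes "\<And>a b. (a, b) \<in> r \<Longrightarrow> F a = F b" "y \<in> glue_class r x" shows "F y = F x"
proof -
  have "(x, y) \<in> (r \<union> r\<inverse>)\<^sup>*" using assms(2) by (simp add: glue_class_def)
  then show ?thesis by (induction rule: rtrancl_induct) (auto dest: assms(1))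
qed

definition glue_lift :: "('a \<Rightarrow> 'b) \<Rightarrow> 'a set \<Rightarrow> 'b" where
  "glue_lift F A = F (SOME x. x \<in> A)"

lemma glue_lift:
  assumes "\<And>a b. (a, b) \<in> r \<Longrightarrow> F a = F b" shows "glue_lift F (glue_class r x) = F x"
proof -
  have "(SOME y. y \<in> glue_class r x) \<in> glue_class r x"
    by (rule someI[of "\<lambda>y. y \<in> glue_class r x", OF glue_class_self])
  from glue_class_invariant[of r F, OF assms this] show ?thesis by (simp add: glue_lift_def)
qed

lemma continuous_map_glue_lift:
  assumes "\<And>a b. (a, b) \<in> r \<Longrightarrow> F a = F b" "continuous_map X Y F"
  shows "continuous_map (quotient_topology X r) Y (glue_lift F)"
proof (rule continuous_compose_quotient_map[OF quotient_map_glue_class])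
  show "continuous_map X Y (glue_lift F \<circ> glue_class r)"
    using assms(2) by (rule continuous_map_eq) (simp add: glue_lift[OF assms(1)])
qed

lemma compact_space_quotient_topology:
  assumes "compact_space X" shows "compact_space (quotient_topology X r)"
  using assms quotient_map_glue_class image_compactin quotient_imp_continuous_map
    quotient_imp_surjective_map
  unfolding compact_space_def by metis

context simplicial_graph
begin

section \<open>The cell complex inside the torus with one circle for each vertex\<close>

definition cube_cexp :: "'v set \<Rightarrow> ('v \<Rightarrow> real) \<Rightarrow> 'v \<Rightarrow> complex" where
  "cube_cexp Q x v = (if v \<in> Q then cis (2 * pi * x v) else 1)"

lemma cube_cexp_opposite: "(x, y) \<in> opposite_faces Q \<Longrightarrow> cube_cexp Q x = cube_cexp Q y"
  by (auto simp: opposite_faces_def cube_cexp_def fun_eq_iff)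

definition sum_cexp :: "'v torus_sum_point \<Rightarrow> 'v \<Rightarrow> complex" where
  "sum_cexp = (\<lambda>(Q, \<kappa>). glue_lift (cube_cexp Q) \<kappa>)"

lemma sum_cexp_eq: "sum_cexp (Q, glue_class (opposite_faces Q) x) = cube_cexp Q x"
  by (simp add: sum_cexp_def glue_lift[OF cube_cexp_opposite])

lemma sum_cexp_identification: "(s, t) \<in> torus_identification V E \<Longrightarrow> sum_cexp s = sum_cexp t"
  by (auto simp: torus_identification_def subtorus_point_def sum_cexp_eq cube_cexp_def fun_eq_iff)

definition cplx_cexp :: "'v torus_sum_point set \<Rightarrow> 'v \<Rightarrow> complex" where
  "cplx_cexp = glue_lift sum_cexp"

definition cplx_point :: "'v set \<Rightarrow> ('v \<Rightarrow> real) \<Rightarrow> 'v torus_sum_point set" where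
  "cplx_point Q x = glue_class (torus_identification V E) (Q, glue_class (opposite_faces Q) x)"

lemma cplx_cexp_point: "cplx_cexp (cplx_point Q x) = cube_cexp Q x"
  by (simp add: cplx_cexp_def cplx_point_def glue_lift[OF sum_cexp_identification] sum_cexp_eq)

lemma topspace_graph_complex:
  "topspace (graph_complex V E) = {cplx_point Q x | Q x. Q \<in> cliques V E \<and> x \<in> topspace (unit_cube Q)}"
  by (auto simp: graph_complex_def topspace_quotient_topology torus_def cplx_point_def image_iff) blast+

lemma continuous_cube_cexp: "continuous_map (unit_cube Q) euclidean (cube_cexp Q)"
proof -
  have "continuous_map (unit_cube Q) euclidean (\<lambda>x. cube_cexp Q x v)" for v
  proof (cases "v \<in> Q")
    case True
    have "continuous_map (unit_cube Q) (top_of_set {0..1}) (\<lambda>x. x v)"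
      unfolding unit_cube_def by (rule continuous_map_product_projection[OF True])
    then have "continuous_map (unit_cube Q) euclideanreal (\<lambda>x. x v)"
      by (simp add: continuous_map_in_subtopology)
    moreover have "continuous_map euclideanreal euclidean (\<lambda>t. cis (2 * pi * t))"
      by (auto intro!: continuous_intros)
    ultimately have "continuous_map (unit_cube Q) euclidean ((\<lambda>t. cis (2 * pi * t)) \<circ> (\<lambda>x. x v))"
      by (rule continuous_map_compose)
    then show ?thesis using True by (simp add: cube_cexp_def o_def)
  qed (simp add: cube_cexp_def)
  then show ?thesis
    by (simp add: continuous_map_componentwise_UNIV flip: euclidean_product_topology)
qed

lemma finite_cliques: "finite (cliques V E)"
  by (rule finite_subset[of _ "Pow V"]) (auto simp: cliques_def finite_V)

lemma continuous_cplx_cexp: "continuous_map (graph_complex V E) euclidean cplx_cexp"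
  unfolding graph_complex_def cplx_cexp_def
proof (rule continuous_map_glue_lift[OF sum_cexp_identification])
  have "continuous_map (torus Q) euclidean (\<lambda>\<kappa>. sum_cexp (Q, \<kappa>))" for Q
    unfolding torus_def sum_cexp_def prod.case
    by (rule continuous_map_glue_lift[OF cube_cexp_opposite continuous_cube_cexp])
  then have *: "openin (torus Q) {\<kappa> \<in> topspace (torus Q). sum_cexp (Q, \<kappa>) \<in> U}"
    if "openin euclidean U" for U Q
    using that by (rule openin_continuous_map_preimage)
  show "continuous_map (sum_topology torus (cliques V E)) euclidean sum_cexp"
    unfolding continuous_map_def openin_sum_topology
  proof (intro conjI allI impI ballI)
    fix U :: "('v \<Rightarrow> complex) set" and Q assume U: "openin euclidean U" and Q: "Q \<in> cliques V E"
    have "{\<kappa>. (Q, \<kappa>) \<in> {x \<in> topspace (sum_topology torus (cliques V E)). sum_cexp x \<in> U}} =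
        {\<kappa> \<in> topspace (torus Q). sum_cexp (Q, \<kappa>) \<in> U}" using Q by auto
    then show "openin (torus Q) {\<kappa>. (Q, \<kappa>) \<in> {x \<in> topspace (sum_topology torus (cliques V E)). sum_cexp x \<in> U}}"
      using *[OF U, of Q] by simp
  qed auto
qed

lemma compact_graph_complex: "compact_space (graph_complex V E)"
  unfolding graph_complex_def
proof (rule compact_space_quotient_topology)
  let ?S = "sum_topology torus (cliques V E)"
  have "compact_space (unit_cube Q)" for Q :: "'v set"
    unfolding unit_cube_def compact_space_product_topology
    by (simp add: compact_space_subtopology)
  then have "compact_space (torus Q)" for Q :: "'v set"
    unfolding torus_def by (rule compact_space_quotient_topology)
  then have "compactin ?S (Pair Q ` topspace (torus Q))" if "Q \<in> cliques V E" for Q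
    using image_compactin continuous_map_component_injection[OF that]
    unfolding compact_space_def by blast
  then have "compactin ?S (\<Union>Q\<in>cliques V E. Pair Q ` topspace (torus Q))"
    using finite_cliques by (intro compactin_Union) auto
  moreover have "(\<Union>Q\<in>cliques V E. Pair Q ` topspace (torus Q)) = topspace ?S" by auto
  ultimately show "compact_space ?S" by (simp add: compact_space_def)
qed

lemma cis_inject:
  assumes "cis (2 * pi * a) = cis (2 * pi * b)" "0 \<le> a" "a < 1" "0 \<le> b" "b < 1"
  shows "a = b"
proof -
  \<comment> \<open>Reflection and shift take \<open>[0, 1)\<close> to the half-open range from
    \<open>-pi\<close> to \<open>pi\<close> of \<open>Arg\<close>, with \<open>pi\<close>
    included.\<close>
  have "Arg (cis (pi - 2 * pi * t)) = pi - 2 * pi * t" if "0 \<le> t" "t < 1" for t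
    using that by (intro Arg_cis) auto
  moreover have "cis (pi - 2 * pi * a) = cis (pi - 2 * pi * b)"
    using assms(1) by (simp flip: cis_divide)
  ultimately have "pi - 2 * pi * a = pi - 2 * pi * b" using assms by metis
  then show ?thesis by simp
qed

lemma cplx_point_normalize:
  assumes x: "x \<in> topspace (unit_cube Q)" and Q: "Q \<in> cliques V E"
  obtains y where "y \<in> topspace (unit_cube Q)" "\<And>v. v \<in> Q \<Longrightarrow> y v < 1" "cplx_point Q x = cplx_point Q y"
proof -
  define f where "f S = (\<lambda>v. if v \<in> S then 0 else x v)" for S
  have f: "f S \<in> topspace (unit_cube Q)" if "S \<subseteq> Q" for S
    using x that by (auto simp: f_def unit_cube_def PiE_iff extensional_def)
  let ?S = "{v \<in> Q. x v = 1}"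
  have "finite Q" using Q finite_V finite_subset by (auto simp: cliques_def)
  \<comment> \<open>A generating identification of opposite faces changes one coordinate, so the
    coordinates equal to 1 are replaced by 0 one at a time.\<close>
  have eq: "glue_class (opposite_faces Q) (f S) = glue_class (opposite_faces Q) x"
    if "finite S" "S \<subseteq> ?S" for S
    using that
  proof (induction S rule: finite_induct)
    case empty
    then show ?case by (simp add: f_def)
  next
    case (insert w S)
    have "f S = (f (insert w S))(w := 1)" using insert by (auto simp: f_def fun_eq_iff)
    moreover have "f (insert w S) w = 0" by (simp add: f_def)
    moreover have "f (insert w S) \<in> topspace (unit_cube Q)" using insert.prems by (intro f) auto
    ultimately have "(f (insert w S), f S) \<in> opposite_faces Q"
      using insert.prems unfolding opposite_faces_def by blast
    from glue_class_eq[OF this] insert show ?case by simp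
  qed
  show ?thesis
  proof
    show "f ?S \<in> topspace (unit_cube Q)" by (rule f) auto
    show "f ?S v < 1" if "v \<in> Q" for v
      using x that by (auto simp: f_def unit_cube_def PiE_iff less_le)
    show "cplx_point Q x = cplx_point Q (f ?S)"
      using eq[of ?S] \<open>finite Q\<close> by (simp add: cplx_point_def)
  qed
qed

text \<open>Coordinates in \<open>[0, 1)\<close> are determined by their exponentials. So the two
  points agree on \<open>Q \<inter> Q'\<close> and vanish elsewhere: they are represented by the
  same point of the common subcube, and one generating identification joins them.\<close>

lemma cplx_point_eq:
  assumes Q: "Q \<in> cliques V E" "Q' \<in> cliques V E"
    and x: "x \<in> topspace (unit_cube Q)" "x' \<in> topspace (unit_cube Q')"
    and x1: "\<And>v. v \<in> Q \<Longrightarrow> x v < 1" "\<And>v. v \<in> Q' \<Longrightarrow> x' v < 1"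
    and eq: "cube_cexp Q x = cube_cexp Q' x'"
  shows "cplx_point Q x = cplx_point Q' x'"
proof -
  let ?z = "restrict x (Q \<inter> Q')"
  have pos: "v \<in> Q \<Longrightarrow> 0 \<le> x v" "v \<in> Q' \<Longrightarrow> 0 \<le> x' v" for v
    using x by (auto simp: unit_cube_def PiE_iff)
  have both: "x v = x' v" if "v \<in> Q" "v \<in> Q'" for v
    using fun_cong[OF eq, of v] that pos x1 by (intro cis_inject) (auto simp: cube_cexp_def)
  have left: "x v = 0" if "v \<in> Q" "v \<notin> Q'" for v
    using fun_cong[OF eq, of v] that pos x1 by (intro cis_inject) (auto simp: cube_cexp_def)
  have right: "x' v = 0" if "v \<in> Q'" "v \<notin> Q" for v
    using fun_cong[OF eq, of v] that pos x1 by (intro cis_inject) (auto simp: cube_cexp_def)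
  have "(\<lambda>v\<in>Q. if v \<in> Q \<inter> Q' then ?z v else 0) = x"
    using x(1) left by (auto simp: unit_cube_def PiE_iff extensional_def fun_eq_iff)
  moreover have "(\<lambda>v\<in>Q'. if v \<in> Q \<inter> Q' then ?z v else 0) = x'"
    using x(2) right both by (auto simp: unit_cube_def PiE_iff extensional_def fun_eq_iff)
  moreover have "?z \<in> topspace (unit_cube (Q \<inter> Q'))"
    using x(1) by (auto simp: unit_cube_def PiE_iff)
  ultimately have "((Q, glue_class (opposite_faces Q) x), (Q', glue_class (opposite_faces Q') x'))
      \<in> torus_identification V E"
    using Q unfolding torus_identification_def subtorus_point_def
    by (intro CollectI exI[of _ Q] exI[of _ Q'] exI[of _ ?z]) simp
  then show ?thesis unfolding cplx_point_def by (rule glue_class_eq)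
qed

text \<open>A continuous bijection from a compact space to a Hausdorff space. Injectivity says that
  the identifications of faces and of subtori account for all coincidences in the big torus.\<close>

theorem homeomorphic_map_graph_complex: "homeomorphic_map (graph_complex V E) (top_of_set TC) cplx_cexp"
proof (rule continuous_imp_homeomorphic_map)
  have sub: "cube_cexp Q x \<in> TC" if "Q \<in> cliques V E" for Q x
  proof -
    have "{v. cube_cexp Q x v \<noteq> 1} \<subseteq> Q" by (auto simp: cube_cexp_def)
    with that show ?thesis using cliques_subset by (auto simp: TC_def cube_cexp_def)
  qed
  have "z \<in> cplx_cexp ` topspace (graph_complex V E)" if z: "z \<in> TC" for z
  proof -
    \<comment> \<open>The non-trivial coordinates of \<open>z\<close> form a clique; the point is
      found in the torus of exactly that clique.\<close>
    let ?Q = "{v. z v \<noteq> 1}"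
    define y where "y = clog ?Q z"
    let ?x = "\<lambda>v\<in>?Q. y v - of_int \<lfloor>y v\<rfloor>"
    have "cube_cexp ?Q ?x v = z v" for v
      using fun_cong[OF cexp_shift[of y "\<lambda>v. \<lfloor>y v\<rfloor>"], of v] fun_cong[OF cexp_clog[OF z, of ?Q], of v]
      by (simp add: cube_cexp_def cexp_def y_def)
    then have "z = cplx_cexp (cplx_point ?Q ?x)" by (simp add: cplx_cexp_point fun_eq_iff)
    moreover have "?x \<in> topspace (unit_cube ?Q)"
    proof -
      have "0 \<le> y v - of_int \<lfloor>y v\<rfloor> \<and> y v - of_int \<lfloor>y v\<rfloor> \<le> 1" for v by linarith
      then show ?thesis by (auto simp: unit_cube_def)
    qed
    moreover have "?Q \<in> cliques V E" using z by (simp add: TC_def)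
    ultimately show ?thesis unfolding topspace_graph_complex by blast
  qed
  then show img: "cplx_cexp ` topspace (graph_complex V E) = topspace (top_of_set TC)"
    using sub by (auto simp: topspace_graph_complex cplx_cexp_point)
  show "continuous_map (graph_complex V E) (top_of_set TC) cplx_cexp"
    using continuous_cplx_cexp img by (auto simp: continuous_map_in_subtopology)
  show "inj_on cplx_cexp (topspace (graph_complex V E))"
  proof (rule inj_onI)
    fix a b assume ab: "a \<in> topspace (graph_complex V E)" "b \<in> topspace (graph_complex V E)"
      "cplx_cexp a = cplx_cexp b"
    obtain Q x Q' x' where 1: "a = cplx_point Q x" "Q \<in> cliques V E" "x \<in> topspace (unit_cube Q)"
      and 2: "b = cplx_point Q' x'" "Q' \<in> cliques V E" "x' \<in> topspace (unit_cube Q')"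
      using ab(1,2) unfolding topspace_graph_complex by blast
    obtain y where y: "y \<in> topspace (unit_cube Q)" "\<And>v. v \<in> Q \<Longrightarrow> y v < 1" "cplx_point Q x = cplx_point Q y"
      by (rule cplx_point_normalize[OF 1(3,2)]) blast
    obtain y' where y': "y' \<in> topspace (unit_cube Q')" "\<And>v. v \<in> Q' \<Longrightarrow> y' v < 1"
      "cplx_point Q' x' = cplx_point Q' y'"
      by (rule cplx_point_normalize[OF 2(3,2)]) blast
    have "cube_cexp Q y = cube_cexp Q' y'"
      using ab(3) 1(1) 2(1) y(3) y'(3) by (simp add: cplx_cexp_point)
    from cplx_point_eq[OF 1(2) 2(2) y(1) y'(1) y(2) y'(2) this] show "a = b"
      using 1(1) 2(1) y(3) y'(3) by simp
  qed
qed (intro compact_graph_complex Hausdorff_space_subtopology Hausdorff_space_euclidean_fun)+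

end

theorem theorem7p2:
  fixes V :: "'v set" and E :: "'v set set"
  assumes "finite_simplicial_graph V E"
  shows "path_connected_space (graph_complex V E) \<and>
    (\<forall>x\<in>topspace (graph_complex V E). fundamental_group (graph_complex V E) x \<cong> graph_group V E) \<and>
    (\<exists>(C :: (real \<Rightarrow> 'v torus_sum_point set) set topology) p.
      universal_covering C p (graph_complex V E)) \<and>
    (\<forall>(C :: 'c topology) p. universal_covering C p (graph_complex V E) \<longrightarrow> contractible_space C)"
proof -
  interpret simplicial_graph V E by unfold_locales (rule assms)
  let ?X = "graph_complex V E" and ?U = "top_of_set UC"
  \<comment> \<open>The inverse homeomorphism moves the covering of the torus subspace
    \<open>TC\<close> to a covering of the complex itself.\<close>
  obtain k where "homeomorphic_maps ?X (top_of_set TC) cplx_cexp k"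
    using homeomorphic_map_graph_complex unfolding homeomorphic_map_maps by (elim exE) (rule that)
  then have "homeomorphic_maps (top_of_set TC) ?X k cplx_cexp" by (rule iffD1[OF homeomorphic_maps_sym])
  then have k: "homeomorphic_map (top_of_set TC) ?X k" unfolding homeomorphic_map_maps by (rule exI[of _ cplx_cexp])
  let ?p = "k \<circ> pr"
  have cov: "covering_map ?U ?p ?X" by (rule covering_map_homeomorphic_target[OF covering_map_pr k])
  have b0: "\<sigma> \<one>\<^bsub>G\<^esub> (\<lambda>_. 0) \<in> topspace ?U" using UC_I[OF G.one_closed clique_supp_zero] by simp
  have "path_connectedin ?U (topspace ?U)"
    using contractible_imp_path_connected_space[OF contractible_UC] by (simp only: path_connectedin_topspace)
  from path_connectedin_continuous_map_image[OF covering_map_continuous[OF cov] this]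
  have "path_connected_space ?X"
    unfolding covering_map_image[OF cov] by (simp only: path_connectedin_topspace)
  moreover have "fundamental_group ?X x \<cong> G" if x: "x \<in> topspace ?X" for x
  proof (rule fundamental_group_regular_covering[OF cov contractible_UC group_G _ _ _ _ _ x])
    show "continuous_map ?U ?U (act a)" if "a \<in> carrier G" for a by (rule continuous_map_act[OF that])
    show "act (a \<otimes>\<^bsub>G\<^esub> b) c = act a (act b c)" if "a \<in> carrier G" "b \<in> carrier G" for a b c
      by (rule act_mult[OF that])
    show "?p (act a c) = ?p c" if "a \<in> carrier G" "c \<in> topspace ?U" for a c
      using pr_act(2)[OF that(1)] that(2) by simp
    show "a = b" if "a \<in> carrier G" "b \<in> carrier G" "c \<in> topspace ?U" "act a c = act b c" for a b c
      using act_free[OF that(1,2) _ that(4)] that(3) by simp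
    show "\<exists>a\<in>carrier G. c' = act a c" if "c \<in> topspace ?U" "c' \<in> topspace ?U" "?p c = ?p c'" for c c'
    proof -
      have "pr c \<in> TC" "pr c' \<in> TC" using that(1,2) continuous_map_pr by (auto simp: continuous_map_def)
      then have "pr c = pr c'"
        using homeomorphic_imp_injective_map[OF k] that(3) by (auto dest: inj_onD)
      then show ?thesis using pr_transitive that(1,2) by simp
    qed
  qed
  moreover have "\<exists>(C :: (real \<Rightarrow> 'v torus_sum_point set) set topology) p. universal_covering C p ?X"
    by (rule universal_covering_on_path_classes[OF cov contractible_UC b0])
  moreover have "contractible_space C" if "universal_covering C p ?X" for C :: "'c topology" and p
    by (rule universal_covering_contractible[OF cov contractible_UC _ that]) (use b0 in blast)
  ultimately show ?thesis by blast
qed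

end
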